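(* Let $H\in\{P_6,N,W\}$ and let $G$ be a 2-connected claw-free graph on $n$ vertices. If $G$ satisfies $\varPhi(H,3)$, i.e. every vertex $v$ of $G$ that is an end-vertex of some induced subgraph of $G$ isomorphic to $H$ has $d_G(v)\geq (n+3)/3$, then $G$ is hamiltonian.
   Context: All graphs are finite and simple. A graph is claw-free if it has no induced subgraph isomorphic to $K_{1,3}$. An end-vertex of a graph $H$ is a vertex of degree $1$ in $H$. For a graph $G$ on $n$ vertices, a graph $H$ and a number $k$, $G$ satisfies $\varPhi(H,k)$ if every vertex $v$ of $G$ which is an end-vertex of an induced copy of $H$ in $G$ satisfies $d_G(v)\geq (n+k)/3$. $P_6$ is the path on $6$ vertices. $N$ (the net) is the graph obtained from a triangle by attaching one pendant edge at each of its three vertices. $W$ (the wounded) is the graph obtained from a triangle $xyz$ by adding a new vertex adjacent only to $y$, and a path $z u w$ with two new vertices $u,w$ (so $u$ is adjacent to $z$ and $w$, and $w$ only to $u$). *)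

theory Defs
  imports "Graph_Theory.Graph_Theory"
begin

text \<open>
  Finite simple graphs are the library's \<^locale>\<open>graph\<close>: finite symmetric digraphs without loops
  and without parallel arcs, in which an edge \<open>uv\<close> is the pair of arcs \<open>u \<rightarrow> v\<close> and \<open>v \<rightarrow> u\<close>.
\<close>

text \<open>In such a graph the arcs leaving \<open>v\<close> correspond to the neighbours of \<open>v\<close>.\<close>

abbreviation degree :: "('a, 'b) pre_digraph \<Rightarrow> 'a \<Rightarrow> nat" where
  "degree \<equiv> out_degree"

definition end_vertex :: "('a, 'b) pre_digraph \<Rightarrow> 'a \<Rightarrow> bool" where
  "end_vertex H v \<longleftrightarrow> v \<in> verts H \<and> degree H v = 1"

definition undirected :: "'a set \<Rightarrow> ('a \<times> 'a) set \<Rightarrow> ('a, 'a \<times> 'a) pre_digraph" where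
  "undirected V E = with_proj \<lparr> pverts = V, parcs = E \<union> E\<inverse> \<rparr>"

text \<open>The path on \<open>n\<close> vertices.\<close>

definition path_graph :: "nat \<Rightarrow> (nat, nat \<times> nat) pre_digraph" where
  "path_graph n = undirected {..<n} {(i, Suc i) | i. Suc i < n}"

definition net :: "(nat, nat \<times> nat) pre_digraph" where
  "net = undirected {..<6} {(0, 1), (1, 2), (0, 2), (0, 3), (1, 4), (2, 5)}"

text \<open>Triangle \<open>x y z = 0 1 2\<close>, the pendant vertex \<open>3\<close> at \<open>y\<close>, and the path \<open>z u w = 2 4 5\<close>.\<close>

definition wounded :: "(nat, nat \<times> nat) pre_digraph" where
  "wounded = undirected {..<6} {(0, 1), (1, 2), (0, 2), (1, 3), (2, 4), (4, 5)}"

definition claw_free :: "('a, 'b) pre_digraph \<Rightarrow> bool" where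
  "claw_free G \<longleftrightarrow> \<not> (\<exists>C. induced_subgraph C G \<and> K\<^bsub>1,3\<^esub> C)"

text \<open>
  More than \<open>k\<close> vertices, and no set of fewer than \<open>k\<close> vertices separates the graph; in particular
  a 2-connected graph has at least three vertices.
\<close>

definition k_connected :: "nat \<Rightarrow> ('a, 'b) pre_digraph \<Rightarrow> bool" where
  "k_connected k G \<longleftrightarrow> card (verts G) > k \<and>
     (\<forall>X. X \<subseteq> verts G \<and> card X < k \<longrightarrow> connected (G \<restriction> (verts G - X)))"

text \<open>
  A cycle in the sense of \<^const>\<open>pre_digraph.cycle\<close> is a nonempty list of consecutive arcs,
  the vertices on it being their tails. The closed walk \<open>u, v, u\<close> along a single edge is such a
  cycle, so length at least three has to be demanded.
\<close>

definition hamiltonian :: "('a, 'b) pre_digraph \<Rightarrow> bool" where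
  "hamiltonian G \<longleftrightarrow>
     (\<exists>p. pre_digraph.cycle G p \<and> length p \<ge> 3 \<and> tail G ` set p = verts G)"

definition satisfies_Phi ::
  "('a, 'b) pre_digraph \<Rightarrow> ('c, 'd) pre_digraph \<Rightarrow> real \<Rightarrow> bool" where
  "satisfies_Phi G H k \<longleftrightarrow>
     (\<forall>v \<in> verts G. (\<exists>S. induced_subgraph S G \<and> digraph_iso S H \<and> end_vertex S v) \<longrightarrow>
        real (degree G v) \<ge> (real (card (verts G)) + k) / 3)"

end

(*
  Ryjacek's closure turns the claw-free graph E into a graph F without claws and induced diamonds
  that is hamiltonian only if E is; every maximal clique ("region") of F induces a connected subgraph
  of E. If F is not hamiltonian, an induced cycle dominating as many vertices as possible, inside a
  smallest 2-connected nonhamiltonian induced subgraph, misses some vertex; a path through the missed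
  part attached at two places of the cycle gives one of Brousek's graphs: two triangles joined by
  three arms, each of which has at least three vertices or has two vertices with a private common
  neighbour.

  Call v heavy if 3 d(v) >= n + 3. In F two nonadjacent vertices have at most two common neighbours,
  so three heavy vertices, pairwise nonadjacent in F, would make F hamiltonian. Induced subgraphs of
  F are lifted to E by replacing edges with induced paths inside regions; the interior vertices of
  such a path have no neighbours outside the region. Lifting long paths of Brousek's graph makes a
  middle vertex of each arm heavy when H is the path. When H is the net or the wounded graph, each of
  the two triangles lifts to a triangle with three long arms, whose first vertices are heavy. Three of
  these six heavy vertices are independent, unless all of them lie in the two cliques of F that
  contain the triangles, and then the cliques would be too large.
*)
theory Submission
  imports Defs
begin

section \<open>Local completion and the closure\<close>

text \<open>The constant 3 in the degree condition comes from a count in \<open>F\<close>. Three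
  vertices independent in \<open>F\<close> have no common neighbour and share at most two neighbours
  pairwise, so their degrees sum to at most (n - 3) + 6. Equality can occur, and then the six shared
  neighbours form a dominating induced hexagon. The obstacle is that copies of \<open>H\<close> are
  induced in \<open>E\<close>, while the count needs independence in \<open>F\<close>: heavy
  vertices of one lifted net are nonadjacent in \<open>E\<close> but may share a clique of
  \<open>F\<close>. If one of them lies outside its clique, mixing the nets of both triangles gives
  an \<open>F\<close>-independent triple. Otherwise the degrees bound clique sizes from below, and
  cliques meeting pairwise in at most one vertex bound them from above; summed over both triangles,
  2n + 24 is needed and 2n + 20 is available. Maximal domination is what excludes arms that are too
  short: exchanging an arc of the cycle for the attached path must lose a dominated vertex, and this
  vertex becomes the private common neighbour.\<close>

definition sgraph :: "'a set \<Rightarrow> ('a \<Rightarrow> 'a \<Rightarrow> bool) \<Rightarrow> bool" where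
  "sgraph V E \<longleftrightarrow> finite V \<and> (\<forall>x y. E x y \<longrightarrow> x \<in> V \<and> y \<in> V \<and> E y x \<and> x \<noteq> y)"

definition clawfree :: "('a \<Rightarrow> 'a \<Rightarrow> bool) \<Rightarrow> bool" where
  "clawfree E \<longleftrightarrow> (\<forall>x a b c. E x a \<and> E x b \<and> E x c \<and> a \<noteq> b \<and> a \<noteq> c \<and> b \<noteq> c \<longrightarrow>
     E a b \<or> E a c \<or> E b c)"

definition diamondfree :: "('a \<Rightarrow> 'a \<Rightarrow> bool) \<Rightarrow> bool" where
  "diamondfree E \<longleftrightarrow> (\<forall>a b x y. E a b \<and> E a x \<and> E b x \<and> E a y \<and> E b y \<and> x \<noteq> y \<longrightarrow> E x y)"

definition cyc :: "('a \<Rightarrow> 'a \<Rightarrow> bool) \<Rightarrow> 'a list \<Rightarrow> bool" where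
  "cyc E xs \<longleftrightarrow> 3 \<le> length xs \<and> distinct xs \<and> successively E xs \<and> E (last xs) (hd xs)"

definition ham :: "'a set \<Rightarrow> ('a \<Rightarrow> 'a \<Rightarrow> bool) \<Rightarrow> bool" where
  "ham V E \<longleftrightarrow> (\<exists>xs. cyc E xs \<and> set xs = V)"

definition ham_path :: "'a set \<Rightarrow> ('a \<Rightarrow> 'a \<Rightarrow> bool) \<Rightarrow> 'a \<Rightarrow> 'a \<Rightarrow> 'a list \<Rightarrow> bool" where
  "ham_path V E b c xs \<longleftrightarrow> xs \<noteq> [] \<and> distinct xs \<and> successively E xs \<and> hd xs = b \<and> last xs = c \<and> set xs = V"

lemma sgraphD:
  assumes "sgraph V E" "E x y"
  shows "x \<in> V" "y \<in> V" "E y x" "x \<noteq> y" "y \<noteq> x"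
  using assms unfolding sgraph_def by blast+

lemma clawfreeD:
  assumes "clawfree E" "E x a" "E x b" "E x c" "a \<noteq> b" "a \<noteq> c" "b \<noteq> c"
  shows "E a b \<or> E a c \<or> E b c"
  using assms unfolding clawfree_def by blast

lemma diamondfreeD:
  assumes "diamondfree E" "E a b" "E a x" "E b x" "E a y" "E b y" "x \<noteq> y"
  shows "E x y"
  using assms unfolding diamondfree_def by blast

lemma successively_rev_sym:
  assumes "\<And>x y. E x y \<Longrightarrow> E y x"
  shows "successively (\<lambda>x y. E y x) xs = successively E xs"
  using assms by (metis successively_mono)

lemma sgraph_rev:
  assumes "sgraph V E"
  shows "successively (\<lambda>x y. E y x) xs = successively E xs"
  using assms successively_rev_sym sgraphD(3) by metis

lemma not_successively_split:
  "\<not> successively P xs \<Longrightarrow> \<exists>A u v B. xs = A @ u # v # B \<and> \<not> P u v"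
proof (induction xs rule: induct_list012)
  case (3 x y zs)
  show ?case
  proof (cases "P x y")
    case True
    with 3 obtain A u v B where "y # zs = A @ u # v # B" "\<not> P u v" by auto
    then have "x # y # zs = (x # A) @ u # v # B \<and> \<not> P u v" by simp
    then show ?thesis by blast
  next
    case False
    then have "x # y # zs = [] @ x # y # zs \<and> \<not> P x y" by simp
    then show ?thesis by blast
  qed
qed auto

lemma cyc_rotate1:
  assumes "cyc E (A @ B)"
  shows "cyc E (B @ A)"
  using assms unfolding cyc_def
  by (cases "A = []"; cases "B = []") (auto simp: successively_append_iff)

text \<open>If the extra edge occurs on the cycle, rotating until it is the closing edge leaves a
  path of \<open>F\<close> between \<open>b\<close> and \<open>c\<close>. It cannot occur twice,
  because the cycle has at least three distinct vertices.\<close>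

lemma ham_pathI_cyc:
  assumes "cyc (\<lambda>u v. F u v \<or> u = b \<and> v = c \<or> u = c \<and> v = b) xs" "\<And>x y. F x y \<Longrightarrow> F y x"
  shows "cyc F xs \<or> (\<exists>ys. ham_path (set xs) F b c ys)"
proof -
  let ?F = "\<lambda>u v. F u v \<or> u = b \<and> v = c \<or> u = c \<and> v = b"
  have main: "\<exists>ys. ham_path (set zs) F b c ys"
    if z: "cyc ?F zs" and bc: "\<not> F (last zs) (hd zs)" for zs
  proof -
    have bc': "last zs = b \<and> hd zs = c \<or> last zs = c \<and> hd zs = b"
      using z bc unfolding cyc_def by blast
    have s: "successively F zs"
    proof (rule ccontr)
      assume "\<not> successively F zs"
      then obtain A u v B where zs: "zs = A @ u # v # B" and uv: "\<not> F u v"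
        using not_successively_split by blast
      have "?F u v" using z unfolding cyc_def zs by (auto simp: successively_append_iff)
      with uv have "{u, v} = {last zs, hd zs}" using bc' by auto
      moreover have "distinct zs" "3 \<le> length zs" using z unfolding cyc_def by auto
      ultimately show False unfolding zs
        by (cases A; cases B rule: rev_cases) (auto simp: doubleton_eq_iff)
    qed
    have ne: "zs \<noteq> []" "distinct zs" using z unfolding cyc_def by auto
    show ?thesis
    proof (cases "last zs = c")
      case True
      then have "ham_path (set zs) F b c zs" using bc' s ne unfolding ham_path_def by auto
      then show ?thesis by blast
    next
      case False
      then have "ham_path (set zs) F b c (rev zs)"
        using bc' s ne successively_rev_sym[of F, OF assms(2)] unfolding ham_path_def by (auto simp: hd_rev last_rev)
      then show ?thesis by blast
    qed
  qed
  show ?thesis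
  proof (cases "F (last xs) (hd xs)")
    case True
    show ?thesis
    proof (cases "successively F xs")
      case s: True
      then show ?thesis using True assms(1) unfolding cyc_def by blast
    next
      case False
      then obtain A u v B where xs: "xs = A @ u # v # B" and uv: "\<not> F u v"
        using not_successively_split by blast
      have "cyc ?F ((v # B) @ (A @ [u]))"
        using assms(1) cyc_rotate1[of ?F "A @ [u]" "v # B"] unfolding xs by simp
      moreover have "\<not> F (last ((v # B) @ (A @ [u]))) (hd ((v # B) @ (A @ [u])))"
        using uv by simp
      ultimately have "\<exists>ys. ham_path (set ((v # B) @ (A @ [u]))) F b c ys" by (rule main)
      moreover have "set ((v # B) @ (A @ [u])) = set xs" unfolding xs by auto
      ultimately show ?thesis by simp
    qed
  next
    case False
    then show ?thesis using main[OF assms(1)] by blast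
  qed
qed

lemma ham_intro:
  assumes "distinct xs" "successively E xs" "E (last xs) (hd xs)" "3 \<le> length xs" "set xs = V"
  shows "ham V E"
  using assms unfolding ham_def cyc_def by blast

definition compl :: "('a \<Rightarrow> 'a \<Rightarrow> bool) \<Rightarrow> 'a \<Rightarrow> 'a \<Rightarrow> 'a \<Rightarrow> bool" where
  "compl E x u v \<longleftrightarrow> E u v \<or> E x u \<and> E x v \<and> u \<noteq> v"

text \<open>
  A graph between a claw-free graph and its local completion at \<open>x\<close>: the new edges of the
  completion can be deleted one at a time, so that no minimal choice of a cycle is needed.
\<close>

locale between =
  fixes V :: "'a set" and E F :: "'a \<Rightarrow> 'a \<Rightarrow> bool" and x :: 'a
  assumes gE: "sgraph V E" and gF: "sgraph V F" and cf: "clawfree E"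
    and EF: "\<And>u v. E u v \<Longrightarrow> F u v" and FE: "\<And>u v. F u v \<Longrightarrow> compl E x u v"
begin

lemmas symE = sgraphD(3)[OF gE]
lemmas irrE = sgraphD(4,5)[OF gE]
lemmas symF = sgraphD(3)[OF gF]
lemmas flip = sgraph_rev[OF gF]
lemmas path_simps = Suc_le_eq flip successively_append_iff successively_Cons hd_rev last_rev

lemma at_x: "F x u \<Longrightarrow> E x u" "F u x \<Longrightarrow> E x u"
  using FE[of x u] FE[of u x] irrE symE unfolding compl_def by blast+

lemma new_edge: "F u v \<Longrightarrow> \<not> E u v \<Longrightarrow> E x u \<and> E x v"
  using FE[of u v] unfolding compl_def by blast

lemma cover:
  assumes "E x b" "E x c" "b \<noteq> c" "\<not> E b c" "E x w" "w \<noteq> b" "w \<noteq> c"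
  shows "E w b \<or> E w c"
  using clawfreeD[OF cf, of x b c w] assms symE by blast

lemma split_at_x:
  assumes "ham_path V F b c xs" "E x b" "E x c"
  obtains ys zs where "xs = ys @ x # zs" "ys \<noteq> []" "zs \<noteq> []" "hd ys = b" "last zs = c"
proof -
  have "x \<in> set xs" using assms sgraphD(1)[OF gE] unfolding ham_path_def by blast
  then obtain ys zs where xs: "xs = ys @ x # zs" using split_list by metis
  have "ys \<noteq> []" using assms irrE(1)[of x b] xs unfolding ham_path_def by (cases ys) auto
  moreover have "zs \<noteq> []" using assms irrE(1)[of x c] xs unfolding ham_path_def by (cases zs) auto
  moreover have "hd ys = b" "last zs = c" using assms xs calculation unfolding ham_path_def by auto
  ultimately show ?thesis using that xs by blast
qed

text \<open>If the neighbour of \<open>x\<close> on one side of the path sees the far end, reversing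
  one segment gives a Hamiltonian cycle. Otherwise, as every neighbour of \<open>x\<close> sees
  \<open>b\<close> or \<open>c\<close>, the two path neighbours of \<open>x\<close> belong to their
  own ends.\<close>

lemma path_bounds:
  assumes "ham_path V F b c (ys @ x # zs)" "ys \<noteq> []" "zs \<noteq> []" "E x b" "E x c" "b \<noteq> c" "\<not> E b c"
  shows "E x (last ys)" "E x (hd zs)" "E (last ys) c \<Longrightarrow> ham V F" "E b (hd zs) \<Longrightarrow> ham V F"
    "\<not> ham V F \<Longrightarrow> last ys = b \<or> E (last ys) b" "\<not> ham V F \<Longrightarrow> hd zs = c \<or> E (hd zs) c"
proof -
  have p: "distinct (ys @ x # zs)" "successively F (ys @ x # zs)" "hd ys = b" "last zs = c"
    "set (ys @ x # zs) = V"
    using assms(1-3) unfolding ham_path_def by auto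
  have sp: "successively F ys" "successively F zs" "F (last ys) x" "F x (hd zs)"
    using p(2) assms(2,3) by (auto simp: successively_append_iff successively_Cons)
  show 1: "E x (last ys)" "E x (hd zs)" using sp at_x by blast+
  have sF: "F x (last ys)" "F (hd zs) x" using sp symF by blast+
  have len: "3 \<le> length (ys @ x # zs)" using assms(2,3) by (cases ys; cases zs) auto
  show 2: "ham V F" if "E (last ys) c"
    by (rule ham_intro[of "ys @ rev zs @ [x]"])
      (use that p sp sF assms(2-5) len in \<open>auto simp: path_simps intro: EF symE symF\<close>)
  show 3: "ham V F" if "E b (hd zs)"
    by (rule ham_intro[of "rev ys @ zs @ [x]"])
      (use that p sp sF assms(2-5) len in \<open>auto simp: path_simps intro: EF symE symF\<close>)
  show "last ys = b \<or> E (last ys) b" if "\<not> ham V F"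
  proof -
    have "last ys \<noteq> c" using p(1,4) assms(2,3) by (metis disjoint_iff distinct_append last_ConsR last_in_set list.distinct(1) set_ConsD)
    then show ?thesis using cover[OF assms(4-7) 1(1)] 2 that by blast
  qed
  show "hd zs = c \<or> E (hd zs) c" if "\<not> ham V F"
  proof -
    have "hd zs \<in> set zs" "b \<in> set ys" using p(3) assms(2,3) by auto
    then have "hd zs \<noteq> b" using p(1) by auto
    then show ?thesis using cover[OF assms(4-7) 1(2)] 3 that symE by blast
  qed
qed

lemma pathD:
  assumes "ham_path V F b c xs"
  shows "distinct xs" "successively F xs" "hd xs = b" "last xs = c" "set xs = V"
  using assms unfolding ham_path_def by auto

lemma rev_path:
  assumes "ham_path V F b c xs"
  shows "ham_path V F c b (rev xs)"
  using assms unfolding ham_path_def by (simp add: hd_rev last_rev flip)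

lemma close_path:
  assumes "ham_path V F b c xs" "E x b" "E x c" "E b c"
  shows "ham V F"
proof -
  obtain ys zs where xs: "xs = ys @ x # zs" "ys \<noteq> []" "zs \<noteq> []"
    using split_at_x[OF assms(1-3)] by metis
  have "3 \<le> length xs" using xs by (cases ys; cases zs) auto
  then show ?thesis using pathD[OF assms(1)] symF[OF EF[OF assms(4)]] ham_intro[of xs F V] by simp
qed

text \<open>
  The claws at \<open>x\<close> and at \<open>p\<close> force either a Hamiltonian cycle at once or the edges from
  \<open>last P2\<close> to \<open>b\<close> and from \<open>hd P2\<close> to \<open>c\<close>, which re-route the path through \<open>p, x\<close>.
\<close>

lemma close_common_nbr_left:
  assumes h: "ham_path V F b c (ys @ x # zs)" and ys: "ys = P1 @ p # P2" and zs: "zs \<noteq> []"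
    and b: "E x b" and c: "E x c" and bc: "b \<noteq> c" "\<not> E b c"
    and p: "E x p" "E p b" "E p c"
  shows "ham V F"
proof (rule ccontr)
  assume nh: "\<not> ham V F"
  have ne: "ys \<noteq> []" using ys by auto
  note B = path_bounds[OF h ne zs b c bc]
  note D = pathD[OF h]
  have P1: "P1 \<noteq> []" using D(3) irrE(1)[OF p(2)] unfolding ys by (cases P1) auto
  have P2: "P2 \<noteq> []" using B(3) nh p(3) unfolding ys by (cases P2) auto
  have hb: "hd P1 = b" "last zs = c" using D(3,4) P1 zs unfolding ys by auto
  have lb: "last P2 \<noteq> b" using D(1) hb P1 P2 unfolding ys
    by (metis Un_iff append_Cons append_assoc disjoint_iff distinct_append hd_in_set last_in_set list.set_intros(2) set_append)
  have x1: "E (last P2) b" using B(5)[OF nh] lb P2 unfolding ys by simp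
  have S: "successively F P1" "successively F P2" "successively F zs" "F (last P1) p" "F p (hd P2)"
     "F (last P2) x" "F x (hd zs)"
    using D(2) P1 P2 zs unfolding ys by (auto simp: successively_append_iff successively_Cons)
  have dP: "hd P2 \<noteq> b" "hd P2 \<noteq> c" using D(1) hb P1 P2 zs unfolding ys
    by (metis Un_iff append_Cons append_assoc disjoint_iff distinct_append hd_in_set last_in_set list.set_intros(2) set_append)+
  have n2: "\<not> E (hd P2) b"
  proof
    assume a: "E (hd P2) b"
    have "ham V F"
      by (rule ham_intro[of "P1 @ [p] @ rev (P2 @ x # zs)"])
        (use D S P1 P2 zs hb EF[OF p(3)] EF[OF a] symF[OF S(6)] symF[OF S(7)] ys in
          \<open>auto simp: path_simps Suc_le_eq\<close>)
    then show False using nh by blast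
  qed
  \<comment> \<open>If \<open>p\<close> and \<open>hd P2\<close> are adjacent in \<open>E\<close>,
    the claw is at \<open>p\<close>. If that edge is new, then \<open>hd P2\<close> is a neighbour
    of \<open>x\<close> and the claw is at \<open>x\<close>.\<close>
  have pc: "E (hd P2) c"
  proof (cases "E p (hd P2)")
    case True
    then show ?thesis using clawfreeD[OF cf, of p b c "hd P2"] p n2 dP bc symE by blast
  next
    case False
    then have "E x (hd P2)" using new_edge S(5) by blast
    then show ?thesis using cover[OF b c bc _ dP] n2 by blast
  qed
  have "ham V F"
    by (rule ham_intro[of "P1 @ [p, x] @ zs @ P2"])
      (use D S P1 P2 zs hb EF[OF x1] EF[OF symE[OF p(1)]] EF[OF symE[OF pc]] ys in
        \<open>auto simp: Suc_le_eq successively_append_iff successively_Cons\<close>)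
  then show False using nh by blast
qed

lemma close_common_nbr:
  assumes h: "ham_path V F b c xs" and b: "E x b" and c: "E x c" and bc: "b \<noteq> c"
    and p: "E x p" "E p b" "E p c"
  shows "ham V F"
proof (cases "E b c")
  case True
  then show ?thesis using close_path h b c by blast
next
  case False
  obtain ys zs where xs: "xs = ys @ x # zs" and ne: "ys \<noteq> []" "zs \<noteq> []"
    using split_at_x[OF h b c] by metis
  have "p \<in> set xs" "p \<noteq> x" using pathD(5)[OF h] sgraphD(2)[OF gE p(1)] irrE p by auto
  then consider "p \<in> set ys" | "p \<in> set (rev zs)" using xs by auto
  then show ?thesis
  proof cases
    case 1
    then obtain P1 P2 where "ys = P1 @ p # P2" using split_list by metis
    then show ?thesis using close_common_nbr_left h[unfolded xs] ne(2) b c bc False p by blast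
  next
    case 2
    then obtain P1 P2 where P: "rev zs = P1 @ p # P2" using split_list by metis
    have "ham_path V F c b (rev zs @ x # rev ys)" using rev_path[OF h] unfolding xs by simp
    then show ?thesis using close_common_nbr_left[OF _ P _ c b] ne(1) bc False p symE by auto
  qed
qed

text \<open>
  Here the neighbourhood of \<open>x\<close> consists of a clique \<open>Kb\<close> around \<open>b\<close> and a clique \<open>Kc\<close> around \<open>c\<close>,
  joined by the edge \<open>p q\<close>. Every rotation that turns \<open>p\<close> into an end of the path reduces to
  the previous lemma; if none applies, \<open>p\<close>, its two neighbours on the path and \<open>x\<close> form a claw.
\<close>

lemma close_linked_nbrs:
  assumes h: "ham_path V F b c xs" and b: "E x b" and c: "E x c" and bc: "b \<noteq> c"
    and p: "E x p" "E p b" and q: "E x q" "E q c" and pq: "E p q"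
  shows "ham V F"
proof (rule ccontr)
  assume nh: "\<not> ham V F"
  have nbc: "\<not> E b c" using close_path[OF h b c] nh by blast
  have nocommon: "\<not> (E w b \<and> E w c)" if "E x w" for w using close_common_nbr[OF h b c bc that] nh by blast
  define Kb where "Kb w \<longleftrightarrow> E x w \<and> (w = b \<or> E w b)" for w
  define Kc where "Kc w \<longleftrightarrow> E x w \<and> (w = c \<or> E w c)" for w
  have Kor: "Kb w \<or> Kc w" if "E x w" for w
    using cover[OF b c bc nbc that] that unfolding Kb_def Kc_def by blast
  have Kdisj: "\<not> (Kb w \<and> Kc w)" for w
    using nocommon nbc bc symE unfolding Kb_def Kc_def by blast
  have Kbc: "E u v" if "Kb u" "Kb v" "u \<noteq> v" for u v
  proof -
    have "u \<noteq> c" "v \<noteq> c" "\<not> E u c" "\<not> E v c" using that Kdisj unfolding Kc_def Kb_def using c by auto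
    then show ?thesis using that clawfreeD[OF cf, of x u v c] c symE unfolding Kb_def by blast
  qed
  have Kcc: "E u v" if "Kc u" "Kc v" "u \<noteq> v" for u v
  proof -
    have "u \<noteq> b" "v \<noteq> b" "\<not> E u b" "\<not> E v b" using that Kdisj unfolding Kc_def Kb_def using b by auto
    then show ?thesis using that clawfreeD[OF cf, of x u v b] b symE unfolding Kc_def by blast
  qed
  have Kp: "Kb p" and Kq: "Kc q" and Kbb: "Kb b" and Kcc': "Kc c"
    using p q b c unfolding Kb_def Kc_def by auto
  \<comment> \<open>A path from \<open>p\<close> to any vertex of \<open>Kc\<close> is enough:
    either it ends in \<open>q\<close> and closes by the edge \<open>p q\<close>, or
    \<open>q\<close> is a common neighbour of its two ends.\<close>
  have endp: False if hp: "ham_path V F p v zs" and v: "Kc v" for v zs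
  proof (cases "v = q")
    case True
    then show False using close_path[OF hp p(1)] nh q(1) pq by blast
  next
    case False
    have "E x v" "p \<noteq> v" using v Kdisj Kp unfolding Kc_def by blast+
    moreover have "E q v" using Kcc[OF Kq v] False by metis
    ultimately show False using close_common_nbr[OF hp p(1), of q] nh q(1) symE[OF pq] by blast
  qed
  obtain ys zs where xs: "xs = ys @ x # zs" and ne: "ys \<noteq> []" "zs \<noteq> []"
    using split_at_x[OF h b c] by metis
  note B = path_bounds[OF h[unfolded xs] ne b c bc nbc]
  note D = pathD[OF h[unfolded xs]]
  have Kl: "Kb (last ys)" and Kh: "Kc (hd zs)"
    using B(1,2) B(5,6)[OF nh] unfolding Kb_def Kc_def by auto
  have hl: "hd ys = b" "last zs = c" using D(3,4) ne by auto
  have pb: "p \<noteq> b" using irrE p(2) by blast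
  have "p \<in> set xs" "p \<noteq> x" using pathD(5)[OF h] sgraphD(2)[OF gE p(1)] irrE p by auto
  then consider "p \<in> set ys" | "p \<in> set zs" using xs by auto
  then show False
  proof cases
    case 1
    then obtain P1 P2 where ys: "ys = P1 @ p # P2" using split_list by metis
    have P1: "P1 \<noteq> []" using hl(1) pb unfolding ys by (cases P1) auto
    have hb: "hd P1 = b" using hl(1) P1 unfolding ys by auto
    have P2: "P2 \<noteq> []"
    proof
      assume P2: "P2 = []"
      have lp: "F (last P1) p" using D(2) P1 unfolding ys by (auto simp: successively_append_iff)
      have "ham_path V F p c (rev ys @ x # zs)"
        using D ne hl P1 hb symF[OF EF[OF b]] symF[OF lp] P2 ys unfolding ham_path_def
        by (simp add: flip successively_append_iff successively_Cons hd_append hd_rev last_rev)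
      then show False using Kcc' by (rule endp)
    qed
    have S: "successively F P1" "successively F P2" "successively F zs" "F (last P1) p" "F p (hd P2)"
       "F (last P2) x" "F x (hd zs)"
      using D(2) P1 P2 ne unfolding ys by (auto simp: successively_append_iff successively_Cons)
    have "last P2 \<notin> set P1" using D(1) last_in_set[OF P2] unfolding ys by auto
    then have "last P2 \<noteq> b" using hb hd_in_set[OF P1] by metis
    then have dis: "hd P2 \<noteq> p" "last P1 \<noteq> p" "last P1 \<noteq> last P2" "last P2 \<noteq> b" "last P1 \<noteq> hd P2" "p \<noteq> last P2"
      using D(1) P1 P2 hb unfolding ys
      by (auto dest: hd_in_set last_in_set)
    have Kl': "Kb (last P2)" using Kl P2 unfolding ys by simp
    have n1: "\<not> E (hd P2) b"
    proof
      assume a: "E (hd P2) b"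
      have "ham_path V F p c (p # rev P1 @ P2 @ x # zs)"
        using D S P1 P2 ne hb ys symF[OF S(4)] EF[OF symE[OF a]] unfolding ham_path_def
        by (auto simp: path_simps)
      then show False using Kcc' by (rule endp)
    qed
    have n2: "\<not> E (last P1) (last P2)"
    proof
      assume a: "E (last P1) (last P2)"
      have "ham_path V F p c (p # P2 @ rev P1 @ x # zs)"
        using D S P1 P2 ne hb ys EF[OF symE[OF a]] EF[OF symE[OF b]] unfolding ham_path_def
        by (auto simp: path_simps)
      then show False using Kcc' by (rule endp)
    qed
    have n3: "\<not> E (last P1) (hd P2)"
    proof
      assume a: "E (last P1) (hd P2)"
      have "E p (last P2)" using Kbc[OF Kp Kl' dis(6)] .
      then have "ham_path V F p c (p # rev P2 @ rev P1 @ x # zs)"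
        using D S P1 P2 ne hb ys EF[OF symE[OF a]] EF[OF symE[OF b]] EF unfolding ham_path_def
        by (auto simp: path_simps)
      then show False using Kcc' by (rule endp)
    qed
    have Elb: "E (last P2) b" using Kl' dis unfolding Kb_def by blast
    have n4: "\<not> E x (hd P2)"
    proof
      assume "E x (hd P2)"
      then consider "Kb (hd P2)" | "Kc (hd P2)" using Kor by blast
      then show False
      proof cases
        case 1
        have "hd P2 \<notin> set P1" using D(1) hd_in_set[OF P2] unfolding ys by auto
        then have "hd P2 \<noteq> b" using hb hd_in_set[OF P1] by metis
        then show False using n1 1 unfolding Kb_def by blast
      next
        case 2
        have "hd P2 \<notin> set zs" using D(1) hd_in_set[OF P2] unfolding ys by auto
        then have "c \<noteq> hd P2" using hl(2) last_in_set[OF ne(2)] by metis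
        then have "E c (hd P2)" using Kcc Kcc' 2 by blast
        then have "ham V F"
          by (intro ham_intro[of "P1 @ [p, x] @ zs @ P2"])
            (use D S P1 P2 ne hl hb EF[OF Elb] EF[OF symE[OF p(1)]] EF ys in
              \<open>auto simp: Suc_le_eq successively_append_iff successively_Cons\<close>)
        then show False using nh by blast
      qed
    qed
    have n5: "\<not> E x (last P1)"
    proof
      assume "E x (last P1)"
      then consider "Kb (last P1)" | "Kc (last P1)" using Kor by blast
      then show False
      proof cases
        case 1
        then show False using n2 Kbc Kl' dis(3) by blast
      next
        case 2
        have "last P1 \<notin> set zs" using D(1) last_in_set[OF P1] unfolding ys by auto
        then have "c \<noteq> last P1" using hl(2) last_in_set[OF ne(2)] by metis
        then have lc: "F (last P1) c" using Kcc[OF 2 Kcc'] EF by blast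
        have "ham V F"
          by (intro ham_intro[of "P1 @ rev zs @ [x] @ rev P2 @ [p]"])
            (use D S P1 P2 ne hl hb EF[OF p(2)] symF[OF S(5)] symF[OF S(6)] symF[OF S(7)] lc ys in
              \<open>auto simp: path_simps\<close>)
        then show False using nh by blast
      qed
    qed
    \<comment> \<open>Edges of \<open>F\<close> outside \<open>E\<close> have both ends adjacent to
      \<open>x\<close>, so the two path edges at \<open>p\<close> lie in \<open>E\<close> and the
      claw can be formed there.\<close>
    have e: "E p (last P1)" "E p (hd P2)" using new_edge[OF S(4)] new_edge[OF S(5)] n4 n5 symE by blast+
    have "last P1 \<noteq> x" "hd P2 \<noteq> x" using D(1) last_in_set[OF P1] hd_in_set[OF P2] unfolding ys by auto
    then have "E (last P1) (hd P2) \<or> E (last P1) x \<or> E (hd P2) x"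
      by (rule clawfreeD[OF cf e symE[OF p(1)] dis(5)])
    then show False using n3 n4 n5 symE by blast
  next
    case 2
    then obtain Q1 Q2 where zs: "zs = Q1 @ p # Q2" using split_list by metis
    have pc: "\<not> Kc p" using Kdisj Kp by blast
    have Q1: "Q1 \<noteq> []" using Kh pc unfolding zs by (cases Q1) auto
    have Q2: "Q2 \<noteq> []" using hl(2) Kcc' pc unfolding zs by (cases Q2) auto
    have hc: "last Q2 = c" using hl(2) Q2 unfolding zs by auto
    have Kh': "Kc (hd Q1)" using Kh Q1 unfolding zs by simp
    have S: "successively F Q1" "successively F Q2" "successively F ys" "F (last Q1) p" "F p (hd Q2)"
       "F (last ys) x" "F x (hd Q1)"
      using D(2) Q1 Q2 ne unfolding zs by (auto simp: successively_append_iff successively_Cons)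
    have "hd Q2 \<notin> set ys" "last Q1 \<notin> set ys" using D(1) hd_in_set[OF Q2] last_in_set[OF Q1] unfolding zs by auto
    then have "hd Q2 \<noteq> b" "last Q1 \<noteq> b" using hl(1) hd_in_set[OF ne(1)] by metis+
    then have dis: "hd Q2 \<noteq> p" "last Q1 \<noteq> p" "last ys \<noteq> p" "last Q1 \<noteq> hd Q2" "hd Q1 \<noteq> hd Q2" "hd Q1 \<noteq> c"
      "last Q1 \<noteq> b" "hd Q2 \<noteq> b"
      using D(1) Q1 Q2 hc hl ne unfolding zs
      by (auto dest: hd_in_set last_in_set)
    have pl: "E p (last ys)" using Kbc[OF Kp Kl] dis by metis
    have n3: "\<not> E (last Q1) (hd Q2)"
    proof
      assume a: "E (last Q1) (hd Q2)"
      have "ham_path V F p c (p # rev ys @ x # Q1 @ Q2)"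
        using D S Q1 Q2 ne hl hc zs EF[OF pl] EF[OF a] EF[OF symE[OF b]] unfolding ham_path_def
        by (auto simp: path_simps)
      then show False using Kcc' by (rule endp)
    qed
    have n4: "\<not> E x (hd Q2)"
    proof
      assume "E x (hd Q2)"
      then consider "Kb (hd Q2)" | "Kc (hd Q2)" using Kor by blast
      then show False
      proof cases
        case 1
        then have "E b (hd Q2)" using Kbc Kbb dis(8) by blast
        then have "ham_path V F p c (p # rev Q1 @ x # rev ys @ Q2)"
          using D S Q1 Q2 ne hl hc zs symF[OF S(4)] symF[OF S(6)] symF[OF S(7)] EF unfolding ham_path_def
          by (auto simp: path_simps)
        then show False using Kcc' by (rule endp)
      next
        case 2
        then have "E (hd Q1) (hd Q2)" using Kcc Kh' dis(5) by blast
        then have "ham V F"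
          by (intro ham_intro[of "ys @ p # rev Q1 @ Q2 @ [x]"])
            (use D S Q1 Q2 ne hl hc zs EF[OF symE[OF pl]] symF[OF S(4)] EF[OF symE[OF c]] EF[OF b] EF in
              \<open>auto simp: path_simps\<close>)
        then show False using nh by blast
      qed
    qed
    have n5: "\<not> E x (last Q1)"
    proof
      assume a: "E x (last Q1)"
      then consider "Kb (last Q1)" | "Kc (last Q1)" using Kor by blast
      then show False
      proof cases
        case 1
        then have "E b (last Q1)" using Kbc Kbb dis(7) by blast
        then have "ham_path V F p (hd Q1) (p # Q2 @ x # rev ys @ rev Q1)"
          using D S Q1 Q2 ne hl hc zs symF[OF S(6)] EF[OF symE[OF c]] EF unfolding ham_path_def
          by (auto simp: path_simps)
        then show False using Kh' by (rule endp)
      next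
        case 2
        have "E c (hd Q1)" using Kcc Kh' Kcc' dis(6) by blast
        then have "ham V F"
          by (intro ham_intro[of "ys @ p # Q2 @ Q1 @ [x]"])
            (use D S Q1 Q2 ne hl hc zs EF[OF symE[OF pl]] EF[OF symE[OF a]] EF[OF b] EF in
              \<open>auto simp: path_simps\<close>)
        then show False using nh by blast
      qed
    qed
    have e: "E p (last Q1)" "E p (hd Q2)" using new_edge[OF S(4)] new_edge[OF S(5)] n4 n5 symE by blast+
    have "last Q1 \<noteq> x" "hd Q2 \<noteq> x" using D(1) last_in_set[OF Q1] hd_in_set[OF Q2] unfolding zs by auto
    then have "E (last Q1) (hd Q2) \<or> E (last Q1) x \<or> E (hd Q2) x"
      by (rule clawfreeD[OF cf e symE[OF p(1)] dis(4)])
    then show False using n3 n4 n5 symE by blast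
  qed
qed

end

section \<open>Connectedness inside a vertex set, and construction of the closure\<close>

definition linked :: "('a \<Rightarrow> 'a \<Rightarrow> bool) \<Rightarrow> 'a set \<Rightarrow> 'a \<Rightarrow> 'a \<Rightarrow> bool" where
  "linked E X = (\<lambda>u v. E u v \<and> u \<in> X \<and> v \<in> X)\<^sup>*\<^sup>*"

text \<open>
  For adjacent \<open>u\<close>, \<open>v\<close> in a graph without induced diamonds this is the unique maximal clique
  containing both.
\<close>

definition region :: "('a \<Rightarrow> 'a \<Rightarrow> bool) \<Rightarrow> 'a \<Rightarrow> 'a \<Rightarrow> 'a set" where
  "region F u v = {w. w = u \<or> w = v \<or> F w u \<and> F w v}"

lemma linked_refl [simp]: "linked E X u u"
  unfolding linked_def by simp

lemma linked_edge: "E u v \<Longrightarrow> u \<in> X \<Longrightarrow> v \<in> X \<Longrightarrow> linked E X u v"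
  unfolding linked_def by (simp add: r_into_rtranclp)

lemma linked_trans: "linked E X u v \<Longrightarrow> linked E X v w \<Longrightarrow> linked E X u w"
  unfolding linked_def by (rule rtranclp_trans)

lemma linked_induct [consumes 1, case_names refl step]:
  assumes "linked E X u v" "P u"
    and "\<And>v w. linked E X u v \<Longrightarrow> E v w \<Longrightarrow> v \<in> X \<Longrightarrow> w \<in> X \<Longrightarrow> P v \<Longrightarrow> P w"
  shows "P v"
  using assms(1) unfolding linked_def
proof (induction rule: rtranclp_induct)
  case base
  show ?case by (rule assms(2))
next
  case (step v w)
  then show ?case using assms(3)[of v w] unfolding linked_def by blast
qed

lemma linked_sym:
  assumes "linked E X u v" "\<And>x y. E x y \<Longrightarrow> E y x"
  shows "linked E X v u"
  using assms(1)
proof (induction rule: linked_induct)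
  case (step v w)
  then have "linked E X w v" using assms(2) by (blast intro: linked_edge)
  with step show ?case by (blast intro: linked_trans)
qed simp

lemma linked_mono:
  assumes "linked E X u v" "X \<subseteq> Y"
  shows "linked E Y u v"
  using assms(1)
proof (induction rule: linked_induct)
  case (step v w)
  then have "linked E Y v w" using assms(2) by (blast intro: linked_edge)
  with step show ?case by (blast intro: linked_trans)
qed simp

lemma linked_crossing:
  assumes "linked E X u v" "P u" "\<not> P v"
  obtains a b where "E a b" "a \<in> X" "b \<in> X" "P a" "\<not> P b"
proof -
  have "P v \<or> (\<exists>a b. E a b \<and> a \<in> X \<and> b \<in> X \<and> P a \<and> \<not> P b)"
    using assms(1) by (induction rule: linked_induct) (use assms(2) in auto)
  then show ?thesis using assms(3) that by blast
qed

text \<open>A path from \<open>b\<close> to \<open>c\<close> inside the neighbourhood of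
  \<open>x\<close> leaves the closed neighbourhood of \<open>b\<close> by some edge
  \<open>p q\<close>. By the claw at \<open>x\<close>, the vertex \<open>q\<close> is
  \<open>c\<close> or sees \<open>c\<close>, which is the situation of
  \<open>close_common_nbr\<close> or of \<open>close_linked_nbrs\<close>.\<close>

lemma (in between) ham_remove_edge:
  assumes h: "ham V (\<lambda>u v. F u v \<or> u = b \<and> v = c \<or> u = c \<and> v = b)"
    and b: "E x b" and c: "E x c" and conn: "linked E {w. E x w} b c" and bc: "b \<noteq> c"
  shows "ham V F"
proof -
  obtain xs where "cyc (\<lambda>u v. F u v \<or> u = b \<and> v = c \<or> u = c \<and> v = b) xs" "set xs = V"
    using h unfolding ham_def by blast
  then consider "ham V F" | ys where "ham_path V F b c ys"
    using ham_pathI_cyc[of F b c xs] symF unfolding ham_def by blast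
  then show ?thesis
  proof cases
    case hp: (2 ys)
    show ?thesis
    proof (cases "E b c")
      case True
      then show ?thesis using close_path hp b c by blast
    next
      case nbc: False
      have "\<not> (c = b \<or> E c b)" using nbc bc symE by blast
      then obtain p q where pq: "E p q" "E x p" "E x q" "p = b \<or> E p b" "\<not> (q = b \<or> E q b)"
        using linked_crossing[OF conn, of "\<lambda>w. w = b \<or> E w b"] by (metis mem_Collect_eq)
      then have qc: "q = c \<or> E q c" using cover[OF b c bc nbc, of q] by blast
      have pb: "E p b" using pq symE by blast
      show ?thesis
      proof (cases "q = c")
        case True
        then show ?thesis using close_common_nbr[OF hp b c bc pq(2) pb] pq(1) by blast
      next
        case False
        then show ?thesis using close_linked_nbrs[OF hp b c bc pq(2) pb pq(3) _ pq(1)] qc by blast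
      qed
    qed
  qed
qed

lemma compl_sgraph:
  assumes "sgraph V E"
  shows "sgraph V (compl E x)"
  using assms unfolding sgraph_def compl_def by blast

text \<open>If a claw of the completion uses a new edge \<open>u p\<close>, then \<open>u\<close>
  and \<open>p\<close> are adjacent to \<open>x\<close> and the other two leaves are not. Replacing
  \<open>p\<close> by \<open>x\<close> gives a claw of \<open>E\<close> at \<open>u\<close>.\<close>

lemma compl_clawfree:
  assumes g: "sgraph V E" and cf: "clawfree E"
  shows "clawfree (compl E x)"
  unfolding clawfree_def
proof (intro allI impI, rule ccontr)
  fix u a b c
  assume h: "compl E x u a \<and> compl E x u b \<and> compl E x u c \<and> a \<noteq> b \<and> a \<noteq> c \<and> b \<noteq> c"
    and n: "\<not> (compl E x a b \<or> compl E x a c \<or> compl E x b c)"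
  have claw: False if "\<not> E u p" "compl E x u p" "compl E x u q" "compl E x u r" "p \<noteq> q" "p \<noteq> r" "q \<noteq> r"
     "\<not> compl E x p q" "\<not> compl E x p r" "\<not> compl E x q r" for p q r
  proof -
    have "E x u" "E x p" using that unfolding compl_def by blast+
    then have "\<not> E x q" "\<not> E x r" "E u q" "E u r" using that unfolding compl_def by blast+
    then show False using clawfreeD[OF cf, of u x q r] sgraphD[OF g] \<open>E x u\<close> \<open>E x p\<close> that
      unfolding compl_def by metis
  qed
  have s: "compl E x v w \<longleftrightarrow> compl E x w v" for v w using sgraphD(3)[OF compl_sgraph[OF g]] by blast
  have "E u a" using claw[of a b c] h n by blast
  moreover have "E u b" using claw[of b a c] h n s by blast
  moreover have "E u c" using claw[of c a b] h n s by blast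
  ultimately show False using clawfreeD[OF cf, of u a b c] h n unfolding compl_def by blast
qed

lemma ham_compl:
  assumes g: "sgraph V E" and cf: "clawfree E" and h: "ham V (compl E x)"
    and conn: "\<And>u v. E x u \<Longrightarrow> E x v \<Longrightarrow> linked E {w. E x w} u v"
  shows "ham V E"
proof -
  \<comment> \<open>A pair in \<open>N\<close> stands for an undirected new edge, so removing one
    pair may leave the edge present in the other orientation.\<close>
  define FN where "FN N u v \<longleftrightarrow> E u v \<or> (u, v) \<in> N \<or> (v, u) \<in> N" for N u v
  let ?N = "{(u, v). E x u \<and> E x v \<and> u \<noteq> v}"
  have fin: "finite ?N"
    by (rule finite_subset[of _ "V \<times> V"]) (use g in \<open>auto simp: sgraph_def\<close>)
  have key: "ham V (FN N) \<longrightarrow> ham V E" if "N \<subseteq> ?N" for N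
    using finite_subset[OF that fin] that
  proof (induction N rule: finite_induct)
    case empty
    then show ?case unfolding FN_def by simp
  next
    case (insert bc N)
    obtain b c where bc: "bc = (b, c)" "E x b" "E x c" "b \<noteq> c" using insert.prems by auto
    interpret between V E "FN N" x
    proof
      show "sgraph V (FN N)" using g insert.prems unfolding sgraph_def FN_def by blast
      show "compl E x u v" if "FN N u v" for u v
        using that insert.prems unfolding compl_def FN_def by blast
    qed (use g cf FN_def in auto)
    have "FN (insert bc N) = (\<lambda>u v. FN N u v \<or> u = b \<and> v = c \<or> u = c \<and> v = b)"
      unfolding FN_def bc by auto
    then show ?case using ham_remove_edge[OF _ bc(2,3) conn[OF bc(2,3)] bc(4)] insert by auto
  qed
  have "FN ?N = compl E x" unfolding FN_def compl_def fun_eq_iff mem_Collect_eq prod.case by blast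
  then show ?thesis using key[OF subset_refl] h by simp
qed

lemma region_closed:
  assumes "sgraph V F" "diamondfree F" "F u v" "p \<in> region F u v" "q \<in> region F u v" "p \<noteq> q"
  shows "F p q" "F w p \<Longrightarrow> F w q \<Longrightarrow> w \<in> region F u v"
proof -
  note s = sgraphD(3)[OF assms(1)]
  show 1: "F p q"
    using assms(3-6) diamondfreeD[OF assms(2), of u v p q] s unfolding region_def by auto
  show "w \<in> region F u v" if w: "F w p" "F w q"
  proof -
    have *: "w = z \<or> F w z" if "z \<in> region F u v" for z
    proof (cases "z = p \<or> z = q")
      case True
      then show ?thesis using w by blast
    next
      case False
      have adj: "F a b" if "a \<in> region F u v" "b \<in> region F u v" "a \<noteq> b" for a b
        using that assms(3) diamondfreeD[OF assms(2), of u v a b] s unfolding region_def by auto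
      have "F z p" "F z q" using adj[OF that assms(4)] adj[OF that assms(5)] False by blast+
      then show ?thesis using diamondfreeD[OF assms(2) 1, of w z] w s by blast
    qed
    have "u \<in> region F u v" "v \<in> region F u v" unfolding region_def by auto
    then have "w = u \<or> F w u" "w = v \<or> F w v" using * by blast+
    then show ?thesis unfolding region_def by blast
  qed
qed

text \<open>Local completion is repeated while there is an induced diamond. In a claw-free graph a
  diamond makes the neighbourhood of its vertex \<open>x\<close> connected, as
  \<open>ham_compl\<close> demands, and the completion at \<open>x\<close> adds the missing edge of
  the diamond, so the number of nonadjacent pairs drops.\<close>

theorem closure_exists:
  fixes E :: "'a \<Rightarrow> 'a \<Rightarrow> bool"
  assumes "sgraph V E" "clawfree E"
  shows "\<exists>F. sgraph V F \<and> clawfree F \<and> diamondfree F \<and> (\<forall>u v. E u v \<longrightarrow> F u v) \<and>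
     (ham V F \<longrightarrow> ham V E) \<and> (\<forall>u v. F u v \<longrightarrow> linked E (region F u v) u v)"
  using assms
proof (induction "card {(u, v) \<in> V \<times> V. \<not> E u v}" arbitrary: E rule: less_induct)
  case less
  note g = less.prems(1) and cf = less.prems(2)
  note s = sgraphD(3)[OF g]
  show ?case
  proof (cases "diamondfree E")
    case True
    have "linked E (region E u v) u v" if "E u v" for u v
      using that by (auto simp: region_def intro: linked_edge)
    then show ?thesis using True g cf by blast
  next
    case False
    then obtain x b y z where d: "E x b" "E x y" "E b y" "E x z" "E b z" "y \<noteq> z" "\<not> E y z"
      unfolding diamondfree_def by blast
    \<comment> \<open>By the claw at \<open>x\<close>, each neighbour of \<open>x\<close> is or sees
      one of the nonadjacent vertices \<open>y\<close> and \<open>z\<close>, and both of these see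
      \<open>b\<close>.\<close>
    have lb: "linked E {w. E x w} w b" if w: "E x w" for w
    proof -
      have yz: "linked E {w. E x w} y b" "linked E {w. E x w} z b"
        using d s by (auto intro: linked_edge)
      have "w = y \<or> w = z \<or> E w y \<or> E w z"
        using clawfreeD[OF cf, of x y z w] d w s by blast
      then show ?thesis
        using yz d w linked_trans[of E _ w y b] linked_trans[of E _ w z b] linked_edge[of E w]
        by auto
    qed
    have conn: "linked E {w. E x w} u v" if "E x u" "E x v" for u v
      using linked_trans[OF lb[OF that(1)] linked_sym[OF lb[OF that(2)] s]] .
    let ?C = "compl E x"
    have gC: "sgraph V ?C" by (rule compl_sgraph[OF g])
    have "{(u, v) \<in> V \<times> V. \<not> ?C u v} \<subset> {(u, v) \<in> V \<times> V. \<not> E u v}"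
    proof
      show "{(u, v) \<in> V \<times> V. \<not> ?C u v} \<subseteq> {(u, v) \<in> V \<times> V. \<not> E u v}" unfolding compl_def by auto
      have "(y, z) \<in> {(u, v) \<in> V \<times> V. \<not> E u v}" using d sgraphD(2)[OF g] by auto
      moreover have "(y, z) \<notin> {(u, v) \<in> V \<times> V. \<not> ?C u v}" using d unfolding compl_def by auto
      ultimately show "{(u, v) \<in> V \<times> V. \<not> ?C u v} \<noteq> {(u, v) \<in> V \<times> V. \<not> E u v}" by blast
    qed
    moreover have "finite {(u, v) \<in> V \<times> V. \<not> E u v}"
      by (rule finite_subset[of _ "V \<times> V"]) (use g in \<open>auto simp: sgraph_def\<close>)
    ultimately have lt: "card {(u, v) \<in> V \<times> V. \<not> ?C u v} < card {(u, v) \<in> V \<times> V. \<not> E u v}"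
      by (rule psubset_card_mono[rotated])
    obtain F where F: "sgraph V F" "clawfree F" "diamondfree F" "\<And>u v. ?C u v \<Longrightarrow> F u v"
        "ham V F \<Longrightarrow> ham V ?C" "\<And>u v. F u v \<Longrightarrow> linked ?C (region F u v) u v"
      using less.hyps[OF lt gC compl_clawfree[OF g cf]] by blast
    have EF: "F u v" if "E u v" for u v using that F(4) unfolding compl_def by blast
    have "linked E (region F u v) u v" if uv: "F u v" for u v
    proof -
      \<comment> \<open>A new edge is replaced by the detour through \<open>x\<close>. The detour
        stays in the region because \<open>x\<close> sees two of its vertices.\<close>
      have *: "linked E (region F u v) p q" if pq: "?C p q" "p \<in> region F u v" "q \<in> region F u v" for p q
      proof (cases "E p q")
        case True
        then show ?thesis using pq by (simp add: linked_edge)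
      next
        case False
        then have xp: "E x p" "E x q" "p \<noteq> q" using pq(1) unfolding compl_def by auto
        then have "x \<in> region F u v" using region_closed(2)[OF F(1,3) uv pq(2,3)] EF by blast
        then have "linked E (region F u v) p x" "linked E (region F u v) x q"
          using xp pq s by (auto intro: linked_edge)
        then show ?thesis by (rule linked_trans)
      qed
      define R where "R = region F u v"
      have "linked (compl E x) R u v" using F(6)[OF uv] unfolding R_def .
      then have "linked E R u v"
      proof (induction rule: linked_induct)
        case (step p q)
        then show ?case using *[of p q] unfolding R_def by (blast intro: linked_trans)
      qed simp
      then show ?thesis unfolding R_def .
    qed
    moreover have "ham V F \<longrightarrow> ham V E" using F(5) ham_compl[OF g cf _ conn] by blast
    ultimately show ?thesis using F(1-3) EF by blast
  qed
qed

section \<open>Induced paths and induced cycles\<close>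

primrec ipath :: "('a \<Rightarrow> 'a \<Rightarrow> bool) \<Rightarrow> 'a list \<Rightarrow> bool" where
  "ipath F [] \<longleftrightarrow> True"
| "ipath F (x # xs) \<longleftrightarrow> x \<notin> set xs \<and> (\<forall>z \<in> set xs. F x z \<longleftrightarrow> z = hd xs) \<and> ipath F xs"

text \<open>A vertex \<open>y\<close> attached to the two ends of an induced path with at least
  three vertices; triangles are thereby excluded.\<close>

definition icyc :: "('a \<Rightarrow> 'a \<Rightarrow> bool) \<Rightarrow> 'a list \<Rightarrow> bool" where
  "icyc F xs \<longleftrightarrow> (\<exists>y ys. xs = y # ys \<and> 3 \<le> length ys \<and> y \<notin> set ys \<and> ipath F ys \<and>
     (\<forall>z \<in> set ys. F y z \<longleftrightarrow> z = hd ys \<or> z = last ys))"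

lemma ipath_distinct: "ipath F xs \<Longrightarrow> distinct xs"
  by (induction xs) auto

lemma ipath_append:
  "ipath F (xs @ ys) \<longleftrightarrow> ipath F xs \<and> ipath F ys \<and> set xs \<inter> set ys = {} \<and>
     (\<forall>u \<in> set xs. \<forall>v \<in> set ys. F u v \<longleftrightarrow> u = last xs \<and> v = hd ys)"
proof (induction xs)
  case (Cons x xs)
  show ?case
  proof (cases "xs = []")
    case False
    then have "hd xs \<in> set xs" by auto
    then have "set xs \<inter> set ys = {} \<Longrightarrow> hd xs \<notin> set ys" by blast
    then show ?thesis using False by (auto simp: Cons.IH)
  qed auto
qed simp

lemma ipath_rev:
  assumes "\<And>x y. F x y \<Longrightarrow> F y x"
  shows "ipath F (rev xs) \<longleftrightarrow> ipath F xs"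
proof (induction xs)
  case (Cons x xs)
  have "F u x \<longleftrightarrow> F x u" for u using assms by blast
  then show ?case by (auto simp: ipath_append Cons.IH last_rev)
qed simp

lemma ipath_successively: "ipath F xs \<Longrightarrow> successively F xs"
  by (induction xs rule: induct_list012) auto

lemma icyc_append:
  assumes "L \<noteq> []" "M \<noteq> []"
  shows "icyc F (L @ M) \<longleftrightarrow> 4 \<le> length (L @ M) \<and> ipath F L \<and> ipath F M \<and> set L \<inter> set M = {} \<and>
     (\<forall>u \<in> set L. \<forall>v \<in> set M. F u v \<longleftrightarrow> u = last L \<and> v = hd M \<or> u = hd L \<and> v = last M)"
proof -
  obtain x L' where L: "L = x # L'" using assms by (cases L) auto
  have [simp]: "hd M \<in> set M" "last M \<in> set M" using assms by auto
  show ?thesis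
  proof (cases "L' = []")
    case True
    then show ?thesis using assms unfolding L icyc_def by auto
  next
    case False
    then have "hd L' \<in> set L'" "last L' \<in> set L'" by auto
    then have "set L' \<inter> set M = {} \<Longrightarrow> hd L' \<notin> set M" "x \<notin> set L' \<Longrightarrow> x \<noteq> last L'" by blast+
    then show ?thesis using assms False unfolding L icyc_def by (auto simp: ipath_append)
  qed
qed

text \<open>This replaces shortest-path arguments: each new front vertex is joined to its last
  neighbour on the path found so far, and what precedes that neighbour is dropped. The predicate
  \<open>Z\<close> marks admissible targets, of which the path meets only its end.\<close>

lemma linked_ipath:
  assumes "linked E X u v" "u \<in> X" "Z v"
  shows "\<exists>Q. ipath E Q \<and> Q \<noteq> [] \<and> hd Q = u \<and> set Q \<subseteq> X \<and> Z (last Q) \<and> (\<forall>q \<in> set (butlast Q). \<not> Z q)"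
  using assms(1)[unfolded linked_def] assms(2)
proof (induction rule: converse_rtranclp_induct)
  case base
  then show ?case using assms(3) by (intro exI[of _ "[v]"]) auto
next
  case (step u u')
  then obtain Q where Q: "ipath E Q" "Q \<noteq> []" "hd Q = u'" "set Q \<subseteq> X" "Z (last Q)"
    "\<forall>q \<in> set (butlast Q). \<not> Z q" by blast
  show ?case
  proof (cases "Z u")
    case True
    then show ?thesis using step.prems by (intro exI[of _ "[u]"]) auto
  next
    case False
    have "\<exists>w \<in> set Q. w = u \<or> E u w" using Q(2,3) step.hyps(1) by auto
    from split_list_last_prop[OF this] obtain Q1 w Q2
      where s: "Q = Q1 @ w # Q2" "w = u \<or> E u w" "\<forall>z \<in> set Q2. \<not> (z = u \<or> E u z)" by blast
    have i: "ipath E (w # Q2)" "set (w # Q2) \<subseteq> X" "Z (last (w # Q2))" "\<forall>q \<in> set (butlast (w # Q2)). \<not> Z q"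
      using Q s(1) by (auto simp: ipath_append butlast_append)
    show ?thesis
    proof (cases "w = u")
      case True
      then show ?thesis using i by (intro exI[of _ "w # Q2"]) auto
    next
      case w: False
      have "ipath E (u # w # Q2)" using i(1) s(2,3) w by auto
      then show ?thesis using i False step.prems by (intro exI[of _ "u # w # Q2"]) auto
    qed
  qed
qed

definition cross :: "('a \<Rightarrow> 'a \<Rightarrow> bool) \<Rightarrow> 'a list \<Rightarrow> 'a list \<Rightarrow> bool" where
  "cross F X Y \<longleftrightarrow> (\<forall>u \<in> set X. \<forall>v \<in> set Y. u \<noteq> v \<and>
     (F u v \<longleftrightarrow> u = hd X \<and> v = hd Y \<or> u = last X \<and> v = last Y))"

definition twoconn :: "'a set \<Rightarrow> ('a \<Rightarrow> 'a \<Rightarrow> bool) \<Rightarrow> bool" where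
  "twoconn U F \<longleftrightarrow> 3 \<le> card U \<and> (\<forall>x. \<forall>u \<in> U - {x}. \<forall>v \<in> U - {x}. linked F (U - {x}) u v)"

lemma successively_clique:
  "distinct xs \<Longrightarrow> (\<And>u v. u \<in> set xs \<Longrightarrow> v \<in> set xs \<Longrightarrow> u \<noteq> v \<Longrightarrow> F u v) \<Longrightarrow> successively F xs"
  by (induction xs rule: induct_list012) auto

lemma successively_concat:
  assumes "S \<noteq> []" "\<And>x. x \<in> set S \<Longrightarrow> B x \<noteq> [] \<and> successively F (B x)"
    "successively (\<lambda>x y. F (last (B x)) (hd (B y))) S"
  shows "successively F (concat (map B S)) \<and> concat (map B S) \<noteq> [] \<and>
    hd (concat (map B S)) = hd (B (hd S)) \<and> last (concat (map B S)) = last (B (last S))"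
  using assms
proof (induction S rule: list_nonempty_induct)
  case (cons x xs)
  then show ?case by (auto simp: successively_Cons successively_append_iff)
qed simp

locale closed_graph =
  fixes V :: "'a set" and F :: "'a \<Rightarrow> 'a \<Rightarrow> bool"
  assumes gF: "sgraph V F" and cfF: "clawfree F" and dfF: "diamondfree F"
begin

lemmas symF = sgraphD(3)[OF gF]
lemmas inV = sgraphD(1,2)[OF gF]

lemma irr [simp]: "\<not> F x x"
  using gF unfolding sgraph_def by blast

lemma comm: "F x y \<longleftrightarrow> F y x"
  using symF by blast

lemma clawD: "F x a \<Longrightarrow> F x b \<Longrightarrow> F x c \<Longrightarrow> a \<noteq> b \<Longrightarrow> a \<noteq> c \<Longrightarrow> b \<noteq> c \<Longrightarrow> F a b \<or> F a c \<or> F b c"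
  using clawfreeD[OF cfF] by blast

lemma diamondD: "F a b \<Longrightarrow> F a x \<Longrightarrow> F b x \<Longrightarrow> F a y \<Longrightarrow> F b y \<Longrightarrow> x \<noteq> y \<Longrightarrow> F x y"
  using diamondfreeD[OF dfF] by blast

lemma icyc_swap: "icyc F (L @ M) \<Longrightarrow> icyc F (M @ L)"
proof (cases "L = [] \<or> M = []")
  case False
  then show "icyc F (L @ M) \<Longrightarrow> icyc F (M @ L)"
    using icyc_append[of L M F] icyc_append[of M L F] comm by (simp add: Int_commute add.commute) blast
qed auto

lemma icyc_nbrs:
  assumes "icyc F S" "x \<in> set S"
  obtains a b where "a \<in> set S" "b \<in> set S" "F x a" "F x b" "a \<noteq> b" "\<not> F a b"
    "\<And>z. z \<in> set S \<Longrightarrow> F x z \<Longrightarrow> z = a \<or> z = b"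
proof -
  obtain A B where S: "S = A @ x # B" using split_list[OF assms(2)] by blast
  have "icyc F ((x # B) @ A)" using icyc_swap assms(1) unfolding S by blast
  then obtain ys where ys: "ys = B @ A" "3 \<le> length ys" "x \<notin> set ys" "ipath F ys"
     "\<forall>z \<in> set ys. F x z \<longleftrightarrow> z = hd ys \<or> z = last ys" unfolding icyc_def by auto
  obtain p q r where pqr: "ys = p # q # r" "r \<noteq> []" using ys(2)
    by (cases ys; cases "tl ys"; cases "tl (tl ys)") auto
  have l: "last r \<in> set r" using pqr by auto
  show ?thesis
  proof (rule that[of p "last r"])
    have "set ys \<subseteq> set S" using S ys(1) by auto
    then show "p \<in> set S" "last r \<in> set S" using pqr l by auto
    have "ipath F (p # q # r)" "\<forall>z \<in> set (p # q # r). F x z \<longleftrightarrow> z = p \<or> z = last r"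
      using ys(4,5) pqr by auto
    then show "F x p" "F x (last r)" "p \<noteq> last r" "\<not> F p (last r)" using l by auto
    show "z = p \<or> z = last r" if "z \<in> set S" "F x z" for z
    proof -
      have "z \<in> set ys" using that S ys(1) by auto
      then show ?thesis using ys(5) that pqr by auto
    qed
  qed
qed

text \<open>The two neighbours of \<open>e\<close> on the cycle are nonadjacent, so the claw at
  \<open>e\<close> makes \<open>v\<close> see one of them. The last alternative is the closing
  edge.\<close>

lemma icyc_consecutive:
  assumes "icyc F S" "v \<notin> set S" "e \<in> set S" "F v e"
  shows "(\<exists>A x y B. S = A @ x # y # B \<and> F v x \<and> F v y) \<or> F v (last S) \<and> F v (hd S)"
proof -
  obtain A B where S: "S = A @ e # B" using split_list[OF assms(3)] by blast
  have "icyc F ((e # B) @ A)" using icyc_swap assms(1) unfolding S by blast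
  then obtain ys where ys: "ys = B @ A" "3 \<le> length ys" "e \<notin> set ys" "ipath F ys"
     "\<forall>z \<in> set ys. F e z \<longleftrightarrow> z = hd ys \<or> z = last ys" unfolding icyc_def by auto
  obtain p q r where pqr: "ys = p # q # r" "r \<noteq> []" using ys(2)
    by (cases ys; cases "tl ys"; cases "tl (tl ys)") auto
  have l: "last r \<in> set r" using pqr by auto
  have ly: "last ys = last r" using pqr by auto
  have "ipath F (p # q # r)" "\<forall>z \<in> set (p # q # r). F e z \<longleftrightarrow> z = p \<or> z = last r"
    using ys(4,5) pqr by auto
  then have "F e p" "F e (last ys)" "p \<noteq> last ys" "\<not> F p (last ys)" using l ly by auto
  moreover have "set ys \<subseteq> set S" using S ys(1) by auto
  then have pS: "p \<in> set S" "last ys \<in> set S" using pqr l ly by auto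
  have "v \<noteq> p" "v \<noteq> last ys" using assms(2) pS by auto
  ultimately have vv: "F v p \<or> F v (last ys)" using clawD[of e p "last ys" v] assms(4) comm by blast
  show ?thesis
  proof (cases "F v p")
    case True
    show ?thesis
    proof (cases B)
      case Nil
      then have "hd S = p" "last S = e" using S ys(1) pqr(1) by auto
      then show ?thesis using True assms(4) by auto
    next
      case (Cons b B')
      then have "S = A @ e # p # B'" using S ys(1) pqr(1) by auto
      then show ?thesis using True assms(4) by blast
    qed
  next
    case False
    then have vl: "F v (last ys)" using vv by blast
    show ?thesis
    proof (cases A rule: rev_cases)
      case Nil
      then have "last S = last ys" "hd S = e" using S ys(1) pqr(1) by auto
      then show ?thesis using vl assms(4) by auto
    next
      case (snoc A' a)
      then have "S = A' @ last ys # e # B" using S ys(1) by auto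
      then show ?thesis using vl assms(4) by blast
    qed
  qed
qed

lemma icyc_edges:
  assumes "icyc F S"
  shows "distinct S" "successively F S" "F (last S) (hd S)" "4 \<le> length S"
proof -
  obtain y ys where y: "S = y # ys" "3 \<le> length ys" "y \<notin> set ys" "ipath F ys"
     "\<forall>z \<in> set ys. F y z \<longleftrightarrow> z = hd ys \<or> z = last ys" using assms unfolding icyc_def by auto
  then have "ys \<noteq> []" by auto
  then show "distinct S" "successively F S" "F (last S) (hd S)" "4 \<le> length S"
    using y ipath_distinct[OF y(4)] ipath_successively[OF y(4)] comm[of y]
    by (auto simp: successively_Cons)
qed

text \<open>Each vertex off the cycle is assigned to a cycle edge whose ends it both sees. Vertices
  assigned to the same edge form a clique, as there are no induced diamonds, and can be inserted
  between its ends.\<close>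

lemma dominating_icyc_ham:
  assumes S: "icyc F S" "set S \<subseteq> U" and fin: "finite U" and dom: "\<And>v. v \<in> U \<Longrightarrow> v \<notin> set S \<Longrightarrow> \<exists>e \<in> set S. F v e"
  shows "ham U F"
proof -
  note E = icyc_edges[OF S(1)]
  have Sne: "S \<noteq> []" using E(4) by auto
  \<comment> \<open>A cycle edge is named by its first vertex \<open>x\<close>; the second
    alternative is the edge that closes the list.\<close>
  define nx where "nx v x \<longleftrightarrow> (\<exists>A y B. S = A @ x # y # B \<and> F v x \<and> F v y) \<or> x = last S \<and> F v (last S) \<and> F v (hd S)" for v x
  have "\<exists>x \<in> set S. nx v x" if v: "v \<in> U - set S" for v
  proof -
    obtain e where e: "e \<in> set S" "F v e" using dom v by blast
    have "v \<notin> set S" using v by blast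
    from icyc_consecutive[OF S(1) this e] show ?thesis
    proof (elim disjE exE conjE)
      fix A x y B assume "S = A @ x # y # B" "F v x" "F v y"
      then have "nx v x" "x \<in> set S" unfolding nx_def by auto
      then show ?thesis by blast
    next
      assume "F v (last S)" "F v (hd S)"
      then have "nx v (last S)" unfolding nx_def by blast
      then show ?thesis using Sne by auto
    qed
  qed
  then obtain g where g: "\<And>v. v \<in> U - set S \<Longrightarrow> g v \<in> set S \<and> nx v (g v)" by metis
  define W where "W x = {v \<in> U - set S. g v = x}" for x
  have "\<exists>l. distinct l \<and> set l = W x" for x
    using finite_distinct_list[of "W x"] fin unfolding W_def by auto
  then obtain l where l: "\<And>x. distinct (l x)" "\<And>x. set (l x) = W x" by metis
  define B where "B x = x # l x" for x
  have Wx: "F v x" if "v \<in> W x" for v x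
  proof -
    have "nx v x" using g that unfolding W_def by auto
    then show ?thesis unfolding nx_def by blast
  qed
  have same: "F v y" if "v \<in> W x" "S = A @ x # y # C" for v x y A C
  proof -
    have n: "nx v x" using g that(1) unfolding W_def by auto
    have "x \<noteq> last S" using E(1) that(2) by auto
    then obtain A' y' C' where "S = A' @ x # y' # C'" "F v y'" using n unfolding nx_def by blast
    moreover have "A' = A \<and> y' # C' = y # C" using E(1) that(2) calculation(1)
      by (metis append_Cons_eq_iff distinct.simps(2) distinct_append not_distinct_conv_prefix)
    ultimately show ?thesis by auto
  qed
  have lastW: "F v (hd S)" if "v \<in> W (last S)" for v
  proof -
    have v: "v \<in> U - set S" "g v = last S" using that unfolding W_def by auto
    then have "nx v (last S)" using g[OF v(1)] by metis
    moreover have "\<nexists>A y B. S = A @ last S # y # B"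
    proof
      assume "\<exists>A y B. S = A @ last S # y # B"
      then obtain A y B where AyB: "S = A @ last S # y # B" by blast
      then have "last S = last (y # B)" by (metis last_ConsR last_appendR list.distinct(1))
      then have "last S \<in> set (y # B)" by (metis last_in_set list.distinct(1))
      moreover have "distinct (A @ last S # y # B)" using E(1) AyB by metis
      ultimately show False by auto
    qed
    ultimately show ?thesis unfolding nx_def by blast
  qed
  have clique: "F v w" if "v \<in> W x" "w \<in> W x" "v \<noteq> w" and xS: "x \<in> set S" for v w x
  proof -
    obtain A C where AC: "S = A @ x # C" using split_list[OF xS] by blast
    show ?thesis
    proof (cases C)
      case Nil
      then have "x = last S" using AC by simp
      then show ?thesis using that Wx lastW E(3) diamondD[of "last S" "hd S" v w] comm by blast
    next
      case (Cons y C')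
      then have "F x y" using AC E(2) by (auto simp: successively_append_iff)
      then show ?thesis using same[of _ x A y C'] AC Cons that Wx diamondD[of x y v w] comm by blast
    qed
  qed
  have b1: "B x \<noteq> [] \<and> successively F (B x)" if "x \<in> set S" for x
  proof -
    have "distinct (x # l x)" using l that unfolding W_def by auto
    moreover have "F u v" if "u \<in> set (x # l x)" "v \<in> set (x # l x)" "u \<noteq> v" for u v
      using that l(2) clique \<open>x \<in> set S\<close> Wx comm by auto
    ultimately show ?thesis unfolding B_def using successively_clique by blast
  qed
  have lastB: "last (B x) = x \<or> last (B x) \<in> W x" for x
    using l(2) last_in_set[of "l x"] unfolding B_def by auto
  have b2: "successively (\<lambda>x y. F (last (B x)) (hd (B y))) S"
  proof (rule ccontr)
    assume "\<not> ?thesis"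
    then obtain A x y C where "S = A @ x # y # C" "\<not> F (last (B x)) (hd (B y))"
      using not_successively_split by blast
    moreover from this have "F x y" using E(2) by (auto simp: successively_append_iff)
    ultimately show False using lastB[of x] same[of _ x A y C] unfolding B_def by auto
  qed
  let ?C = "concat (map B S)"
  have C: "successively F ?C" "hd ?C = hd S" "last ?C = last (B (last S))"
    using successively_concat[OF Sne b1 b2] unfolding B_def by auto
  have "set ?C = U"
  proof
    show "set ?C \<subseteq> U" using l(2) S(2) unfolding B_def W_def by auto
    show "U \<subseteq> set ?C"
    proof
      fix v assume v: "v \<in> U"
      show "v \<in> set ?C"
      proof (cases "v \<in> set S")
        case True
        then show ?thesis unfolding B_def by auto
      next
        case False
        then have "g v \<in> set S" "v \<in> set (l (g v))" using g v l(2) unfolding W_def by auto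
        then show ?thesis unfolding B_def by auto
      qed
    qed
  qed
  moreover have "distinct ?C"
  proof -
    have "distinct (map B S)" using E(1) unfolding B_def by (auto simp: distinct_map inj_on_def)
    moreover have "distinct ys" if "ys \<in> set (map B S)" for ys
      using that l S(2) unfolding B_def W_def by auto
    moreover have "set ys \<inter> set zs = {}" if yz: "ys \<in> set (map B S)" "zs \<in> set (map B S)" "ys \<noteq> zs" for ys zs
    proof -
      obtain x x' where "x \<in> set S" "x' \<in> set S" "ys = B x" "zs = B x'" "x \<noteq> x'" using yz by auto
      then show ?thesis using l(2) unfolding B_def W_def by auto
    qed
    ultimately show ?thesis by (rule distinct_concat)
  qed
  moreover have "F (last ?C) (hd ?C)" using C lastB[of "last S"] lastW E(3) by auto
  moreover have "3 \<le> length ?C"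
  proof -
    have "card (set S) \<le> card (set ?C)" by (rule card_mono) (auto simp: B_def)
    then have "length S \<le> length ?C" using distinct_card[OF E(1)] card_length[of ?C] by linarith
    then show ?thesis using E(4) by linarith
  qed
  ultimately show ?thesis using C(1) ham_intro by blast
qed

end

section \<open>Graphs without induced cycles, and gluing along a clique\<close>

context closed_graph
begin

text \<open>An induced path between nonadjacent vertices starts \<open>u, p, w\<close> with
  \<open>u\<close> and \<open>w\<close> nonadjacent. An induced path from \<open>u\<close> that
  avoids \<open>p\<close> and stops at the first neighbour of \<open>p\<close> which is neither
  \<open>u\<close> nor adjacent to \<open>u\<close> closes through \<open>p\<close> to an induced
  cycle.\<close>

lemma complete_or_icyc:
  assumes tc: "twoconn U F" and noc: "\<And>S. icyc F S \<Longrightarrow> \<not> set S \<subseteq> U" and uv: "u \<in> U" "v \<in> U" "u \<noteq> v"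
  shows "F u v"
proof (rule ccontr)
  assume nuv: "\<not> F u v"
  have "\<not> U \<subseteq> {u, v}" using tc card_mono[of "{u, v}" U] uv(3) unfolding twoconn_def by auto
  then obtain x where "x \<in> U - {u, v}" by blast
  then have "linked F (U - {x}) u v" using tc uv unfolding twoconn_def by blast
  from linked_ipath[OF this, of "\<lambda>q. q = v"] obtain Q where
    Q: "ipath F Q" "Q \<noteq> []" "hd Q = u" "set Q \<subseteq> U" "last Q = v" using \<open>x \<in> _\<close> uv by blast
  obtain p w Q' where Q': "Q = u # p # w # Q'"
  proof -
    obtain Q1 where Q1: "Q = u # Q1" using Q(2,3) by (cases Q) auto
    then obtain p Q2 where Q2: "Q1 = p # Q2" using Q(5) uv(3) by (cases Q1) auto
    have "F u p" using Q(1) unfolding Q1 Q2 by auto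
    then have "Q2 \<noteq> []" using Q(5) nuv unfolding Q1 Q2 by auto
    then show ?thesis using that Q1 Q2 by (cases Q2) auto
  qed
  have f: "F p u" "F p w" "\<not> F u w" "u \<noteq> w" "p \<in> U" "w \<in> U" "u \<noteq> p" "w \<noteq> p"
    using Q(1,4) unfolding Q' by (auto simp: comm)
  have "linked F (U - {p}) u w" using tc f uv unfolding twoconn_def by blast
  from linked_ipath[OF this, of "\<lambda>q. F p q \<and> q \<noteq> u \<and> \<not> F u q"] obtain R where
    R: "ipath F R" "R \<noteq> []" "hd R = u" "set R \<subseteq> U - {p}" "F p (last R)" "last R \<noteq> u" "\<not> F u (last R)"
      "\<forall>q \<in> set (butlast R). \<not> (F p q \<and> q \<noteq> u \<and> \<not> F u q)" using f uv by blast
  obtain q R1 where R1: "R = u # q # R1"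
    using R(2,3,6) by (cases R; cases "tl R") auto
  have q: "F u q" "q \<noteq> u" using R(1) unfolding R1 by auto
  then have R1ne: "R1 \<noteq> []" using R(7) unfolding R1 by auto
  have lR: "last R = last R1" "last R1 \<in> set R1" using R1 R1ne by auto
  have inner: "\<not> F p z" if "z \<in> set (butlast R1)" for z
  proof -
    have "z \<in> set (butlast R)" "z \<in> set R1" using that R1ne unfolding R1 by (auto dest: in_set_butlastD)
    moreover have "\<not> F u z" "z \<noteq> u" using R(1) \<open>z \<in> set R1\<close> unfolding R1 by auto
    ultimately show ?thesis using R(8) by blast
  qed
  have cyc: False if T: "ipath F T" "3 \<le> length T" "set T \<subseteq> set R" "F p (hd T)" "F p (last T)"
    "\<And>z. z \<in> set T \<Longrightarrow> F p z \<Longrightarrow> z = hd T \<or> z = last T" for T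
  proof -
    have "p \<notin> set T" using T(3) R(4) by blast
    then have "icyc F (p # T)" using T unfolding icyc_def by auto
    moreover have "set (p # T) \<subseteq> U" using T(3) R(4) f by auto
    ultimately show False using noc by blast
  qed
  have R1s: "z \<in> set R1 \<Longrightarrow> z = last R1 \<or> z \<in> set (butlast R1)" for z
    using R1ne by (metis append_butlast_last_id rotate1.simps(2) set_ConsD set_rotate1)
  show False
  proof (cases "F p q")
    case False
    have "F p z \<Longrightarrow> z = hd R \<or> z = last R" if "z \<in> set R" for z
      using that inner R1s lR False unfolding R1 by auto
    moreover have "3 \<le> length R" using R1ne unfolding R1 by (cases R1) auto
    ultimately show False using cyc[of R] R f by blast
  next
    case True
    \<comment> \<open>Here \<open>p, u, q\<close> is a triangle, so the cycle uses \<open>q\<close>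
      in place of \<open>u\<close>. If \<open>q\<close> saw the end of \<open>R\<close> as well,
      there would be an induced diamond; hence the cycle has length at least four.\<close>
    have "\<not> F q (last R1)"
      using diamondD[of p q u "last R1"] True q R f lR comm by auto
    then have "2 \<le> length R1" using R(1) R1ne unfolding R1 by (cases R1; cases "tl R1") auto
    moreover have "F p z \<Longrightarrow> z = q \<or> z = last R1" if "z \<in> set (q # R1)" for z
      using that inner R1s by auto
    moreover have "ipath F (q # R1)" using R(1) unfolding R1 by auto
    ultimately show False using cyc[of "q # R1"] R R1ne True lR unfolding R1 by auto
  qed
qed

lemma complete_ham:
  assumes "finite U" "3 \<le> card U" "\<And>u v. u \<in> U \<Longrightarrow> v \<in> U \<Longrightarrow> u \<noteq> v \<Longrightarrow> F u v"
  shows "ham U F"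
proof -
  obtain xs where xs: "distinct xs" "set xs = U" using finite_distinct_list[OF assms(1)] by blast
  then have l: "3 \<le> length xs" using assms(2) distinct_card by metis
  then have "xs \<noteq> []" "hd xs \<noteq> last xs" using xs(1) by (cases xs; auto)+
  then have "F (last xs) (hd xs)" using xs assms(3) by (metis hd_in_set last_in_set)
  moreover have "successively F xs" using successively_clique[OF xs(1)] xs(2) assms(3) by blast
  ultimately show ?thesis using ham_intro xs l by blast
qed

lemma ham_minus:
  assumes "ham (insert p W) F" "p \<notin> W" "2 \<le> card W"
  obtains A where "set A = W" "distinct A" "successively F A" "A \<noteq> []" "F (hd A) p" "F p (last A)" "hd A \<noteq> last A"
proof -
  obtain xs where xs: "cyc F xs" "set xs = insert p W" using assms(1) unfolding ham_def by blast
  then obtain A B where AB: "xs = A @ p # B" using split_list[of p xs] by auto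
  have c: "cyc F ((p # B) @ A)" using cyc_rotate1 xs(1) unfolding AB by blast
  let ?C = "B @ A"
  have d: "distinct (p # ?C)" "successively F (p # ?C)" "F (last (p # ?C)) p" using c unfolding cyc_def by auto
  have len: "2 \<le> length ?C" using c unfolding cyc_def by auto
  have ne: "?C \<noteq> []" using len by auto
  have s: "set ?C = W"
  proof -
    have "set (p # ?C) = insert p W" using xs(2) unfolding AB by auto
    then show ?thesis using d(1) assms(2) by auto
  qed
  show ?thesis
  proof (rule that[of ?C])
    show "F (hd ?C) p" "F p (last ?C)" "successively F ?C"
      using d ne comm by (auto simp: successively_Cons simp del: append_is_Nil_conv)
    show "hd ?C \<noteq> last ?C" using d(1) len by (cases ?C) auto
  qed (use s d ne in auto)
qed

text \<open>
  Either part together with one vertex of the other, which stands for the whole of it, is again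
  2-connected, and Hamiltonian cycles of these two smaller graphs can be glued inside the clique \<open>R\<close>.
\<close>

lemma glue:
  assumes tc: "twoconn U F" and nh: "\<not> ham U F" and U: "U = V1 \<union> V2" "V1 \<inter> V2 = {}"
    and R: "\<And>p q. p \<in> R \<Longrightarrow> q \<in> R \<Longrightarrow> p \<noteq> q \<Longrightarrow> F p q"
    and e: "\<And>u v. u \<in> V1 \<Longrightarrow> v \<in> V2 \<Longrightarrow> F u v \<Longrightarrow> u \<in> R \<and> v \<in> R"
    and c: "2 \<le> card V1" "2 \<le> card V2" and pq: "p \<in> R \<inter> V2" "q \<in> R \<inter> V1"
  shows "\<exists>U'. U' \<subset> U \<and> twoconn U' F \<and> \<not> ham U' F"
proof -
  have sub: "twoconn (insert p W1) F \<and> insert p W1 \<subset> U"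
    if W: "U = W1 \<union> W2" "W1 \<inter> W2 = {}" "2 \<le> card W1" "2 \<le> card W2" "p \<in> R \<inter> W2"
      "\<And>u v. u \<in> W1 \<Longrightarrow> v \<in> W2 \<Longrightarrow> F u v \<Longrightarrow> u \<in> R \<and> v \<in> R" for W1 W2 p
  proof
    have fin: "finite W1" "finite W2" using W(3,4) by (metis card.infinite not_numeral_le_zero)+
    obtain p2 where p2: "p2 \<in> W2" "p2 \<noteq> p" 
      using W(4) card_mono[of "{p}" W2] by fastforce
    show "insert p W1 \<subset> U" using p2 W by auto
    \<comment> \<open>A walk can leave \<open>W1\<close> only from a vertex of \<open>R\<close>, so
      each vertex of \<open>W1\<close> reaches \<open>R\<close> inside its own part even after
      \<open>x\<close> is deleted.\<close>
    have inside: "\<exists>r \<in> R \<inter> W1. r \<noteq> x \<and> linked F (W1 - {x}) y r" 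
      if y: "y \<in> W1" "y \<noteq> x" and z: "z \<in> W2" "z \<noteq> x" for x y z
    proof -
      have "linked F (U - {x}) y z" using tc W(1) y z unfolding twoconn_def by blast
      then have "(z \<in> W1 \<and> linked F (W1 - {x}) y z) \<or> (\<exists>r \<in> R \<inter> W1. r \<noteq> x \<and> linked F (W1 - {x}) y r)"
      proof (induction rule: linked_induct)
        case refl
        then show ?case using y by simp
      next
        case (step v w)
        show ?case
        proof (cases "w \<in> W1")
          case True
          then show ?thesis using step.IH step.hyps linked_trans[OF _ linked_edge[of F v w "W1 - {x}"]] by auto
        next
          case False
          then have "w \<in> W2" using step.hyps W(1) by auto
          then show ?thesis using step.IH step.hyps W(6)[of v w] by blast
        qed
      qed
      then show ?thesis using z W(2) by blast
    qed
    have "card (insert p W1) = Suc (card W1)" using W(2,5) fin by (subst card_insert_disjoint) auto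
    moreover have "linked F (insert p W1 - {x}) u v"
      if uv: "u \<in> insert p W1 - {x}" "v \<in> insert p W1 - {x}" for x u v
    proof -
      have "\<exists>h. \<forall>y \<in> insert p W1 - {x}. linked F (insert p W1 - {x}) y h"
      proof (cases "x = p")
        case True
        obtain h where h: "h \<in> W1" using W(3) by (cases "W1 = {}") auto
        then obtain r0 where r0: "r0 \<in> R \<inter> W1" using inside[of h p p2] p2 W(2,5) True by blast
        have "linked F (insert p W1 - {x}) y r0" if y: "y \<in> insert p W1 - {x}" for y
        proof -
          have y1: "y \<in> W1" using y True by auto
          then obtain r where r: "r \<in> R \<inter> W1" "linked F (W1 - {x}) y r"
            using inside[of y p p2] y p2 True by auto
          have "linked F (W1 - {x}) r r0"
            using r0 r R W(2,5) True by (cases "r = r0") (auto intro!: linked_edge)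
          then have "linked F (W1 - {x}) y r0" using r(2) by (rule linked_trans[rotated])
          then show ?thesis by (rule linked_mono) auto
        qed
        then show ?thesis by blast
      next
        case False
        have "linked F (insert p W1 - {x}) y p" if y: "y \<in> insert p W1 - {x}" for y
        proof (cases "y = p")
          case yp: False
          then obtain r where r: "r \<in> R \<inter> W1" "r \<noteq> x" "linked F (W1 - {x}) y r"
            using inside[of y x p] y W(5) False by auto
          have "linked F (insert p W1 - {x}) y r" using r(3) by (rule linked_mono) auto
          moreover have "linked F (insert p W1 - {x}) r p"
            using r R[of r p] W(2,5) False by (intro linked_edge) auto
          ultimately show ?thesis by (rule linked_trans)
        qed simp
        then show ?thesis by blast
      qed
      then obtain h where h: "\<And>y. y \<in> insert p W1 - {x} \<Longrightarrow> linked F (insert p W1 - {x}) y h" by blast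
      show ?thesis using linked_trans[OF h[OF uv(1)] linked_sym[OF h[OF uv(2)] symF]] .
    qed
    ultimately show "twoconn (insert p W1) F" using W(3) unfolding twoconn_def by auto
  qed
  have 1: "twoconn (insert p V1) F \<and> insert p V1 \<subset> U" using sub[OF U c pq(1) e] .
  have 2: "twoconn (insert q V2) F \<and> insert q V2 \<subset> U"
  proof (rule sub[of V2 V1])
    show "u \<in> R \<and> v \<in> R" if "u \<in> V2" "v \<in> V1" "F u v" for u v using e[of v u] that comm by blast
  qed (use U c pq in auto)
  have "\<not> ham (insert p V1) F \<or> \<not> ham (insert q V2) F"
  proof (rule ccontr)
    assume "\<not> ?thesis"
    then have h: "ham (insert p V1) F" "ham (insert q V2) F" by auto
    have "p \<notin> V1" "q \<notin> V2" using pq U by auto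
    obtain A where A: "set A = V1" "distinct A" "successively F A" "A \<noteq> []" "F (hd A) p" "F p (last A)" "hd A \<noteq> last A"
      using ham_minus[OF h(1) \<open>p \<notin> V1\<close> c(1)] by metis
    obtain B where B: "set B = V2" "distinct B" "successively F B" "B \<noteq> []" "F (hd B) q" "F q (last B)" "hd B \<noteq> last B"
      using ham_minus[OF h(2) \<open>q \<notin> V2\<close> c(2)] by metis
    have in1: "hd A \<in> V1" "last A \<in> V1" "hd B \<in> V2" "last B \<in> V2" using A(1,4) B(1,4) by auto
    \<comment> \<open>The cycle neighbours of \<open>p\<close> lie in \<open>V1\<close> and those of
      \<open>q\<close> in \<open>V2\<close>, and all of them in \<open>R\<close>; hence the clique
      supplies both edges joining the two paths.\<close>
    then have inR: "hd A \<in> R" "last A \<in> R" "hd B \<in> R" "last B \<in> R"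
      using e[OF in1(1) _ A(5)] e[OF in1(2) _ symF[OF A(6)]] e[OF _ in1(3) symF[OF B(5)]] e[OF _ in1(4) B(6)] pq
      by blast+
    have "last A \<noteq> hd B" "last B \<noteq> hd A" using in1 U(2) by auto
    then have "F (last A) (hd B)" "F (last B) (hd A)"
      using R[OF inR(2,3)] R[OF inR(4,1)] by simp_all
    moreover have "3 \<le> length (A @ B)" using A(4,7) B(4,7) by (cases A; cases B; cases "tl A"; auto)
    ultimately have "ham U F" using A B U by (intro ham_intro[of "A @ B"]) (auto simp: successively_append_iff)
    then show False using nh by blast
  qed
  then show ?thesis using 1 2 by blast
qed

end

section \<open>Induced thetas in closed graphs\<close>

text \<open>
  Brousek's graphs: two triangles joined by three arms. An arm with only two vertices must carry a
  private common neighbour \<open>c i\<close> of them; on longer arms \<open>c i\<close> is irrelevant.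
\<close>

definition theta :: "('a \<Rightarrow> 'a \<Rightarrow> bool) \<Rightarrow> 'a set \<Rightarrow> (nat \<Rightarrow> 'a list) \<Rightarrow> (nat \<Rightarrow> 'a) \<Rightarrow> bool" where
  "theta F V X c \<longleftrightarrow>
     (\<forall>i<3. ipath F (X i) \<and> 2 \<le> length (X i) \<and> set (X i) \<subseteq> V) \<and>
     (\<forall>i<3. \<forall>j<3. i \<noteq> j \<longrightarrow> cross F (X i) (X j)) \<and>
     (\<forall>i<3. length (X i) = 2 \<longrightarrow> c i \<in> V \<and> F (c i) (hd (X i)) \<and> F (c i) (last (X i)) \<and>
        (\<forall>j<3. j \<noteq> i \<longrightarrow> (\<forall>u \<in> set (X j). c i \<noteq> u \<and> \<not> F (c i) u) \<and>
           (length (X j) = 2 \<longrightarrow> c i \<noteq> c j \<and> \<not> F (c i) (c j))))"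

context closed_graph
begin

lemma cross_sym: "cross F X Y \<Longrightarrow> cross F Y X"
  unfolding cross_def using comm by blast

lemma icyc_theta:
  assumes "X \<noteq> []" "Y \<noteq> []" "ipath F X" "ipath F Y" "cross F X Y" "4 \<le> length X + length Y"
  shows "icyc F (X @ rev Y)"
proof -
  have "F u v \<longleftrightarrow> u = last X \<and> v = hd (rev Y) \<or> u = hd X \<and> v = last (rev Y)" if "u \<in> set X" "v \<in> set (rev Y)" for u v
    using assms(2,5) that unfolding cross_def by (auto simp: hd_rev last_rev)
  moreover have "set X \<inter> set (rev Y) = {}" using assms(5) unfolding cross_def by auto
  ultimately show ?thesis using assms by (simp add: icyc_append ipath_rev[OF symF])
qed

definition domset :: "'a set \<Rightarrow> 'a list \<Rightarrow> 'a set" where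
  "domset U S = {v \<in> U. v \<in> set S \<or> (\<exists>e \<in> set S. F v e)}"

lemma domsetI: "v \<in> U \<Longrightarrow> e \<in> set S \<Longrightarrow> v = e \<or> F v e \<Longrightarrow> v \<in> domset U S"
  unfolding domset_def by auto

end

text \<open>
  \<open>L @ rev N\<close> is an induced cycle dominating as many vertices as possible, \<open>P\<close> is a path attached to
  it, and \<open>w\<close> is undominated. An induced cycle through \<open>hd P\<close> or \<open>w\<close> dominates \<open>w\<close> as well, so it must
  miss a vertex that \<open>L @ rev N\<close> dominates.
\<close>

locale theta_setup = closed_graph +
  fixes U :: "'a set" and L N P :: "'a list" and w :: 'a
  assumes finU: "finite U" and UV: "U \<subseteq> V"
    and ipL: "ipath F L" and ipN: "ipath F N" and ipP: "ipath F P"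
    and ne: "L \<noteq> []" "N \<noteq> []" and P2: "2 \<le> length P"
    and sub: "set L \<subseteq> U" "set N \<subseteq> U" "set P \<subseteq> U"
    and LN: "cross F L N" and LP: "cross F L P" and NP: "cross F N P"
    and len: "4 \<le> length L + length N"
    and max: "\<And>S'. icyc F S' \<Longrightarrow> set S' \<subseteq> U \<Longrightarrow> card (domset U S') \<le> card (domset U (L @ rev N))"
    and w: "w \<in> U" "w \<notin> domset U (L @ rev N)" "F w (hd P)" "length P = 2 \<longrightarrow> F w (last P)"
begin

lemma swap_setup: "theta_setup V F U N L P w"
proof
  show "cross F N L" using LN by (rule cross_sym)
  have "domset U (N @ rev L) = domset U (L @ rev N)" unfolding domset_def by auto
  then show "w \<notin> domset U (N @ rev L)"
    "\<And>S'. icyc F S' \<Longrightarrow> set S' \<subseteq> U \<Longrightarrow> card (domset U S') \<le> card (domset U (N @ rev L))"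
    using w(2) max by simp_all
qed (use finU UV ipL ipN ipP ne P2 sub LP NP len w in auto)

lemma undominated:
  assumes "icyc F S'" "set S' \<subseteq> U" "hd P \<in> set S' \<or> w \<in> set S'"
  obtains v where "v \<in> U" "v \<in> domset U (L @ rev N)" "v \<notin> set S'" "\<And>e. e \<in> set S' \<Longrightarrow> \<not> F v e"
proof -
  have "w \<in> domset U S'" using assms(3) w unfolding domset_def by auto
  moreover have "finite (domset U S')" using finU unfolding domset_def by simp
  ultimately have "\<not> domset U (L @ rev N) \<subseteq> domset U S'"
    using psubset_card_mono[of "domset U S'" "domset U (L @ rev N)"] max[OF assms(1,2)] w(2) by auto
  then obtain v where "v \<in> domset U (L @ rev N)" "v \<notin> domset U S'" by blast
  then show ?thesis using that[of v] unfolding domset_def by auto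
qed

lemma w_nonadj: "e \<in> set L \<union> set N \<Longrightarrow> w \<noteq> e \<and> \<not> F w e"
  using w(1,2) unfolding domset_def by auto

lemma hdlast: "hd L \<in> set L" "last L \<in> set L" "hd N \<in> set N" "last N \<in> set N" "hd P \<in> set P" "last P \<in> set P"
  "hd P \<noteq> last P"
  using ne P2 ipP by (cases P; auto)+

lemma ends:
  "F (hd L) (hd P)" "F (hd L) (hd N)" "F (hd N) (hd P)"
  "F (last L) (last P)" "F (last L) (last N)" "F (last N) (last P)"
  using LN LP NP hdlast unfolding cross_def by blast+

text \<open>The arms \<open>N\<close> and \<open>P\<close> form an induced cycle through
  \<open>hd P\<close>, so some dominated vertex \<open>c\<close> is lost by it and is dominated only
  from \<open>L\<close>. If \<open>L\<close> were a single vertex, it would centre a claw with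
  \<open>c\<close> and the two ends of \<open>N\<close>; if \<open>L\<close> has two vertices, claws
  at them make \<open>c\<close> see both.\<close>

lemma short_arm:
  assumes "length L \<le> 2"
  shows "length L = 2 \<and> (\<exists>c \<in> U. c \<in> domset U (L @ rev N) \<and> F c (hd L) \<and> F c (last L) \<and>
     (\<forall>u \<in> set N \<union> set P. c \<noteq> u \<and> \<not> F c u))"
proof -
  have "P \<noteq> []" using P2 by auto
  moreover have "4 \<le> length N + length P" using assms len P2 by linarith
  ultimately have ic: "icyc F (N @ rev P)" using icyc_theta[OF ne(2) _ ipN ipP NP] by blast
  obtain c where c: "c \<in> U" "c \<in> domset U (L @ rev N)" "c \<notin> set N \<union> set P" "\<And>e. e \<in> set N \<union> set P \<Longrightarrow> \<not> F c e"
    using undominated[OF ic] sub hdlast by auto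
  obtain e where e: "e \<in> set L" "c = e \<or> F c e" using c unfolding domset_def by auto
  consider l where "L = [l]" | l1 l2 where "L = [l1, l2]"
    using assms ne(1) by (cases L; cases "tl L") auto
  then show ?thesis
  proof cases
    case 1
    then have l: "F l (hd N)" "F l (last N)" "F l (hd P)" using ends by auto
    have "2 \<le> length N" using len 1 by simp
    then have "3 \<le> length N" using len 1 by simp
    then obtain p q r where pqr: "N = p # q # r" "r \<noteq> []" by (cases N; cases "tl N"; cases "tl (tl N)") auto
    have lr: "last r \<in> set r" using pqr by auto
    have "hd N \<noteq> last N \<and> \<not> F (hd N) (last N)" using ipN lr pqr by auto
    moreover have "c \<noteq> l" using c(4)[of "hd P"] hdlast l by auto
    then have "F l c" using e 1 symF by auto
    ultimately show ?thesis
      using clawD[of l "hd N" "last N" c] l c(3) c(4)[of "hd N"] c(4)[of "last N"] hdlast comm by blast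
  next
    case 2
    have l: "F l1 (hd P)" "F l2 (last P)" "F l1 (hd N)" "F l2 (last N)" "F l1 l2" using ends ipL 2 by auto
    have "c \<noteq> l1" "c \<noteq> l2" using c(4)[of "hd P"] c(4)[of "last P"] hdlast l by auto
    have n: "l2 \<noteq> hd N" "l1 \<noteq> last N" "\<not> F l2 (hd N) \<or> hd N = last N" "\<not> F l1 (last N) \<or> hd N = last N"
      using LN hdlast 2 ipL unfolding cross_def by auto
    have hn: "hd N \<noteq> last N"
    proof -
      have "2 \<le> length N" using len 2 by simp
      then show ?thesis using ipN by (cases N) auto
    qed
    have nc: "\<not> F c (hd N)" "\<not> F c (last N)" "c \<noteq> hd N" "c \<noteq> last N" using c(3,4) hdlast by auto
    have "F c l1 \<and> F c l2"
    proof (cases "F c l1")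
      case True
      then show ?thesis using clawD[of l1 "hd N" l2 c] l n hn nc \<open>c \<noteq> l2\<close> comm by blast
    next
      case False
      then have "F c l2" using e 2 \<open>c \<noteq> l1\<close> \<open>c \<noteq> l2\<close> by auto
      then show ?thesis using clawD[of l2 "last N" l1 c] l n hn nc \<open>c \<noteq> l1\<close> comm by blast
    qed
    then show ?thesis using c 2 by auto
  qed
qed

text \<open>Applied to vertices \<open>x\<close> that an exchange removes from the cycle: if two
  nonadjacent neighbours of \<open>x\<close> are on the new cycle, the claw at \<open>x\<close>
  keeps all its neighbours dominated.\<close>

lemma domset_cover:
  assumes "x \<in> set L \<union> set N" "F x p" "F x q" "p \<noteq> q" "\<not> F p q" "p \<in> set S'" "q \<in> set S'" "F v x" "v \<in> U"
  shows "v \<in> domset U S'"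
  using clawD[of x p q v] assms comm domsetI[of v U p S'] domsetI[of v U q S'] by blast

text \<open>If \<open>c\<close> and \<open>d\<close> were adjacent, \<open>l1, c, d, n2\<close> and
  \<open>P\<close> would form an induced cycle that omits only \<open>l2\<close> and
  \<open>n1\<close> of the old one. Both of these see the nonadjacent vertices \<open>l1\<close> and
  \<open>n2\<close>, so no dominated vertex would be lost, contrary to
  \<open>undominated\<close>.\<close>

lemma private_nonadj:
  assumes L2: "length L = 2" and N2: "length N = 2"
    and c: "c \<in> U" "F c (hd L)" "F c (last L)" "\<And>u. u \<in> set N \<union> set P \<Longrightarrow> c \<noteq> u \<and> \<not> F c u"
    and d: "d \<in> U" "F d (hd N)" "F d (last N)" "\<And>u. u \<in> set L \<union> set P \<Longrightarrow> d \<noteq> u \<and> \<not> F d u"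
  shows "c \<noteq> d \<and> \<not> F c d"
proof -
  obtain l1 l2 where L: "L = [l1, l2]" using L2 by (cases L; cases "tl L") auto
  obtain n1 n2 where N: "N = [n1, n2]" using N2 by (cases N; cases "tl N") auto
  have cd: "c \<noteq> d" using c(2) d(4)[of "hd L"] hdlast by blast
  have x1: "l1 \<noteq> l2" "n1 \<noteq> n2" "F l1 l2" "F n1 n2" using ipL ipN unfolding L N by auto
  have x2: "l1 \<noteq> n2" "l2 \<noteq> n1" "\<not> F l1 n2" "\<not> F l2 n1" "l1 \<noteq> n1" "l2 \<noteq> n2"
    "F l1 n1" "F l2 n2"
    using LN x1(1,2) unfolding L N cross_def by simp_all
  note x = x1 x2
  have "\<not> F c d"
  proof
    assume F: "F c d"
    let ?Y = "[l1, c, d, n2]"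
    have e: "F l1 c" "F d n2" "F c l2" using c(2,3) d(3) symF unfolding L N by auto
    have ne': "l1 \<noteq> d" "\<not> F l1 d" "c \<noteq> n2" "\<not> F c n2" "\<not> F d l1" "\<not> F d l2" "d \<noteq> n2" "l1 \<noteq> c"
      using c(4)[of n2] d(4)[of l1] d(4)[of l2] comm[of d l1] e unfolding L N by auto
    have iY: "ipath F ?Y" using x e ne' F cd by auto
    have Lu: "l \<noteq> u \<and> (F l u \<longleftrightarrow> l = l1 \<and> u = hd P \<or> l = l2 \<and> u = last P)" if "l = l1 \<or> l = l2" "u \<in> set P" for l u
      using LP that unfolding L cross_def by auto
    have Nu: "l \<noteq> u \<and> (F l u \<longleftrightarrow> l = n1 \<and> u = hd P \<or> l = n2 \<and> u = last P)" if "l = n1 \<or> l = n2" "u \<in> set P" for l u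
      using NP that unfolding N cross_def by auto
    have key: "u \<noteq> v \<and> (F u v \<longleftrightarrow> u = l1 \<and> v = hd P \<or> u = n2 \<and> v = last P)"
      if u: "u = l1 \<or> u = c \<or> u = d \<or> u = n2" and v: "v \<in> set P" for u v
      using u
    proof (elim disjE)
      assume "u = l1" then show ?thesis using Lu[of l1 v] v x by simp
    next
      assume "u = n2" then show ?thesis using Nu[of n2 v] v x by simp
    next
      assume "u = c" then show ?thesis using c(4)[of v] v ne' by auto
    next
      assume "u = d" then show ?thesis using d(4)[of v] v ne' by auto
    qed
    have cr: "cross F ?Y P"
      unfolding cross_def
    proof (intro ballI)
      fix u v assume uv: "u \<in> set ?Y" "v \<in> set P"
      have "u = l1 \<or> u = c \<or> u = d \<or> u = n2" using uv(1) by auto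
      from key[OF this uv(2)] show "u \<noteq> v \<and> (F u v \<longleftrightarrow> u = hd ?Y \<and> v = hd P \<or> u = last ?Y \<and> v = last P)" by simp
    qed
    have "icyc F (?Y @ rev P)" using icyc_theta[OF _ _ iY ipP cr] hdlast(5) by (cases P) auto
    moreover have "set (?Y @ rev P) \<subseteq> U" using c d sub unfolding L N by auto
    ultimately obtain v where v: "v \<in> U" "v \<in> domset U (L @ rev N)" "v \<notin> set (?Y @ rev P)"
      "\<And>e. e \<in> set (?Y @ rev P) \<Longrightarrow> \<not> F v e" using undominated[of "?Y @ rev P"] hdlast(5) by auto
    have "v \<noteq> l2" "v \<noteq> n1" using v(4)[of "n2"] v(4)[of l1] x comm[of n1] by auto
    then consider "F v l2" | "F v n1" using v unfolding domset_def L N by auto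
    then show False
    proof cases
      case 1
      then show False using domset_cover[of l2 l1 n2 "?Y @ rev P" v] x v comm[of l2] unfolding L N domset_def by auto
    next
      case 2
      then show False using domset_cover[of n1 l1 n2 "?Y @ rev P" v] x v comm[of n1] unfolding L N domset_def by auto
    qed
  qed
  then show ?thesis using cd by blast
qed

text \<open>The same exchange with \<open>w\<close> as the private vertex of \<open>P\<close>: the
  cycle through \<open>p1, w, c, l2\<close> and \<open>N\<close> omits only \<open>l1\<close>, whose
  nonadjacent neighbours \<open>hd N\<close> and \<open>l2\<close> remain on it.\<close>

lemma private_nonadj_P:
  assumes L2: "length L = 2" and PP: "length P = 2"
    and c: "c \<in> U" "c \<in> domset U (L @ rev N)" "F c (hd L)" "F c (last L)" "\<And>u. u \<in> set N \<union> set P \<Longrightarrow> c \<noteq> u \<and> \<not> F c u"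
  shows "c \<noteq> w \<and> \<not> F c w"
proof -
  obtain l1 l2 where L: "L = [l1, l2]" using L2 by (cases L; cases "tl L") auto
  obtain p1 p2 where P: "P = [p1, p2]" using PP by (cases P; cases "tl P") auto
  have cw: "c \<noteq> w" using c w by blast
  have x1: "l1 \<noteq> l2" "p1 \<noteq> p2" "F l1 l2" "F p1 p2" using ipL ipP unfolding L P by auto
  have x2: "l1 \<noteq> p2" "l2 \<noteq> p1" "\<not> F l1 p2" "\<not> F l2 p1" "l1 \<noteq> p1" "l2 \<noteq> p2"
    "F l1 p1" "F l2 p2"
    using LP x1(1,2) unfolding L P cross_def by simp_all
  note x = x1 x2
  have wn: "w \<noteq> l1" "w \<noteq> l2" "\<not> F w l1" "\<not> F w l2" using w_nonadj L by auto
  have wp: "F w p1" "F w p2" "w \<noteq> p1" using w(3,4) PP P by auto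
  have "\<not> F c w"
  proof
    assume F: "F c w"
    let ?Y = "[p1, w, c, l2]"
    have e: "F l1 c" "F c l2" "F p1 w" "F w c" using c(3,4) F wp symF unfolding L by auto
    have ne': "c \<noteq> p1" "\<not> F p1 c" "\<not> F p1 l2" "c \<noteq> l2"
      using c(5)[of p1] x e(2) symF[of p1 c] symF[of p1 l2] unfolding P by auto
    have iY: "ipath F ?Y" using x e ne' F cw wn wp by auto
    have l2N: "4 \<le> length ?Y + length N" by simp
    have Lu: "l \<noteq> u \<and> (F l u \<longleftrightarrow> l = l1 \<and> u = hd N \<or> l = l2 \<and> u = last N)" if "l = l1 \<or> l = l2" "u \<in> set N" for l u
      using LN that unfolding L cross_def by auto
    have Pu: "u \<noteq> l \<and> (F l u \<longleftrightarrow> l = p1 \<and> u = hd N \<or> l = p2 \<and> u = last N)" if "l = p1 \<or> l = p2" "u \<in> set N" for l u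
      using NP that comm[of l u] unfolding P cross_def by auto
    have key: "u \<noteq> v \<and> (F u v \<longleftrightarrow> u = p1 \<and> v = hd N \<or> u = l2 \<and> v = last N)"
      if u: "u = p1 \<or> u = w \<or> u = c \<or> u = l2" and v: "v \<in> set N" for u v
      using u
    proof (elim disjE)
      assume "u = l2" then show ?thesis using Lu[of l2 v] v x by simp
    next
      assume "u = p1" then show ?thesis using Pu[of p1 v] v x by auto
    next
      assume "u = c" then show ?thesis using c(5)[of v] v ne' by auto
    next
      assume "u = w" then show ?thesis using w_nonadj[of v] v wn wp by auto
    qed
    have cr: "cross F ?Y N"
      unfolding cross_def
    proof (intro ballI)
      fix u v assume uv: "u \<in> set ?Y" "v \<in> set N"
      have "u = p1 \<or> u = w \<or> u = c \<or> u = l2" using uv(1) by auto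
      from key[OF this uv(2)] show "u \<noteq> v \<and> (F u v \<longleftrightarrow> u = hd ?Y \<and> v = hd N \<or> u = last ?Y \<and> v = last N)" by simp
    qed
    have "icyc F (?Y @ rev N)" using icyc_theta[OF _ ne(2) iY ipN cr l2N] by auto
    moreover have "set (?Y @ rev N) \<subseteq> U" using c w sub unfolding L P by auto
    ultimately obtain v where v: "v \<in> U" "v \<in> domset U (L @ rev N)" "v \<notin> set (?Y @ rev N)"
      "\<And>e. e \<in> set (?Y @ rev N) \<Longrightarrow> \<not> F v e" using undominated[of "?Y @ rev N"] by auto
    have hn: "F l1 (hd N)" "hd N \<noteq> l2" "\<not> F (hd N) l2 \<or> hd N = last N" "F l2 (last N)"
      using Lu[of l1 "hd N"] Lu[of l2 "hd N"] Lu[of l2 "last N"] hdlast x comm[of "hd N"] by auto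
    have hn2: "hd N \<noteq> last N"
    proof -
      have "2 \<le> length N" using len L by simp
      then show ?thesis using ipN by (cases N) auto
    qed
    have "v \<noteq> l1" using v(4)[of l2] x by auto
    then have "F v l1" using v unfolding domset_def L by auto
    then show False using domset_cover[of l1 "hd N" l2 "?Y @ rev N" v] hn hn2 x v hdlast unfolding L domset_def by auto
  qed
  then show ?thesis using cw by blast
qed

lemma theta_exists: "\<exists>X c. theta F V X c"
proof -
  interpret sw: theta_setup V F U N L P w by (rule swap_setup)
  have L2: "2 \<le> length L" using short_arm ne by (cases "length L \<le> 2") auto
  have N2: "2 \<le> length N" using sw.short_arm ne by (cases "length N \<le> 2") auto
  obtain c where c: "length L = 2 \<longrightarrow> c \<in> U \<and> c \<in> domset U (L @ rev N) \<and> F c (hd L) \<and> F c (last L) \<and>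
     (\<forall>u \<in> set N \<union> set P. c \<noteq> u \<and> \<not> F c u)" using short_arm by (cases "length L = 2") auto
  obtain d where d: "length N = 2 \<longrightarrow> d \<in> U \<and> d \<in> domset U (N @ rev L) \<and> F d (hd N) \<and> F d (last N) \<and>
     (\<forall>u \<in> set L \<union> set P. d \<noteq> u \<and> \<not> F d u)" using sw.short_arm by (cases "length N = 2") auto
  have cd: "length L = 2 \<longrightarrow> length N = 2 \<longrightarrow> c \<noteq> d \<and> \<not> F c d" using private_nonadj[of c d] c d by blast
  have cw: "length L = 2 \<longrightarrow> length P = 2 \<longrightarrow> c \<noteq> w \<and> \<not> F c w" using private_nonadj_P[of c] c by blast
  have dw: "length N = 2 \<longrightarrow> length P = 2 \<longrightarrow> d \<noteq> w \<and> \<not> F d w" using sw.private_nonadj_P[of d] d by blast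
  have i3: "(\<forall>i<3. Q i) \<longleftrightarrow> Q 0 \<and> Q 1 \<and> Q (2::nat)" for Q
    by (auto simp: less_Suc_eq numeral_3_eq_3 numeral_2_eq_2)
  have cs: "cross F N L" "cross F P L" "cross F P N" using LN LP NP cross_sym by blast+
  have t0: "length L = 2 \<longrightarrow> c \<in> V \<and> F c (hd L) \<and> F c (last L) \<and> (\<forall>u \<in> set N. c \<noteq> u \<and> \<not> F c u) \<and>
      (\<forall>u \<in> set P. c \<noteq> u \<and> \<not> F c u)" using c UV by blast
  have t1: "length N = 2 \<longrightarrow> d \<in> V \<and> F d (hd N) \<and> F d (last N) \<and> (\<forall>u \<in> set L. d \<noteq> u \<and> \<not> F d u) \<and>
      (\<forall>u \<in> set P. d \<noteq> u \<and> \<not> F d u)" using d UV by blast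
  have t2: "length P = 2 \<longrightarrow> w \<in> V \<and> F w (hd P) \<and> F w (last P) \<and> (\<forall>u \<in> set L. w \<noteq> u \<and> \<not> F w u) \<and>
      (\<forall>u \<in> set N. w \<noteq> u \<and> \<not> F w u)" using w w_nonadj UV by blast
  have sy: "length L = 2 \<longrightarrow> length N = 2 \<longrightarrow> d \<noteq> c \<and> \<not> F d c" "length L = 2 \<longrightarrow> length P = 2 \<longrightarrow> w \<noteq> c \<and> \<not> F w c"
    "length N = 2 \<longrightarrow> length P = 2 \<longrightarrow> w \<noteq> d \<and> \<not> F w d" using cd cw dw symF by blast+
  have sV: "set L \<subseteq> V" "set N \<subseteq> V" "set P \<subseteq> V" using sub UV by auto
  have "theta F V ((!) [L, N, P]) ((!) [c, d, w])"
    unfolding theta_def i3 using t0 t1 t2 sy cd cw dw LN LP NP cs ipL ipN ipP L2 N2 P2 sV by simp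
  then show ?thesis by blast
qed

end

section \<open>Finding a theta in a minimal nonhamiltonian subgraph\<close>

context closed_graph
begin

lemma nonham_theta:
  assumes tc: "twoconn V F" and nh: "\<not> ham V F"
  shows "\<exists>X c. theta F V X c"
proof -
  let ?B = "{U. U \<subseteq> V \<and> twoconn U F \<and> \<not> ham U F}"
  have "finite ?B" "?B \<noteq> {}" using gF tc nh unfolding sgraph_def by auto
  then have "\<exists>U \<in> ?B. \<forall>U' \<in> ?B. U' \<subseteq> U \<longrightarrow> U = U'" by (rule finite_has_minimal)
  then obtain U where U: "U \<subseteq> V" "twoconn U F" "\<not> ham U F"
    and least: "\<And>U'. U' \<in> ?B \<Longrightarrow> U' \<subseteq> U \<Longrightarrow> U = U'" by auto
  have minU: "\<not> (\<exists>U'. U' \<subset> U \<and> twoconn U' F \<and> \<not> ham U' F)" using least U(1) by blast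
  have fU: "finite U" using U(1) gF finite_subset unfolding sgraph_def by blast
  have "\<exists>S. icyc F S \<and> set S \<subseteq> U"
  proof (rule ccontr)
    assume "\<not> ?thesis"
    then have "F u v" if "u \<in> U" "v \<in> U" "u \<noteq> v" for u v using complete_or_icyc[OF U(2) _ that] by blast
    then show False using complete_ham[OF fU] U(2,3) unfolding twoconn_def by blast
  qed
  then obtain S0 where "icyc F S0 \<and> set S0 \<subseteq> U" by blast
  moreover have "\<forall>S. icyc F S \<and> set S \<subseteq> U \<longrightarrow> card (domset U S) < Suc (card U)"
    using card_mono[OF fU] unfolding domset_def by (auto simp: less_Suc_eq_le)
  ultimately obtain S where S: "icyc F S" "set S \<subseteq> U"
    and maxS: "\<And>S'. icyc F S' \<Longrightarrow> set S' \<subseteq> U \<Longrightarrow> card (domset U S') \<le> card (domset U S)"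
    using ex_has_greatest_nat[of "\<lambda>S. icyc F S \<and> set S \<subseteq> U" S0 "\<lambda>S. card (domset U S)" "Suc (card U)"] by blast
  let ?D = "domset U S"
  have "\<not> U \<subseteq> ?D" using dominating_icyc_ham[OF S fU] U(3) unfolding domset_def by blast
  then obtain o0 where o0: "o0 \<in> U" "o0 \<notin> ?D" by blast
  \<comment> \<open>The component of \<open>o0\<close> among the undominated vertices.\<close>
  define Q1 where "Q1 = {z. linked F (U - ?D) o0 z}"
  have o0Q: "o0 \<in> Q1" unfolding Q1_def by simp
  have Q1sub: "z \<in> U \<and> z \<notin> ?D" if "z \<in> Q1" for z
  proof -
    have "linked F (U - ?D) o0 z" using that unfolding Q1_def by simp
    then show ?thesis by (induction rule: linked_induct) (use o0 in auto)
  qed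
  have Q1ext: "v \<in> Q1" if "z \<in> Q1" "F z v" "v \<in> U" "v \<notin> ?D" for z v
  proof -
    have "linked F (U - ?D) z v" using that Q1sub[OF that(1)] by (intro linked_edge) auto
    moreover have "linked F (U - ?D) o0 z" using that(1) unfolding Q1_def by simp
    ultimately have "linked F (U - ?D) o0 v" by (rule linked_trans[rotated])
    then show ?thesis unfolding Q1_def by simp
  qed
  have Q1linked: "linked F Q1 o0 z" if "z \<in> Q1" for z
  proof -
    have "linked F (U - ?D) o0 z" using that unfolding Q1_def by simp
    then show ?thesis
    proof (induction rule: linked_induct)
      case (step v w)
      have "v \<in> Q1" "w \<in> Q1" using step.hyps linked_trans[OF step.hyps(1) linked_edge[of F v w]]
        unfolding Q1_def by auto
      then show ?case using linked_trans[OF step.IH linked_edge[of F v w Q1]] step.hyps by blast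
    qed simp
  qed
  have Q1S: "\<not> F z e \<and> z \<noteq> e" if "z \<in> Q1" "e \<in> set S" for z e
    using Q1sub[OF that(1)] that(2) unfolding domset_def by auto
  \<comment> \<open>The contacts of the component are its outside neighbours, and \<open>T f\<close>
    is the trace of a contact on the cycle. As a contact has a neighbour in \<open>Q1\<close>, the
    claw at it makes its trace a clique, and the trace turns out to be one cycle edge.\<close>
  define con where "con f \<longleftrightarrow> f \<in> U \<and> f \<notin> Q1 \<and> (\<exists>z \<in> Q1. F f z)" for f
  define T where "T f = {z \<in> set S. F f z}" for f
  have con: "f \<in> U" "f \<notin> Q1" "f \<notin> set S" "\<exists>z \<in> Q1. F f z" "\<exists>e \<in> set S. F f e" if f: "con f" for f
  proof -
    show f1: "f \<in> U" "f \<notin> Q1" "\<exists>z \<in> Q1. F f z" using f unfolding con_def by auto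
    then obtain z where z: "z \<in> Q1" "F f z" by blast
    show f3: "f \<notin> set S" using Q1S[OF z(1)] z(2) comm by blast
    have "f \<in> ?D" using Q1ext[OF z(1) symF[OF z(2)] f1(1)] f1(2) by blast
    then show "\<exists>e \<in> set S. F f e" using f3 unfolding domset_def by auto
  qed
  have Tcl: "F a b" if f: "con f" and a: "a \<in> T f" and b: "b \<in> T f" and ab: "a \<noteq> b" for f a b
  proof -
    obtain z where z: "z \<in> Q1" "F f z" using con(4)[OF f] by blast
    have ab': "a \<in> set S" "b \<in> set S" "F f a" "F f b" using a b unfolding T_def by auto
    have "z \<noteq> a" "z \<noteq> b" "\<not> F z a" "\<not> F z b" using Q1S[OF z(1)] ab' by auto
    then show ?thesis using clawD[of f z a b] z ab ab' by blast
  qed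
  have notri: False if "a \<in> set S" "b \<in> set S" "z \<in> set S" "F a b" "F a z" "F b z" for a b z
    using icyc_nbrs[OF S(1) that(1)] that(2-6) irr comm by metis
  have pair: "\<exists>S'. icyc F S' \<and> set S' = set S \<and> F f (hd S') \<and> F f (last S')" if f: "con f" for f
  proof -
    obtain e where e: "e \<in> set S" "F f e" using con(5)[OF f] by blast
    from icyc_consecutive[OF S(1) con(3)[OF f] e] show ?thesis
    proof (elim disjE exE conjE)
      fix A x y B assume a: "S = A @ x # y # B" "F f x" "F f y"
      have "icyc F ((y # B) @ (A @ [x]))" using icyc_swap[of "A @ [x]" "y # B"] S(1) a(1) by simp
      moreover have "set ((y # B) @ (A @ [x])) = set S" using a(1) by auto
      ultimately show ?thesis using a(2,3) by (intro exI[of _ "(y # B) @ (A @ [x])"]) auto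
    next
      assume "F f (last S)" "F f (hd S)"
      then show ?thesis using S(1) by blast
    qed
  qed
  have Tpair: "T f = {a, b}" if f: "con f" and ab: "a \<in> T f" "b \<in> T f" "a \<noteq> b" for f a b
  proof (rule ccontr)
    assume "T f \<noteq> {a, b}"
    then obtain z where z: "z \<in> T f" "z \<noteq> a" "z \<noteq> b" using ab by blast
    have "F a b" "F a z" "F b z" using Tcl[OF f] ab z by metis+
    moreover have "a \<in> set S" "b \<in> set S" "z \<in> set S" using ab z unfolding T_def by auto
    ultimately show False using notri by blast
  qed
  \<comment> \<open>If all traces were the same edge, all contacts would lie in the region of this
    edge, and every edge between \<open>Q1\<close> with its contacts and the rest would run inside
    that region. Then \<open>glue\<close> would contradict the minimality of
    \<open>U\<close>.\<close>
  have "\<exists>f1 f2. con f1 \<and> con f2 \<and> T f1 \<noteq> T f2"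
  proof (rule ccontr)
    assume "\<not> ?thesis"
    then have same: "T f = T g" if "con f" "con g" for f g using that by blast
    obtain e where e: "e \<in> set S" using icyc_edges(4)[OF S(1)] by (cases S) auto
    have "\<not> U \<subseteq> {o0, e}" using U(2) card_mono[of "{o0, e}" U] card_insert_le_m1[of 2 "{e}" o0]
      unfolding twoconn_def by auto
    then obtain x where x: "x \<in> U - {o0, e}" by blast
    have "e \<noteq> o0" "e \<notin> Q1" using Q1S o0Q e irr by metis+
    then have "linked F (U - {x}) o0 e" using U(2) x o0 e S(2) unfolding twoconn_def by auto
    then obtain z f where zf: "F z f" "z \<in> U - {x}" "f \<in> U - {x}" "z \<in> Q1" "f \<notin> Q1"
      using linked_crossing[of F "U - {x}" o0 e "\<lambda>z. z \<in> Q1"] o0Q \<open>e \<notin> Q1\<close> by metis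
    then have f: "con f" unfolding con_def using symF by blast
    obtain S' where S': "icyc F S'" "set S' = set S" "F f (hd S')" "F f (last S')" using pair[OF f] by blast
    define a b where "a = hd S'" and "b = last S'"
    have ab: "a \<in> set S" "b \<in> set S" "F b a" "a \<noteq> b" "F f a" "F f b"
      using S' icyc_edges(3,4)[OF S'(1)] irr unfolding a_def b_def
      by (metis hd_in_set last_in_set list.size(3) not_numeral_le_zero)+
    define R where "R = region F b a"
    define V1 where "V1 = Q1 \<union> {f. con f}"
    have V1U: "V1 \<subseteq> U" using Q1sub con(1) unfolding V1_def by blast
    have Rfab: "g \<in> R" if "con g" for g
    proof -
      have "T g = T f" using same f that by blast
      then show ?thesis using ab unfolding T_def R_def region_def by blast
    qed
    have SV1: "e \<notin> V1" if "e \<in> set S" for e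
      using that con(3) Q1S irr unfolding V1_def by blast
    have eR: "u \<in> R \<and> v \<in> R" if uv: "u \<in> V1" "v \<in> U - V1" "F u v" for u v
    proof (cases "u \<in> Q1")
      case True
      then have "con v" using uv Q1ext symF unfolding con_def V1_def by blast
      then show ?thesis using uv unfolding V1_def by blast
    next
      case False
      then have cu: "con u" using uv unfolding V1_def by blast
      then obtain z where z: "z \<in> Q1" "F u z" using con(4) by blast
      have vz: "\<not> F z v" "z \<noteq> v" using uv z unfolding V1_def con_def using symF by blast+
      have uab: "F u a" "F u b" using Rfab[OF cu] con(3)[OF cu] ab unfolding R_def region_def by auto
      have za: "\<not> F z a" "\<not> F z b" "z \<noteq> a" "z \<noteq> b" using Q1S[OF z(1)] ab by auto
      have "v = a \<or> F a v" using clawD[of u z a v] uab z vz za uv by blast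
      moreover have "v = b \<or> F b v" using clawD[of u z b v] uab z vz za uv by blast
      ultimately have "v \<in> R" unfolding R_def region_def using symF by blast
      then show ?thesis using Rfab[OF cu] by blast
    qed
    have "card {f, o0} \<le> card V1" using f o0Q V1U fU
      by (intro card_mono) (auto simp: V1_def intro: finite_subset)
    moreover have "f \<noteq> o0" using con(2)[OF f] o0Q by blast
    ultimately have c1: "2 \<le> card V1" by simp
    have "card {a, b} \<le> card (U - V1)" using ab SV1 S(2) fU by (intro card_mono) auto
    then have c2: "2 \<le> card (U - V1)" using ab(4) by simp
    have Rc: "F p q" if "p \<in> R" "q \<in> R" "p \<noteq> q" for p q
      using region_closed(1)[OF gF dfF ab(3)] that unfolding R_def by blast
    have "a \<in> R \<inter> (U - V1)" using ab SV1 S(2) unfolding R_def region_def by auto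
    moreover have "f \<in> R \<inter> V1" using Rfab f unfolding V1_def by blast
    ultimately show False using glue[OF U(2,3) _ _ Rc eR c1 c2] V1U minU by blast
  qed
  then obtain f1 f2 where f: "con f1" "con f2" "T f1 \<noteq> T f2" by blast
  obtain S' where S': "icyc F S'" "set S' = set S" "F f1 (hd S')" "F f1 (last S')" using pair[OF f(1)] by blast
  note E = icyc_edges[OF S'(1)]
  have S'ne: "S' \<noteq> []" using E(4) by auto
  have hl: "hd S' \<in> set S" "last S' \<in> set S" "hd S' \<noteq> last S'"
    using S'(2) S'ne E(3) irr by (metis hd_in_set last_in_set)+
  have T1: "T f1 = {hd S', last S'}" using Tpair[OF f(1)] hl S' unfolding T_def by blast
  obtain e where e: "e \<in> set S'" "F f2 e" using con(5)[OF f(2)] S'(2) by blast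
  have f2S: "f2 \<notin> set S'" using con(3)[OF f(2)] S'(2) by blast
  have "\<not> (F f2 (last S') \<and> F f2 (hd S'))" using Tpair[OF f(2), of "hd S'" "last S'"] T1 f(3) hl unfolding T_def by blast
  then obtain A x y B where xy: "S' = A @ x # y # B" "F f2 x" "F f2 y"
    using icyc_consecutive[OF S'(1) f2S e] by blast
  \<comment> \<open>The cycle is rotated so that its closing edge is the trace of \<open>f1\<close>.
    Cutting it also at the trace of \<open>f2\<close> leaves two arms, both directed from the
    triangle of \<open>f1\<close> to that of \<open>f2\<close>.\<close>
  define L where "L = A @ [x]"
  define N where "N = rev (y # B)"
  have LN: "L @ rev N = S'" unfolding L_def N_def xy by simp
  have ne: "L \<noteq> []" "N \<noteq> []" unfolding L_def N_def by auto
  have ends: "hd L = hd S'" "last L = x" "hd N = last S'" "last N = y"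
    using ne LN unfolding L_def N_def by (auto simp: xy hd_append hd_rev last_rev)
  have "x \<in> set S" "y \<in> set S" "x \<noteq> y" using S'(2) E(1) unfolding xy by auto
  then have T2: "T f2 = {x, y}" using Tpair[OF f(2)] xy unfolding T_def by blast
  have "icyc F (L @ rev N)" "rev N \<noteq> []" using S'(1) LN ne by auto
  note ic0 = icyc_append[THEN iffD1, OF ne(1) this(2,1)]
  note ic = conjunct1[OF ic0] conjunct1[OF conjunct2[OF ic0]] conjunct1[OF conjunct2[OF conjunct2[OF ic0]]]
    conjunct1[OF conjunct2[OF conjunct2[OF conjunct2[OF ic0]]]]
  note ic5 = conjunct2[OF conjunct2[OF conjunct2[OF conjunct2[OF ic0]]], THEN bspec, THEN bspec]
  have LNu: "set L \<union> set N = set S" unfolding S'(2)[symmetric] LN[symmetric] by simp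
  have LNs: "set L \<subseteq> set S" "set N \<subseteq> set S" unfolding LNu[symmetric] by simp_all
  have crLN: "cross F L N" unfolding cross_def
  proof (intro ballI)
    fix u v assume uv: "u \<in> set L" "v \<in> set N"
    then show "u \<noteq> v \<and> (F u v \<longleftrightarrow> u = hd L \<and> v = hd N \<or> u = last L \<and> v = last N)"
      using ic(4) ic5[of u v] ne by (auto simp: hd_rev last_rev)
  qed
  obtain z1 where z1: "z1 \<in> Q1" "F f1 z1" using con(4)[OF f(1)] by blast
  obtain z2 where z2: "z2 \<in> Q1" "F f2 z2" using con(4)[OF f(2)] by blast
  let ?X = "insert f1 (insert f2 Q1)"
  have "linked F Q1 z1 z2" using linked_trans[OF linked_sym[OF Q1linked[OF z1(1)] symF] Q1linked[OF z2(1)]] .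
  then have "linked F ?X z1 z2" by (rule linked_mono) auto
  moreover have "linked F ?X f1 z1" "linked F ?X z2 f2" using z1 z2 symF by (auto intro: linked_edge)
  ultimately have "linked F ?X f1 f2" by (metis linked_trans)
  from linked_ipath[OF this, of "\<lambda>q. q = f2"] obtain P where
    P: "ipath F P" "P \<noteq> []" "hd P = f1" "set P \<subseteq> ?X" "last P = f2" by auto
  have f12: "f1 \<noteq> f2" using f(3) by blast
  have P2: "2 \<le> length P" using P(2,3,5) f12 by (cases P; cases "tl P") auto
  have PS: "p \<noteq> u \<and> (F u p \<longleftrightarrow> p = f1 \<and> (u = hd S' \<or> u = last S') \<or> p = f2 \<and> (u = x \<or> u = y))"
    if "p \<in> set P" "u \<in> set S" for p u
  proof -
    have "p \<in> ?X" using that(1) P(4) by blast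
    then consider "p = f1" | "p = f2" | "p \<in> Q1" by blast
    then show ?thesis
    proof cases
      case 1
      then have "F f1 u \<longleftrightarrow> u \<in> T f1" using that(2) unfolding T_def by auto
      then show ?thesis using 1 T1 con(3)[OF f(1)] f12 that(2) comm[of u f1] by auto
    next
      case 2
      then have "F f2 u \<longleftrightarrow> u \<in> T f2" using that(2) unfolding T_def by auto
      then show ?thesis using 2 T2 con(3)[OF f(2)] f12 that(2) comm[of u f2] by auto
    next
      case 3
      then show ?thesis using Q1S[OF 3 that(2)] con(2)[OF f(1)] con(2)[OF f(2)] comm[of u p] by auto
    qed
  qed
  have hL: "hd L \<in> set L" "last L \<in> set L" "hd N \<in> set N" "last N \<in> set N" using ne by auto
  have disj: "set L \<inter> set N = {}" using ic(4) by simp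
  have crLP: "cross F L P" unfolding cross_def
  proof (intro ballI)
    fix u v assume uv: "u \<in> set L" "v \<in> set P"
    have "u \<noteq> last S'" "u \<noteq> y" using uv(1) disj hL(3,4) unfolding ends by auto
    then show "u \<noteq> v \<and> (F u v \<longleftrightarrow> u = hd L \<and> v = hd P \<or> u = last L \<and> v = last P)"
      using PS[OF uv(2), of u] uv(1) LNs unfolding ends P by auto
  qed
  have crNP: "cross F N P" unfolding cross_def
  proof (intro ballI)
    fix u v assume uv: "u \<in> set N" "v \<in> set P"
    have "u \<noteq> hd S'" "u \<noteq> x" using uv(1) disj hL(1,2) unfolding ends by auto
    then show "u \<noteq> v \<and> (F u v \<longleftrightarrow> u = hd N \<and> v = hd P \<or> u = last N \<and> v = last P)"
      using PS[OF uv(2), of u] uv(1) LNs unfolding ends P by auto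
  qed
  have D': "domset U (L @ rev N) = ?D" unfolding LN domset_def S'(2) ..
  \<comment> \<open>If \<open>P\<close> is just the edge \<open>f1 f2\<close>, the claw at
    \<open>f1\<close> with \<open>z1\<close>, \<open>f2\<close> and a cycle vertex not seen by
    \<open>f2\<close> makes \<open>z1\<close> the private vertex of this arm.\<close>
  have zf2: "F z1 f2" if "length P = 2"
  proof -
    have "F f1 f2" using that P(1,3,5) by (cases P; cases "tl P") auto
    moreover have "\<not> T f1 \<subseteq> T f2"
      using f(3) hl(3) unfolding T1 T2 by auto
    then obtain t where t: "t \<in> T f1" "t \<notin> T f2" by blast
    moreover have "t \<in> set S" "F f1 t" "\<not> F f2 t" "t \<noteq> f2" using t con(3)[OF f(2)] unfolding T_def by auto
    moreover have "z1 \<noteq> f2" using con(2)[OF f(2)] z1(1) by blast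
    ultimately show ?thesis using clawD[of f1 z1 f2 t] z1 Q1S[OF z1(1)] symF by blast
  qed
  have "theta_setup V F U L N P z1"
  proof unfold_locales
    show "ipath F N" using ic(3) ipath_rev[OF symF, where xs = N] by simp
    show "set P \<subseteq> U" using P(4) con(1)[OF f(1)] con(1)[OF f(2)] Q1sub by blast
    show "4 \<le> length L + length N" using ic(1) by simp
    show "\<And>S'. icyc F S' \<Longrightarrow> set S' \<subseteq> U \<Longrightarrow> card (domset U S') \<le> card (domset U (L @ rev N))"
      using maxS D' by simp
    show "z1 \<in> U" "z1 \<notin> domset U (L @ rev N)" using Q1sub[OF z1(1)] D' by auto
    show "F z1 (hd P)" "length P = 2 \<longrightarrow> F z1 (last P)" using z1 zf2 symF P(3,5) by auto
  qed (use fU U(1) ic P(1) ne P2 LNs S(2) crLN crLP crNP in auto)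
  then show ?thesis by (rule theta_setup.theta_exists)
qed

end

section \<open>Three heavy vertices\<close>

lemma ipath_interior:
  assumes "ipath E M" "w \<in> set M" "w \<noteq> hd M" "w \<noteq> last M"
  obtains A p q B where "M = A @ p # w # q # B" "E p w" "E w q" "p \<noteq> q" "\<not> E p q"
proof -
  obtain A' B' where M: "M = A' @ w # B'" using split_list[OF assms(2)] by blast
  obtain A p where A: "A' = A @ [p]" using assms(3) M by (cases A' rule: rev_cases) auto
  obtain q B where B: "B' = q # B" using assms(4) M by (cases B') auto
  have "M = A @ p # w # q # B" using M A B by simp
  moreover have "E p w" "E w q" "p \<noteq> q" "\<not> E p q"
    using assms(1) unfolding calculation by (auto simp: ipath_append)
  ultimately show ?thesis by (rule that)
qed

context closed_graph
begin

lemma common_nbrs: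
  assumes "s \<noteq> t" "\<not> F s t" "p \<noteq> q" "F s p" "F s q" "F t p" "F t q"
  shows "\<not> F p q"
proof
  assume "F p q"
  then have "F s t" using diamondD[of p q s t] assms symF by metis
  then show False using assms(2) by blast
qed

text \<open>By \<open>common_nbrs\<close> the common neighbours are pairwise nonadjacent, so three
  of them would be the leaves of a claw at \<open>s\<close>.\<close>

lemma card_common_nbrs:
  assumes "s \<noteq> t" "\<not> F s t"
  shows "card {w. F s w \<and> F t w} \<le> 2"
proof (rule ccontr)
  let ?C = "{w. F s w \<and> F t w}"
  assume "\<not> ?thesis"
  then obtain C where C: "C \<subseteq> ?C" "card C = 3"
    using obtain_subset_with_card_n[of 3 ?C] by auto
  then obtain p q r where "C = {p, q, r}" "p \<noteq> q" "p \<noteq> r" "q \<noteq> r" by (auto simp: card_3_iff)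
  then have pqr: "F s p" "F s q" "F s r" "F t p" "F t q" "F t r" "p \<noteq> q" "p \<noteq> r" "q \<noteq> r" using C(1) by auto
  show False
    using clawD[OF pqr(1,2,3) pqr(7,8,9)] common_nbrs[OF assms pqr(7) pqr(1,2,4,5)]
      common_nbrs[OF assms pqr(8) pqr(1,3,4,6)] common_nbrs[OF assms pqr(9) pqr(2,3,5,6)] by blast
qed

lemma hexagon_ham:
  assumes e: "F p q'" "F q' r" "F r p'" "F p' q" "F q r'" "F r' p"
    and n: "\<not> F p r" "\<not> F p p'" "\<not> F p q" "\<not> F q' p'" "\<not> F q' q" "\<not> F q' r'" "\<not> F r q" "\<not> F r r'" "\<not> F p' r'"
    and d: "distinct [p, q', r, p', q, r']"
    and dom: "\<And>v. v \<in> V \<Longrightarrow> \<exists>x \<in> {p, q', r, p', q, r'}. v = x \<or> F v x"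
  shows "ham V F"
proof (rule dominating_icyc_ham)
  show "icyc F [p, q', r, p', q, r']"
    using e n d comm[of p r'] unfolding icyc_def by auto
  show "set [p, q', r, p', q, r'] \<subseteq> V" using e inV by auto
  show "finite V" using gF unfolding sgraph_def by blast
  show "\<exists>x \<in> set [p, q', r, p', q, r']. F v x" if "v \<in> V" "v \<notin> set [p, q', r, p', q, r']" for v
    using dom[OF that(1)] that(2) by auto
qed

text \<open>
  Two nonadjacent vertices have at most two common neighbours and no vertex is adjacent to all three,
  so the degree sum is at most \<open>card V + 3\<close>. In the case of equality the six common neighbours form
  a dominating induced cycle.
\<close>

lemma three_heavy_ham:
  assumes st: "s \<in> V" "t \<in> V" "u \<in> V" "s \<noteq> t" "s \<noteq> u" "t \<noteq> u" "\<not> F s t" "\<not> F s u" "\<not> F t u"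
    and deg: "card V + 3 \<le> card {w. F s w} + card {w. F t w} + card {w. F u w}"
  shows "ham V F"
proof -
  let ?S = "{w. F s w}" and ?T = "{w. F t w}" and ?U = "{w. F u w}"
  have fV: "finite V" using gF unfolding sgraph_def by blast
  have sub: "?S \<subseteq> V" "?T \<subseteq> V" "?U \<subseteq> V" using inV by auto
  have fin: "finite ?S" "finite ?T" "finite ?U" using sub fV finite_subset by blast+
  have e3: False if "F s w" "F t w" "F u w" for w
    using clawD[of w s t u] that st symF by blast
  let ?ST = "{w. F s w \<and> F t w}" and ?SU = "{w. F s w \<and> F u w}" and ?TU = "{w. F t w \<and> F u w}"
  have le: "card ?ST \<le> 2" "card ?SU \<le> 2" "card ?TU \<le> 2" using card_common_nbrs st by auto
  have eq: "?S \<inter> ?T = ?ST" "(?S \<union> ?T) \<inter> ?U = ?SU \<union> ?TU" "?SU \<inter> ?TU = {}" using e3 by auto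
  have c1: "card ?S + card ?T = card (?S \<union> ?T) + card ?ST"
    using card_Un_Int[OF fin(1,2)] eq(1) by simp
  have c2: "card (?S \<union> ?T) + card ?U = card (?S \<union> ?T \<union> ?U) + card (?SU \<union> ?TU)"
    using card_Un_Int[of "?S \<union> ?T" ?U] fin eq(2) by simp
  have finp: "finite ?SU" "finite ?TU" using fin by (auto intro: finite_subset)
  have c3: "card (?SU \<union> ?TU) = card ?SU + card ?TU"
    using card_Un_disjoint[OF finp eq(3)] .
  have W: "?S \<union> ?T \<union> ?U \<subseteq> V - {s, t, u}" using sub st comm by auto
  have cV: "card (V - {s, t, u}) + 3 = card V"
    using st fV card_Diff_subset[of "{s, t, u}" V] card_mono[of V "{s, t, u}"] by auto
  have cW: "card (?S \<union> ?T \<union> ?U) \<le> card (V - {s, t, u})" using card_mono[OF _ W] fV by auto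
  have c: "card ?ST = 2" "card ?SU = 2" "card ?TU = 2" "card (V - {s, t, u}) \<le> card (?S \<union> ?T \<union> ?U)"
    using deg c1 c2 c3 cV cW le by linarith+
  have full: "?S \<union> ?T \<union> ?U = V - {s, t, u}"
    using card_seteq[OF _ W c(4)] fV by auto
  obtain p p' where p: "?ST = {p, p'}" "p \<noteq> p'" using c(1) by (auto simp: card_2_iff)
  have P: "F s p" "F t p" "F s p'" "F t p'" "\<not> F u p" "\<not> F u p'" using p e3 by blast+
  \<comment> \<open>The claw at \<open>z\<close> gives at least one of the two adjacencies, the
    absence of diamonds at most one.\<close>
  have one: "F x a \<longleftrightarrow> \<not> F x b" if "F z a" "F z b" "F z x" "a \<noteq> b" "\<not> F a b" "x \<noteq> a" "x \<noteq> b" for x a b z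
  proof
    show "\<not> F x b" if "F x a"
    proof
      assume "F x b"
      then show False using diamondD[of z x a b] \<open>F z a\<close> \<open>F z b\<close> \<open>F z x\<close> \<open>F x a\<close> \<open>a \<noteq> b\<close> \<open>\<not> F a b\<close> by blast
    qed
    show "F x a" if "\<not> F x b"
      using clawD[of z a b x] that \<open>F z a\<close> \<open>F z b\<close> \<open>F z x\<close> \<open>a \<noteq> b\<close> \<open>\<not> F a b\<close> \<open>x \<noteq> a\<close> \<open>x \<noteq> b\<close> symF by blast
  qed
  have pick: "\<exists>a b. X = {a, b} \<and> a \<noteq> b \<and> \<not> F a b \<and> F p a \<and> \<not> F p b"
    if X: "X = {w. F z w \<and> F u w}" "card X = 2" and z: "F z p" "z \<noteq> u" "\<not> F z u" for X z
  proof -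
    obtain a b where ab: "X = {a, b}" "a \<noteq> b" using X(2) by (auto simp: card_2_iff)
    then have f: "F z a" "F z b" "F u a" "F u b" using X(1) by blast+
    have nab: "\<not> F a b" using common_nbrs[OF z(2,3) ab(2) f] .
    have "p \<noteq> a" "p \<noteq> b" using f P by auto
    then have "F p a \<longleftrightarrow> \<not> F p b" using one[OF f(1,2) z(1) ab(2) nab] by blast
    moreover have "X = {b, a}" "\<not> F b a" using ab nab symF by auto
    ultimately show ?thesis using ab nab by blast
  qed
  obtain q q' where q: "?SU = {q, q'}" "q \<noteq> q'" "\<not> F q q'" "F p q" "\<not> F p q'"
    using pick[OF refl c(2) P(1) st(5,8)] by blast
  obtain r r' where r: "?TU = {r, r'}" "r \<noteq> r'" "\<not> F r r'" "F p r" "\<not> F p r'"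
    using pick[OF refl c(3) P(2) st(6,9)] by blast
  have Q: "F s q" "F u q" "F s q'" "F u q'" "\<not> F t q" "\<not> F t q'" using q(1) e3 by blast+
  have R: "F t r" "F u r" "F t r'" "F u r'" "\<not> F s r" "\<not> F s r'" using r(1) e3 by blast+
  have npp: "\<not> F p p'" using common_nbrs[OF st(4,7) p(2) P(1,3,2,4)] .
  have neq: "p \<noteq> q" "p \<noteq> q'" "p \<noteq> r" "p \<noteq> r'" "p' \<noteq> q" "p' \<noteq> q'" "p' \<noteq> r" "p' \<noteq> r'" "q \<noteq> r" "q \<noteq> r'" "q' \<noteq> r" "q' \<noteq> r'"
    using P Q R by auto
  have qp: "\<not> F q p'" "F q' p'"
    using one[OF P(1,3) Q(1) p(2) npp] one[OF P(1,3) Q(3) p(2) npp] neq q(4,5) symF by metis+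
  have rp: "\<not> F r p'" "F r' p'"
    using one[OF P(2,4) R(1) p(2) npp] one[OF P(2,4) R(3) p(2) npp] neq r(4,5) symF by metis+
  \<comment> \<open>Common neighbours of the three different pairs cannot form a triangle: the
    diamond on the edge \<open>x y\<close> would make \<open>s\<close> adjacent to \<open>z\<close>,
    which already sees \<open>t\<close> and \<open>u\<close>.\<close>
  have tri: False if "F x y" "F y z" "F x z" "F s x" "F s y" "F t x" "F t z" "F u y" "F u z" "x \<noteq> y" "y \<noteq> z" "x \<noteq> z" for x y z
  proof -
    have "s \<noteq> z" using \<open>F t z\<close> st(7) symF by blast
    then have "F s z"
      using diamondD[of x y s z] \<open>F x y\<close> \<open>F x z\<close> \<open>F y z\<close> symF[OF \<open>F s x\<close>] symF[OF \<open>F s y\<close>] by blast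
    then show False using e3 \<open>F t z\<close> \<open>F u z\<close> by blast
  qed
  have nqr: "\<not> F q r"
    using tri[OF q(4) _ r(4) P(1) Q(1) P(2) R(1) Q(2) R(2)] neq by blast
  have qr: "F q r'" using one[OF R(2,4) Q(2) r(2,3)] neq nqr by metis
  have rq: "F r q'" using one[OF Q(2,4) R(2) q(2,3)] neq nqr symF by metis
  have nqr': "\<not> F q' r'" using one[OF R(2,4) Q(4) r(2,3)] neq rq symF by metis
  have dom: "\<exists>x \<in> {p, p', q, q', r, r'}. v = x \<or> F v x" if v: "v \<in> V" for v
  proof -
    have a: ?thesis if z: "F z a" "F z b" "F z v" "a \<noteq> b" "\<not> F a b" "a \<in> {p, p', q, q', r, r'}" "b \<in> {p, p', q, q', r, r'}" for z a b
      using clawD[of z a b v] z symF by blast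
    have "v = s \<or> v = t \<or> v = u \<or> F s v \<or> F t v \<or> F u v" using full v by blast
    then show ?thesis
      using P Q R a[OF P(1,3) _ p(2) npp] a[OF P(2,4) _ p(2) npp] a[OF Q(2,4) _ q(2,3)] by blast
  qed
  show ?thesis
  proof (rule hexagon_ham[of p q r' p' q' r])
    show "distinct [p, q, r', p', q', r]" using neq p(2) q(2) r(2) by auto
    show "\<exists>x \<in> {p, q, r', p', q', r}. v = x \<or> F v x" if "v \<in> V" for v using dom[OF that] by blast
    show "F q' r" "F r p" "F p' q'" "\<not> F p' r" "\<not> F r' q'" "\<not> F r' r" using rq qp rp nqr' r symF by blast+
  qed (use q r qp rp qr nqr npp in auto)
qed

end

section \<open>Lifting from the closure to the graph\<close>

text \<open>Arms of any length are allowed, including a single vertex. Cutting arms down to 2, 2, 2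
  vertices leaves the net, and to 1, 2, 3 vertices the wounded graph.\<close>

definition gen_net :: "('a \<Rightarrow> 'a \<Rightarrow> bool) \<Rightarrow> (nat \<Rightarrow> 'a list) \<Rightarrow> bool" where
  "gen_net E Y \<longleftrightarrow> (\<forall>i<3. Y i \<noteq> [] \<and> ipath E (Y i)) \<and>
     (\<forall>i<3. \<forall>j<3. i \<noteq> j \<longrightarrow> (\<forall>u \<in> set (Y i). \<forall>v \<in> set (Y j). u \<noteq> v \<and>
        (E u v \<longleftrightarrow> u = hd (Y i) \<and> v = hd (Y j))))"

lemma all_less_3: "(\<forall>i<3. Q i) \<longleftrightarrow> Q 0 \<and> Q 1 \<and> Q (2::nat)"
  by (auto simp: less_Suc_eq numeral_3_eq_3 numeral_2_eq_2)

lemma less_3_cases: "i < (3::nat) \<Longrightarrow> i = 0 \<or> i = 1 \<or> i = 2"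
  by auto

locale closure_pair = closed_graph V F for V :: "'a set" and F :: "'a \<Rightarrow> 'a \<Rightarrow> bool" +
  fixes E :: "'a \<Rightarrow> 'a \<Rightarrow> bool"
  assumes gE: "sgraph V E" and cfE: "clawfree E" and EF: "\<And>u v. E u v \<Longrightarrow> F u v"
    and lk: "\<And>u v. F u v \<Longrightarrow> linked E (region F u v) u v"
begin

lemmas symE = sgraphD(3)[OF gE]

lemma irrE [simp]: "\<not> E x x"
  using gE unfolding sgraph_def by blast

lemma commE: "E x y \<longleftrightarrow> E y x"
  using symE by blast

lemma clawE: "E x a \<Longrightarrow> E x b \<Longrightarrow> E x c \<Longrightarrow> a \<noteq> b \<Longrightarrow> a \<noteq> c \<Longrightarrow> b \<noteq> c \<Longrightarrow> E a b \<or> E a c \<or> E b c"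
  using clawfreeD[OF cfE] by blast

lemmas region_adj = region_closed(1)[OF gF dfF]
lemmas region_in = region_closed(2)[OF gF dfF]

lemma region_mem [simp]: "u \<in> region F u v" "v \<in> region F u v"
  unfolding region_def by auto

lemma region_adj': "F u v \<Longrightarrow> p \<in> region F u v \<Longrightarrow> q \<in> region F u v \<Longrightarrow> p = q \<or> F p q"
  using region_adj by blast

text \<open>
  Since regions are connected in \<open>E\<close>, a neighbour \<open>y\<close> outside the clique yields an \<open>E\<close>-neighbour
  outside it, which completes a claw. Hence interior vertices of induced paths inside a region have
  no neighbours outside the region.
\<close>

lemma frontier_simplicial:
  assumes uv: "F u v" and w: "w \<in> region F u v" and y: "F w y" "y \<notin> region F u v"
    and p: "p \<in> region F u v" "E w p" and q: "q \<in> region F u v" "E w q" and pq: "p \<noteq> q"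
  shows "E p q"
proof -
  have "\<not> (y = w)" using y(1) irr by blast
  then obtain w' y' where "E w' y'" "w' = w" "y' \<in> region F w y" "y' \<noteq> w"
    using linked_crossing[OF lk[OF y(1)], of "\<lambda>z. z = w"] by metis
  then have y': "E w y'" "y' \<in> region F w y" "y' \<noteq> w" by auto
  have out: "y' \<notin> region F u v"
  proof
    assume a: "y' \<in> region F u v"
    then have "y' \<noteq> y" using y(2) by blast
    then have "F y y'" using y'(2,3) symF unfolding region_def by blast
    then show False using region_in[OF uv w a _ symF[OF y(1)]] y'(3) y(2) by blast
  qed
  have no: "\<not> E r y'" "r \<noteq> y'" if "r \<in> region F u v" "E w r" for r
  proof
    have "r \<noteq> w" using that by auto
    assume "E r y'"
    then show False
      using region_in[OF uv w that(1) _ symF[OF EF[OF y'(1)]] symF[OF EF]] \<open>r \<noteq> w\<close> out by blast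
  next
    show "r \<noteq> y'" using that out by blast
  qed
  show ?thesis using clawE[OF p(2) q(2) y'(1) pq] no[OF p] no[OF q] by blast
qed

lemma nonsimplicial_inner:
  assumes "F u v" "w \<in> region F u v" "p \<in> region F u v" "E w p" "q \<in> region F u v" "E w q" "p \<noteq> q" "\<not> E p q" "F w z"
  shows "z \<in> region F u v"
  using frontier_simplicial[OF assms(1,2,9) _ assms(3-7)] assms(8) by blast

lemma segment:
  assumes uv: "F u v"
  obtains M where "ipath E M" "M \<noteq> []" "hd M = u" "last M = v" "set M \<subseteq> region F u v"
    "\<And>w z. w \<in> set M \<Longrightarrow> w \<noteq> u \<Longrightarrow> w \<noteq> v \<Longrightarrow> F w z \<Longrightarrow> z \<in> region F u v"
proof -
  have "linked E (region F u v) u v" using lk[OF uv] .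
  from linked_ipath[OF this, of "\<lambda>q. q = v"] obtain M where
    M: "ipath E M" "M \<noteq> []" "hd M = u" "set M \<subseteq> region F u v" "last M = v" by auto
  have "z \<in> region F u v" if w: "w \<in> set M" "w \<noteq> u" "w \<noteq> v" "F w z" for w z
  proof -
    obtain A p q B where s: "M = A @ p # w # q # B" "E p w" "E w q" "p \<noteq> q" "\<not> E p q"
      using ipath_interior[OF M(1) w(1)] w(2,3) M(3,5) by metis
    then have "p \<in> region F u v" "w \<in> region F u v" "q \<in> region F u v" using M(4) by auto
    then show ?thesis using nonsimplicial_inner[OF uv, of w p q] s symE w(4) by blast
  qed
  then show ?thesis using that M by blast
qed

text \<open>
  The vertices that may occur on a lift of the path \<open>L\<close> to the original graph.
\<close>

definition tame :: "'a list \<Rightarrow> 'a \<Rightarrow> bool" where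
  "tame L w \<longleftrightarrow> w \<in> set L \<or> (\<exists>u \<in> set L. \<exists>v \<in> set L. F u v \<and> w \<in> region F u v \<and> (\<forall>z. F w z \<longrightarrow> z \<in> region F u v))"

text \<open>The edges are replaced by segments, starting from the far end of \<open>L\<close>. A
  vertex of the new segment can meet or touch the lifted rest only at \<open>y\<close>: a contact
  anywhere else would either be a chord of \<open>L\<close> at \<open>x\<close> or put
  \<open>x\<close> into the region of an edge of \<open>L\<close>, and then \<open>x\<close> would
  see both ends of that edge.\<close>

lemma lift_path:
  assumes "ipath F L" "L \<noteq> []"
  shows "\<exists>L'. ipath E L' \<and> L' \<noteq> [] \<and> hd L' = hd L \<and> last L' = last L \<and> length L \<le> length L' \<and> (\<forall>w \<in> set L'. tame L w)"
  using assms
proof (induction L)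
  case (Cons x L)
  show ?case
  proof (cases L)
    case Nil
    then show ?thesis by (intro exI[of _ "[x]"]) (auto simp: tame_def)
  next
    case (Cons y L0)
    have ip: "ipath F L" "L \<noteq> []" using Cons.prems Cons by auto
    obtain L1 where L1: "ipath E L1" "L1 \<noteq> []" "hd L1 = y" "last L1 = last L" "length L \<le> length L1" "\<And>w. w \<in> set L1 \<Longrightarrow> tame L w"
      using Cons.IH[OF ip] Cons by auto
    have xy: "F x y" and xL: "x \<notin> set L" and x0: "\<And>z. z \<in> set L \<Longrightarrow> F x z \<Longrightarrow> z = y"
      using Cons.prems(1) unfolding Cons by auto
    obtain M where M: "ipath E M" "M \<noteq> []" "hd M = x" "last M = y" "set M \<subseteq> region F x y"
      "\<And>w z. w \<in> set M \<Longrightarrow> w \<noteq> x \<Longrightarrow> w \<noteq> y \<Longrightarrow> F w z \<Longrightarrow> z \<in> region F x y"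
      using segment[OF xy] by metis
    obtain M' where M': "M = M' @ [y]" using M(2,4) by (metis append_butlast_last_id)
    have M'ne: "M' \<noteq> []" using M(3) M' xL Cons by (cases M') auto
    have yM': "y \<notin> set M'" using ipath_distinct[OF M(1)] unfolding M' by auto
    have no_x: False if "u \<in> set L" "v \<in> set L" "F u v" "x \<in> region F u v" for u v
    proof -
      have "F x u" "F x v" using that xL unfolding region_def by auto
      then show False using x0 that irr by metis
    qed
    have key: "w' = y" if w: "w \<in> set M'" and w': "w' \<in> set L1" and adj: "w = w' \<or> E w w'" for w w'
    proof -
      have wM: "w \<in> set M" "w \<noteq> y" "w \<in> region F x y" using w M' yM' M(5) by auto
      have wx: "w = x \<or> F w x" using wM unfolding region_def by auto
      have w'r: "w' = x \<or> F w' x \<or> w = x \<and> F x w'"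
      proof (cases "w = w'")
        case True
        then show ?thesis using wx by blast
      next
        case False
        then have f: "F w w'" using adj EF by blast
        show ?thesis
        proof (cases "w = x")
          case True
          then show ?thesis using f by blast
        next
          case False
          then have "w' \<in> region F x y" using M(6)[OF wM(1) False wM(2) f] by blast
          then show ?thesis using region_adj'[OF xy _ region_mem(1)] by blast
        qed
      qed
      show ?thesis
      proof (cases "w' \<in> set L")
        case True
        then show ?thesis using w'r x0[OF True] xL symF by blast
      next
        case False
        then obtain u v where uv: "u \<in> set L" "v \<in> set L" "F u v" "w' \<in> region F u v" "\<And>z. F w' z \<Longrightarrow> z \<in> region F u v"
          using L1(6)[OF w'] unfolding tame_def by blast
        then have "x \<in> region F u v" using w'r symF by blast
        then show ?thesis using no_x uv by blast
      qed
    qed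
    have last: "E (last M') y" "\<And>w. w \<in> set M' \<Longrightarrow> E w y \<Longrightarrow> w = last M'"
      using M(1) M'ne unfolding M' by (auto simp: ipath_append)
    have "ipath E (M' @ L1)"
      unfolding ipath_append
    proof (intro conjI ballI)
      show "ipath E M'" using M(1) unfolding M' by (simp add: ipath_append)
      show "ipath E L1" by (rule L1(1))
      show "set M' \<inter> set L1 = {}" using key yM' by blast
      fix w w' assume w: "w \<in> set M'" "w' \<in> set L1"
      show "E w w' \<longleftrightarrow> w = last M' \<and> w' = hd L1"
        using key[OF w] last w L1(3) by metis
    qed
    moreover have "tame (x # L) w" if w: "w \<in> set (M' @ L1)" for w
    proof (cases "w \<in> set M'")
      case True
      then have wM: "w \<in> set M" "w \<noteq> y" using M' yM' by auto
      show ?thesis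
      proof (cases "w = x")
        case False
        have "w \<in> region F x y" "\<forall>z. F w z \<longrightarrow> z \<in> region F x y" using M(5,6) wM False by blast+
        then show ?thesis unfolding tame_def using xy Cons by auto
      qed (simp add: tame_def)
    next
      case False
      then have "tame L w" using w L1(6) by auto
      then show ?thesis unfolding tame_def by auto
    qed
    moreover have "hd (M' @ L1) = x" using M(3) M' M'ne by auto
    moreover have "length (x # L) \<le> length (M' @ L1)" using M'ne L1(5) by (cases M') auto
    ultimately show ?thesis using L1(2,4) ip(2) by (intro exI[of _ "M' @ L1"]) auto
  qed
qed simp

lemma lift_long:
  assumes "ipath F L" "n \<le> length L" "0 < n"
  obtains Q where "ipath E Q" "length Q = n" "hd Q = hd L"
proof -
  obtain L' where L': "ipath E L'" "hd L' = hd L" "length L \<le> length L'"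
    using lift_path[OF assms(1)] assms(2,3) by (cases "L = []") auto
  have "ipath E (take n L' @ drop n L')" using L'(1) by simp
  then have "ipath E (take n L')" unfolding ipath_append by blast
  moreover have "length (take n L') = n" using L'(3) assms(2) by simp
  moreover have "hd (take n L') = hd L" using L'(2) assms(3) by simp
  ultimately show ?thesis by (rule that)
qed

text \<open>An \<open>E\<close>-path \<open>M\<close> in \<open>K\<close> joins \<open>a 0\<close>
  to \<open>a 1\<close>, and \<open>Q\<close> leads from \<open>a 2\<close> to the first vertex
  \<open>t\<close> with a neighbour on \<open>M\<close>. The neighbours of \<open>t\<close> on
  \<open>M\<close> form a clique, and some two of them are consecutive; hence they are exactly two
  vertices \<open>p\<close> and \<open>q\<close>, and \<open>p, q, t\<close> is the central
  triangle. At the vertices \<open>a i\<close>, where the path offers no second neighbour for a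
  claw, \<open>frontier_simplicial\<close> takes over, thanks to the neighbour outside
  \<open>K\<close>.\<close>

lemma net_in_region:
  fixes a :: "nat \<Rightarrow> 'a"
  assumes K: "K = region F k k'" "F k k'"
    and a: "\<And>i. i < 3 \<Longrightarrow> a i \<in> K" "\<And>i j. i < 3 \<Longrightarrow> j < 3 \<Longrightarrow> i \<noteq> j \<Longrightarrow> a i \<noteq> a j"
      "\<And>i. i < 3 \<Longrightarrow> \<exists>y. F (a i) y \<and> y \<notin> K"
  obtains R where "gen_net E R" "\<And>i. i < 3 \<Longrightarrow> last (R i) = a i" "\<And>i. i < 3 \<Longrightarrow> set (R i) \<subseteq> K"
    "\<And>i w z. i < 3 \<Longrightarrow> w \<in> set (R i) \<Longrightarrow> w \<noteq> a i \<Longrightarrow> F w z \<Longrightarrow> z \<in> K"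
proof -
  have adjK: "F p q" if "p \<in> K" "q \<in> K" "p \<noteq> q" for p q using region_adj[OF K(2)] that unfolding K(1) .
  have linkK: "linked E K p q" if "p \<in> K" "q \<in> K" for p q
  proof (cases "p = q")
    case False
    have "F p q" using adjK that False by blast
    moreover have "region F p q \<subseteq> K"
    proof
      fix w assume w: "w \<in> region F p q"
      then have "w = p \<or> w = q \<or> F w p \<and> F w q" unfolding region_def by blast
      then show "w \<in> K" using that region_in[OF K(2), of p q w] False unfolding K(1) by blast
    qed
    ultimately show ?thesis using linked_mono[OF lk] by blast
  qed simp
  have simplicial: "E p q" if "i < 3" "p \<in> K" "E (a i) p" "q \<in> K" "E (a i) q" "p \<noteq> q" for i p q
    using a(3)[OF that(1)] frontier_simplicial[OF K(2), of "a i" _ p q] a(1)[OF that(1)] that unfolding K(1) by blast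
  have inner: "z \<in> K" if "w \<in> K" "p \<in> K" "E w p" "q \<in> K" "E w q" "p \<noteq> q" "\<not> E p q" "F w z" for w p q z
    using nonsimplicial_inner[OF K(2)] that unfolding K(1) by blast
  have a3: "a 0 \<in> K" "a 1 \<in> K" "a 2 \<in> K" "a 0 \<noteq> a 1" "a 0 \<noteq> a 2" "a 1 \<noteq> a 2"
    using a(1)[of 0] a(1)[of 1] a(1)[of 2] a(2)[of 0 1] a(2)[of 0 2] a(2)[of 1 2] by auto
  from linked_ipath[OF linkK[OF a3(1,2)] a3(1), of "\<lambda>q. q = a 1"] obtain M where
    M: "ipath E M" "M \<noteq> []" "hd M = a 0" "set M \<subseteq> K" "last M = a 1" by auto
  have innerM: "z \<in> K" if w: "w \<in> set M" "w \<noteq> a 0" "w \<noteq> a 1" "F w z" for w z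
  proof -
    obtain A p q B where s: "M = A @ p # w # q # B" "E p w" "E w q" "p \<noteq> q" "\<not> E p q"
      using ipath_interior[OF M(1) w(1)] w(2,3) M(3,5) by metis
    then have "p \<in> K" "q \<in> K" "w \<in> K" using M(4) by auto
    then show ?thesis using inner[of w p q z] s symE w(4) by blast
  qed
  \<comment> \<open>An interior vertex of \<open>M\<close> has no neighbour outside
    \<open>K\<close>, whereas \<open>a 2\<close> has one.\<close>
  have a2M: "a 2 \<notin> set M"
  proof
    assume "a 2 \<in> set M"
    then obtain y where "F (a 2) y" "y \<notin> K" using a(3)[of 2] by auto
    then show False using innerM[OF \<open>a 2 \<in> set M\<close>] a3 by metis
  qed
  have "\<exists>v \<in> set M. E (a 0) v"
  proof -
    obtain M1 where M1: "M = a 0 # M1" using M(2,3) by (cases M) auto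
    then have "M1 \<noteq> []" using M(5) a3(4) by auto
    then show ?thesis using M(1) unfolding M1 by auto
  qed
  from linked_ipath[OF linkK[OF a3(3,1)] a3(3), of "\<lambda>q. \<exists>v \<in> set M. E q v", OF this] obtain Q where
    Q: "ipath E Q" "Q \<noteq> []" "hd Q = a 2" "set Q \<subseteq> K" "\<exists>v \<in> set M. E (last Q) v"
      "\<And>q. q \<in> set (butlast Q) \<Longrightarrow> \<not> (\<exists>v \<in> set M. E q v)" by blast
  obtain Q0 t where Q0: "Q = Q0 @ [t]" using Q(2) by (metis append_butlast_last_id)
  have Q0M: "\<not> E q v" if "q \<in> set Q0" "v \<in> set M" for q v using Q(6) that Q0 by auto
  have Minner_nbr: "\<exists>v \<in> set M. E u v" if uM: "u \<in> set M" for u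
  proof (cases "u = hd M")
    case True
    then show ?thesis using \<open>\<exists>v \<in> set M. E (a 0) v\<close> M(3) by simp
  next
    case False
    obtain A B where AB: "M = A @ u # B" using split_list[OF uM] by blast
    then obtain A' p where "A = A' @ [p]" using False by (cases A rule: rev_cases) auto
    then have "E p u" "p \<in> set M" using M(1) AB by (auto simp: ipath_append)
    then show ?thesis using symE by blast
  qed
  have Q0M': "q \<notin> set M" if "q \<in> set Q0" for q using Q0M[OF that] Minner_nbr by blast
  have tM: "t \<notin> set M"
  proof
    assume t: "t \<in> set M"
    show False
    proof (cases Q0 rule: rev_cases)
      case Nil
      then show False using Q(3) Q0 t a2M by auto
    next
      case (snoc Q1 q)
      then have "E q t" using Q(1) unfolding Q0 by (auto simp: ipath_append)
      then show False using Q0M[of q t] t snoc by auto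
    qed
  qed
  have tK: "t \<in> K" using Q(4) Q0 by auto
  have MK: "u \<in> K" if "u \<in> set M" for u using that M(4) by blast
  have tclique: "E u v" if u: "u \<in> set M" "E t u" and v: "v \<in> set M" "E t v" and uv: "u \<noteq> v" for u v
  proof (cases Q0 rule: rev_cases)
    case Nil
    then have "t = a 2" using Q(3) Q0 by simp
    then show ?thesis using simplicial[of 2 u v] that MK by auto
  next
    case (snoc Q1 q)
    then have "E q t" using Q(1) unfolding Q0 by (auto simp: ipath_append)
    moreover have "\<not> E q u" "\<not> E q v" "q \<noteq> u" "q \<noteq> v" using Q0M Q0M' snoc u v by auto
    ultimately show ?thesis using clawE[of t q u v] symE that by blast
  qed
  obtain u0 where u0: "u0 \<in> set M" "E t u0" using Q(5) Q0 by auto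
  have "\<exists>A p q B. M = A @ p # q # B \<and> E t p \<and> E t q"
  proof -
    obtain A B where AB: "M = A @ u0 # B" using split_list[OF u0(1)] by blast
    show ?thesis
    proof (cases A rule: rev_cases)
      case Nil
      then have h: "u0 = a 0" using M(3) AB by simp
      obtain q B' where B: "B = q # B'" using AB Nil M(5) h a3(4) by (cases B) auto
      have "E u0 q" "q \<in> set M" using M(1) AB B Nil by auto
      then have "E t q" using simplicial[of 0 t q] u0 h tK MK tM symE by auto
      then show ?thesis using AB B u0(2) by blast
    next
      case (snoc A' p)
      have p: "E p u0" "p \<in> set M" using M(1) AB snoc by (auto simp: ipath_append)
      show ?thesis
      proof (cases "E t p")
        case True
        moreover have "M = A' @ p # u0 # B" using AB snoc by simp
        ultimately show ?thesis using u0(2) by blast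
      next
        case nt: False
        show ?thesis
        proof (cases B)
          case Nil
          then have "u0 = a 1" using M(5) AB by simp
          then have "E t p" using simplicial[of 1 t p] u0 p tK MK tM symE by auto
          then show ?thesis using nt by blast
        next
          case (Cons q B')
          have q: "E u0 q" "q \<in> set M" "p \<noteq> q" "\<not> E p q"
            using M(1) AB snoc Cons by (auto simp: ipath_append)
          have "E t q" using clawE[of u0 p q t] p q u0 nt tM symE by blast
          then show ?thesis using AB Cons u0(2) by blast
        qed
      qed
    qed
  qed
  then obtain A p q B where s: "M = A @ p # q # B" "E t p" "E t q" by blast
  have ipM: "ipath E (A @ [p])" "ipath E (q # B)" "set (A @ [p]) \<inter> set (q # B) = {}"
    "\<And>u v. u \<in> set (A @ [p]) \<Longrightarrow> v \<in> set (q # B) \<Longrightarrow> E u v \<longleftrightarrow> u = p \<and> v = q"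
    using M(1) unfolding s(1) by (auto simp: ipath_append)
  have tnb: "E t u \<longleftrightarrow> u = p \<or> u = q" if "u \<in> set M" for u
  proof
    assume tu: "E t u"
    show "u = p \<or> u = q"
    proof (rule ccontr)
      assume n: "\<not> (u = p \<or> u = q)"
      have up: "E u p" "E u q" using tclique[OF that tu _ s(2)] tclique[OF that tu _ s(3)] n s(1) by auto
      have "u \<in> set A \<or> u \<in> set B" using that n s(1) by auto
      then show False
      proof
        assume "u \<in> set A"
        then show False using ipM(4)[of u q] up n by auto
      next
        assume "u \<in> set B"
        then show False using ipM(4)[of p u] up symE n by auto
      qed
    qed
  next
    show "E t u" if "u = p \<or> u = q" using that s by auto
  qed
  let ?R = "(!) [rev (A @ [p]), q # B, rev Q]"
  have crossQ: "u \<noteq> v \<and> (E u v \<longleftrightarrow> u = t \<and> (v = p \<or> v = q))" if "u \<in> set Q" "v \<in> set M" for u v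
  proof (cases "u = t")
    case True
    then show ?thesis using tnb[OF that(2)] tM that(2) by blast
  next
    case False
    then have "u \<in> set Q0" using that(1) Q0 by auto
    then show ?thesis using Q0M[OF _ that(2)] Q0M' that(2) False by blast
  qed
  have pqM: "set (A @ [p]) \<subseteq> set M" "set (q # B) \<subseteq> set M" using s(1) by auto
  have g: "gen_net E ?R"
  proof -
    have c01: "u \<noteq> v \<and> (E u v \<longleftrightarrow> u = p \<and> v = q)" "v \<noteq> u \<and> (E v u \<longleftrightarrow> v = q \<and> u = p)"
      if "u \<in> set (A @ [p])" "v \<in> set (q # B)" for u v
      using ipM(3) ipM(4)[OF that] that commE[of v u] by auto
    have c02: "u \<noteq> v \<and> (E u v \<longleftrightarrow> u = t \<and> v = p)" "v \<noteq> u \<and> (E v u \<longleftrightarrow> v = p \<and> u = t)"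
      if "u \<in> set Q" "v \<in> set (A @ [p])" for u v
    proof -
      have "v \<noteq> q" using ipM(3) that(2) by auto
      then show "u \<noteq> v \<and> (E u v \<longleftrightarrow> u = t \<and> v = p)" "v \<noteq> u \<and> (E v u \<longleftrightarrow> v = p \<and> u = t)"
        using crossQ[OF that(1), of v] that(2) pqM(1) commE[of v u] by blast+
    qed
    have c12: "u \<noteq> v \<and> (E u v \<longleftrightarrow> u = t \<and> v = q)" "v \<noteq> u \<and> (E v u \<longleftrightarrow> v = q \<and> u = t)"
      if "u \<in> set Q" "v \<in> set (q # B)" for u v
    proof -
      have "v \<noteq> p" using ipM(3) that(2) by auto
      then show "u \<noteq> v \<and> (E u v \<longleftrightarrow> u = t \<and> v = q)" "v \<noteq> u \<and> (E v u \<longleftrightarrow> v = q \<and> u = t)"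
        using crossQ[OF that(1), of v] that(2) pqM(2) commE[of v u] by blast+
    qed
    have R: "set (rev Q) = set Q" "hd (rev Q) = t" "set (rev (A @ [p])) = set (A @ [p])" "hd (rev (A @ [p])) = p"
      "hd (q # B) = q" using Q0 by simp_all
    have ip: "ipath E (rev (A @ [p]))" "ipath E (rev Q)"
      using ipM(1) Q(1) ipath_rev[where F = E, OF symE] by blast+
    show ?thesis
      unfolding gen_net_def all_less_3
      using ip ipM(2) Q(2) c01 c02 c12 R by (simp del: rev_append rev.simps list.set set_append hd_append)
  qed
  have Rl: "last (?R i) = a i" if "i < 3" for i
  proof -
    have "last (rev (A @ [p])) = a 0" using M(3) s(1) by (cases A) (auto simp: last_rev)
    moreover have "last (q # B) = a 1" using M(5) s(1) by simp
    moreover have "last (rev Q) = a 2" using Q(2,3) by (simp add: last_rev)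
    ultimately show ?thesis using less_3_cases[OF that] by (auto simp del: rev_append)
  qed
  have Rs: "set (?R i) \<subseteq> K" if "i < 3" for i
    using less_3_cases[OF that] subset_trans[OF pqM(1) M(4)] subset_trans[OF pqM(2) M(4)] Q(4) by auto
  have Ri: "z \<in> K" if i: "i < 3" and w: "w \<in> set (?R i)" "w \<noteq> a i" "F w z" for i w z
  proof -
    have "hd (A @ [p]) = a 0" "last (q # B) = a 1" using M(3,5) s(1) by (cases A; simp)+
    then have a01: "a 0 \<in> set (A @ [p])" "a 1 \<in> set (q # B)"
      by (metis hd_in_set snoc_eq_iff_butlast, metis last_in_set list.distinct(1))
    consider "i = 0" | "i = 1" | "i = 2" using less_3_cases[OF i] by blast
    then show ?thesis
    proof cases
      case 1
      then have "w \<in> set (A @ [p])" using w(1) by auto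
      then have "w \<in> set M" "w \<noteq> a 1" using pqM a01 ipM(3) by auto
      then show ?thesis using innerM w 1 by blast
    next
      case 2
      then have "w \<in> set (q # B)" using w(1) by auto
      then have "w \<in> set M" "w \<noteq> a 0" using pqM a01 ipM(3) by auto
      then show ?thesis using innerM w 2 by blast
    next
      case 3
      then have wQ: "w \<in> set Q" "w \<noteq> hd Q" using w Q(3) by auto
      show ?thesis
      proof (cases "w = last Q")
        case False
        obtain A' p' q' B' where s': "Q = A' @ p' # w # q' # B'" "E p' w" "E w q'" "p' \<noteq> q'" "\<not> E p' q'"
          using ipath_interior[OF Q(1) wQ False] by metis
        then have "p' \<in> K" "q' \<in> K" "w \<in> K" using Q(4) by auto
        then show ?thesis using inner[of w p' q' z] s' symE w(3) by blast
      next
        case True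
        \<comment> \<open>The branching vertex \<open>t\<close> has the nonadjacent
          \<open>E\<close>-neighbours \<open>r\<close> and \<open>p\<close> in \<open>K\<close>,
          which is enough to keep its neighbourhood inside \<open>K\<close>.\<close>
        then have wt: "w = t" using Q0 by simp
        then obtain Q1 r where Q1: "Q0 = Q1 @ [r]" using wQ(2) Q0 by (cases Q0 rule: rev_cases) auto
        then have "E r t" using Q(1) unfolding Q0 by (auto simp: ipath_append)
        moreover have "\<not> E r p" "r \<noteq> p" "r \<in> K" "p \<in> K"
          using Q0M[of r p] Q0M'[of r] Q1 s(1) Q(4) Q0 M(4) by auto
        ultimately show ?thesis using inner[of t r p z] tK s(2) symE w(3) wt by blast
      qed
    qed
  qed
  show ?thesis
  proof (rule that[OF g])
    show "last (?R i) = a i" if "i < 3" for i using Rl[OF that] .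
    show "set (?R i) \<subseteq> K" if "i < 3" for i using Rs[OF that] .
    show "z \<in> K" if "i < 3" "w \<in> set (?R i)" "w \<noteq> a i" "F w z" for i w z using Ri[OF that] .
  qed
qed

end

section \<open>End-vertices on a theta\<close>

lemma other_two:
  assumes "i < (3::nat)"
  obtains j k where "j < 3" "k < 3" "i \<noteq> j" "i \<noteq> k" "j \<noteq> k"
proof -
  have "i = 0 \<or> i = 1 \<or> i = 2" using assms by auto
  then show ?thesis using that[of 1 2] that[of 0 2] that[of 0 1] by auto
qed

lemma third:
  assumes "i < (3::nat)" "j < 3" "i \<noteq> j"
  obtains k where "k < 3" "i \<noteq> k" "j \<noteq> k"
proof -
  have "i = 0 \<or> i = 1 \<or> i = 2" "j = 0 \<or> j = 1 \<or> j = 2" using assms by auto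
  then show ?thesis using that[of 0] that[of 1] that[of 2] assms(3) by auto
qed

text \<open>
  A theta in the closure: \<open>Y i\<close> is the arm \<open>X i\<close> from \<open>a i\<close> to \<open>b i\<close> together with its private vertex, if
  any; \<open>y i\<close> and \<open>z i\<close> are the neighbours of the two ends on a long arm and both equal the private
  vertex on a short one. The locale is symmetric under exchanging the two triangles.
\<close>

locale arms = closure_pair V F E for V :: "'a set" and F E +
  fixes Y :: "nat \<Rightarrow> 'a set" and X :: "nat \<Rightarrow> 'a list" and a b y z :: "nat \<Rightarrow> 'a"
  assumes nh: "\<not> ham V F"
    and YV: "\<And>i. i < 3 \<Longrightarrow> Y i \<subseteq> V"
    and arm: "\<And>i j u v. i < 3 \<Longrightarrow> j < 3 \<Longrightarrow> i \<noteq> j \<Longrightarrow> u \<in> Y i \<Longrightarrow> v \<in> Y j \<Longrightarrow>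
       u \<noteq> v \<and> (F u v \<longleftrightarrow> u = a i \<and> v = a j \<or> u = b i \<and> v = b j)"
    and mem: "\<And>i. i < 3 \<Longrightarrow> a i \<in> Y i \<and> b i \<in> Y i \<and> y i \<in> Y i \<and> z i \<in> Y i"
    and ne: "\<And>i. i < 3 \<Longrightarrow> a i \<noteq> b i \<and> y i \<noteq> a i \<and> y i \<noteq> b i \<and> z i \<noteq> a i \<and> z i \<noteq> b i"
    and adj: "\<And>i. i < 3 \<Longrightarrow> F (a i) (y i) \<and> F (b i) (z i)"
    and path: "\<And>i. i < 3 \<Longrightarrow> ipath F (X i) \<and> hd (X i) = a i \<and> last (X i) = b i \<and> set (X i) \<subseteq> Y i \<and> 2 \<le> length (X i)"
    and kind: "\<And>i. i < 3 \<Longrightarrow> y i = z i \<and> F (a i) (b i) \<or>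
       (\<exists>g \<in> Y i. F (y i) g \<and> \<not> F (a i) g \<and> g \<noteq> a i) \<and> (\<exists>g \<in> Y i. F (z i) g \<and> \<not> F (b i) g \<and> g \<noteq> b i)"
begin

lemma swapped: "arms V F E Y (\<lambda>i. rev (X i)) b a z y"
proof
  show "i < 3 \<Longrightarrow> j < 3 \<Longrightarrow> i \<noteq> j \<Longrightarrow> u \<in> Y i \<Longrightarrow> v \<in> Y j \<Longrightarrow>
       u \<noteq> v \<and> (F u v \<longleftrightarrow> u = b i \<and> v = b j \<or> u = a i \<and> v = a j)" for i j u v
    using arm[of i j u v] by blast
  show "ipath F (rev (X i)) \<and> hd (rev (X i)) = b i \<and> last (rev (X i)) = a i \<and> set (rev (X i)) \<subseteq> Y i \<and> 2 \<le> length (rev (X i))"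
    if "i < 3" for i
    using path[OF that] ipath_rev[where F = F, OF symF] by (simp add: hd_rev last_rev)
  show "z i = y i \<and> F (b i) (a i) \<or>
       (\<exists>g \<in> Y i. F (z i) g \<and> \<not> F (b i) g \<and> g \<noteq> b i) \<and> (\<exists>g \<in> Y i. F (y i) g \<and> \<not> F (a i) g \<and> g \<noteq> a i)" if "i < 3" for i
    using kind[OF that] symF by metis
  show "b i \<in> Y i \<and> a i \<in> Y i \<and> z i \<in> Y i \<and> y i \<in> Y i" if "i < 3" for i using mem[OF that] by simp
  show "b i \<noteq> a i \<and> z i \<noteq> b i \<and> z i \<noteq> a i \<and> y i \<noteq> b i \<and> y i \<noteq> a i" if "i < 3" for i using ne[OF that] by auto
  show "F (b i) (z i) \<and> F (a i) (y i)" if "i < 3" for i using adj[OF that] by simp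
qed (use nh YV in simp_all)

definition heavy :: "'a \<Rightarrow> bool" where
  "heavy v \<longleftrightarrow> v \<in> V \<and> card V + 3 \<le> 3 * card {u. E v u}"

lemma finV: "finite V"
  using gF unfolding sgraph_def by blast

lemma no_three_heavy:
  assumes "heavy s" "heavy t" "heavy u" "s \<noteq> t" "s \<noteq> u" "t \<noteq> u" "\<not> F s t" "\<not> F s u" "\<not> F t u"
  shows False
proof -
  have "card {w. E v w} \<le> card {w. F v w}" for v
  proof (rule card_mono)
    show "finite {w. F v w}" using finite_subset[OF _ finV, of "{w. F v w}"] inV by auto
  qed (use EF in auto)
  note le = this[of s] this[of t] this[of u]
  have "card V + 3 \<le> card {w. F s w} + card {w. F t w} + card {w. F u w}"
    using assms(1-3) le unfolding heavy_def by linarith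
  then show False using three_heavy_ham[of s t u] assms nh unfolding heavy_def by blast
qed

lemma yfar: "i < 3 \<Longrightarrow> j < 3 \<Longrightarrow> i \<noteq> j \<Longrightarrow> u \<in> Y j \<Longrightarrow> u \<noteq> y i \<and> \<not> F u (y i)"
  using arm[of j i u "y i"] mem[of i] ne[of i] by auto

lemma y_indep: "i < 3 \<Longrightarrow> j < 3 \<Longrightarrow> i \<noteq> j \<Longrightarrow> y i \<noteq> y j \<and> \<not> F (y i) (y j)"
  using yfar[of j i "y i"] mem[of i] by blast

text \<open>For distinct indices, \<open>y i\<close>, \<open>a i\<close>, the whole arm
  \<open>X j\<close>, \<open>b k\<close>, \<open>z k\<close> is an induced path of \<open>F\<close>
  with at least six vertices. Its lift starts at the same vertex, so all three vertices
  \<open>y i\<close> are heavy, and they are independent.\<close>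

lemma P6_absurd:
  assumes Phi: "\<And>Q. ipath E Q \<Longrightarrow> length Q = 6 \<Longrightarrow> heavy (hd Q)"
  shows False
proof -
  have hy: "heavy (y i)" if i: "i < 3" for i
  proof -
    obtain j k where jk: "j < 3" "k < 3" "i \<noteq> j" "i \<noteq> k" "j \<noteq> k" using other_two[OF i] by metis
    note pj = path[OF jk(1)]
    have Xj: "u \<in> Y j" if "u \<in> set (X j)" for u using pj that by blast
    have Xne: "X j \<noteq> []" using pj by auto
    then have hX: "a j \<in> set (X j)" "b j \<in> set (X j)" "X j \<noteq> []" using pj hd_in_set[OF Xne] last_in_set[OF Xne] by auto
    have mi: "a i \<in> Y i" "y i \<in> Y i" "y i \<noteq> a i" "y i \<noteq> b i" "a i \<noteq> b i" "F (y i) (a i)" using mem[OF i] ne[OF i] adj[OF i] symF by auto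
    have mk: "b k \<in> Y k" "z k \<in> Y k" "z k \<noteq> a k" "z k \<noteq> b k" "a k \<noteq> b k" "F (b k) (z k)" using mem[OF jk(2)] ne[OF jk(2)] adj[OF jk(2)] by auto
    have ik: "u \<noteq> v \<and> \<not> F u v" if "u = y i \<or> u = a i" "v = b k \<or> v = z k" for u v
      using arm[OF i jk(2,4), of u v] that mi mk by auto
    have ij: "u \<noteq> v \<and> (F u v \<longleftrightarrow> u = a i \<and> v = a j)" if "u = y i \<or> u = a i" "v \<in> set (X j)" for u v
      using arm[OF i jk(1,3), of u v] that mi Xj[of v] by auto
    have jk': "u \<noteq> v \<and> (F u v \<longleftrightarrow> u = b j \<and> v = b k)" if "u \<in> set (X j)" "v = b k \<or> v = z k" for u v
      using arm[OF jk(1,2,5), of u v] that mk Xj[of u] by auto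
    have 1: "ipath F (X j @ [b k, z k])"
    proof (subst ipath_append, intro conjI ballI)
      show "ipath F (X j)" using pj by blast
      show "ipath F [b k, z k]" using mk by simp
      show "set (X j) \<inter> set [b k, z k] = {}" using jk' by auto
      fix u v assume u: "u \<in> set (X j)" and v: "v \<in> set [b k, z k]"
      have "v = b k \<or> v = z k" using v by auto
      then show "F u v \<longleftrightarrow> u = last (X j) \<and> v = hd [b k, z k]" using jk'[OF u, of v] pj by simp
    qed
    have 2: "ipath F ([y i, a i] @ (X j @ [b k, z k]))"
    proof (subst ipath_append, intro conjI ballI)
      show "ipath F [y i, a i]" using mi by simp
      have "u \<notin> set (X j @ [b k, z k])" if u: "u = y i \<or> u = a i" for u
        using ij[OF u, of u] ik[OF u, of u] by auto
      then show "set [y i, a i] \<inter> set (X j @ [b k, z k]) = {}" by simp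
      fix u v assume u: "u \<in> set [y i, a i]" and v: "v \<in> set (X j @ [b k, z k])"
      have "hd (X j @ [b k, z k]) = a j" using hX(3) pj by simp
      moreover have u': "u = y i \<or> u = a i" using u by auto
      moreover have n: "b k \<noteq> a j" "z k \<noteq> a j" using jk'[OF hX(1), of "b k"] jk'[OF hX(1), of "z k"] by auto
      moreover have "F u v \<longleftrightarrow> u = a i \<and> v = a j"
      proof (cases "v \<in> set (X j)")
        case True
        then show ?thesis using ij[OF u' True] by blast
      next
        case False
        then have v': "v = b k \<or> v = z k" using v by auto
        then have "v \<noteq> a j" using n by auto
        then show ?thesis using ik[OF u' v'] by blast
      qed
      ultimately show "F u v \<longleftrightarrow> u = last [y i, a i] \<and> v = hd (X j @ [b k, z k])" by simp
    qed (rule 1)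
    have "6 \<le> length ([y i, a i] @ (X j @ [b k, z k]))" using pj by simp
    from lift_long[OF 2 this] obtain Q where "ipath E Q" "length Q = 6" "hd Q = y i" by auto
    then show ?thesis using Phi[of Q] by simp
  qed
  show False
    using no_three_heavy[OF hy hy hy, of 0 1 2] y_indep[of 0 1] y_indep[of 0 2] y_indep[of 1 2] by auto
qed

text \<open>
  The candidates for heavy vertices near the triangle of the \<open>a i\<close>: \<open>outw i v\<close> says that \<open>v\<close> lies just
  outside its clique \<open>A\<close> and adjoins nothing that \<open>y i\<close> does not adjoin, while \<open>inl i s\<close> below says that
  \<open>s\<close> is \<open>a i\<close> or an inner vertex of \<open>A\<close>.
\<close>

definition outw :: "nat \<Rightarrow> 'a \<Rightarrow> bool" where
  "outw i v \<longleftrightarrow> v = y i \<or> F v (y i) \<and> (\<forall>w. F v w \<longrightarrow> w = y i \<or> F w (y i))"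

definition A :: "'a set" where
  "A = region F (a 0) (a 1)"

lemma a_adj: "i < 3 \<Longrightarrow> j < 3 \<Longrightarrow> i \<noteq> j \<Longrightarrow> F (a i) (a j) \<and> a i \<noteq> a j"
  using arm[of i j "a i" "a j"] mem[of i] mem[of j] by blast

lemma a01: "F (a 0) (a 1)"
  using a_adj[of 0 1] by simp

lemma a_in_A: "i < 3 \<Longrightarrow> a i \<in> A"
  using less_3_cases[of i] a_adj[of 2 0] a_adj[of 2 1] unfolding A_def region_def by auto

lemma A_adj: "w \<in> A \<Longrightarrow> i < 3 \<Longrightarrow> w = a i \<or> F w (a i)"
  using region_adj'[OF a01] a_in_A unfolding A_def by blast

lemma A_in: "i < 3 \<Longrightarrow> j < 3 \<Longrightarrow> i \<noteq> j \<Longrightarrow> F w (a i) \<Longrightarrow> F w (a j) \<Longrightarrow> w \<in> A"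
  using region_in[OF a01, of "a i" "a j" w] a_in_A a_adj unfolding A_def by blast

lemma far:
  assumes "outw i v" "w \<noteq> y i" "\<not> F w (y i)"
  shows "w \<noteq> v \<and> \<not> F w v \<and> \<not> F v w"
  using assms comm[of w v] unfolding outw_def by blast

lemma outY: "i < 3 \<Longrightarrow> j < 3 \<Longrightarrow> i \<noteq> j \<Longrightarrow> outw i v \<Longrightarrow> u \<in> Y j \<Longrightarrow> u \<noteq> v \<and> \<not> F u v \<and> \<not> F v u"
  using far[of i v u] yfar[of i j u] by blast

lemma out_out:
  assumes "i < 3" "j < 3" "i \<noteq> j" "outw i v" "outw j w"
  shows "v \<noteq> w \<and> \<not> F v w"
  using far[OF assms(5), of v] outY[OF assms(1-4), of "y j"] mem[OF assms(2)] by blast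

lemma out_A: "i < 3 \<Longrightarrow> outw i v \<Longrightarrow> v \<notin> A"
  using A_adj[of v] outY[of i _ v] mem other_two[of i] by metis

lemma Y_A:
  assumes "i < 3" "u \<in> Y i" "u \<noteq> a i"
  shows "u \<notin> A"
proof
  obtain j k where "j < 3" "k < 3" "i \<noteq> j" "i \<noteq> k" "j \<noteq> k" using other_two[OF assms(1)] by metis
  assume "u \<in> A"
  then have "u = a j \<or> F u (a j)" using A_adj \<open>j < 3\<close> by blast
  then have "u = b i \<and> a j = b j" using arm[OF assms(1) \<open>j < 3\<close> \<open>i \<noteq> j\<close> assms(2), of "a j"] mem[OF \<open>j < 3\<close>] assms(3) by auto
  then show False using ne[OF \<open>j < 3\<close>] by auto
qed

definition inl :: "nat \<Rightarrow> 'a \<Rightarrow> bool" where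
  "inl i s \<longleftrightarrow> s \<in> A \<and> (s = a i \<or> (\<forall>w. F s w \<longrightarrow> w \<in> A))"

lemma inl_out:
  assumes "i < 3" "j < 3" "i \<noteq> j" "inl i s" "outw j v"
  shows "s \<noteq> v \<and> \<not> F s v"
proof -
  have "s \<noteq> v" "v \<notin> A" using out_A[OF assms(2,5)] assms(4) unfolding inl_def by auto
  moreover have "\<not> F (a i) v" using outY[OF assms(2,1) _ assms(5), of "a i"] mem[OF assms(1)] assms(3) by auto
  ultimately show ?thesis using assms(4) unfolding inl_def by blast
qed

text \<open>Independence is demanded only in \<open>E\<close>, since an induced net of
  \<open>E\<close> gives no more; independence in \<open>F\<close> has to be inferred from the
  positions of the vertices.\<close>

definition side :: "(nat \<Rightarrow> 'a) \<Rightarrow> bool" where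
  "side s \<longleftrightarrow> (\<forall>i<3. heavy (s i) \<and> (outw i (s i) \<or> inl i (s i)) \<and> (\<forall>j<3. j \<noteq> i \<longrightarrow> s i \<noteq> s j \<and> \<not> E (s i) (s j)))"

text \<open>A vertex outside the clique is not adjacent in \<open>F\<close> to candidates of the
  other arms, so two such vertices make the whole triple independent in \<open>F\<close>.\<close>

lemma two_out:
  assumes s: "side s" and ij: "i < 3" "j < 3" "i \<noteq> j" and o: "outw i (s i)" "outw j (s j)"
  shows False
proof -
  obtain k where k: "k < 3" "i \<noteq> k" "j \<noteq> k" using third[OF ij] by metis
  have h: "heavy (s i)" "heavy (s j)" "heavy (s k)" "outw k (s k) \<or> inl k (s k)" using s ij k unfolding side_def by auto
  have "s i \<noteq> s k \<and> \<not> F (s i) (s k)" "s j \<noteq> s k \<and> \<not> F (s j) (s k)"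
    using h(4) out_out[OF ij(1) k(1,2) o(1)] out_out[OF ij(2) k(1,3) o(2)]
      inl_out[OF k(1) ij(1) _ _ o(1)] inl_out[OF k(1) ij(2) _ _ o(2)] k(2,3) symF by metis+
  then show False using no_three_heavy[OF h(1-3)] out_out[OF ij o] by blast
qed

lemma A_meets_B:
  assumes i: "i < 3" and w: "w \<in> A" "w \<in> arms.A F b" and inn: "\<And>u. F w u \<Longrightarrow> u \<in> A"
  shows False
proof -
  interpret sw: arms V F E Y "\<lambda>i. rev (X i)" b a z y by (rule swapped)
  have "b 0 \<notin> A" using Y_A[of 0 "b 0"] mem[of 0] ne[of 0] by auto
  moreover have "w = b 0 \<or> F w (b 0)" using sw.A_adj[OF w(2), of 0] by simp
  ultimately show False using w(1) inn by blast
qed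

text \<open>Inner vertices have no neighbours outside their own clique, and neither
  \<open>a i\<close> nor \<open>b j\<close> lies in the opposite one. The indices have to differ: on
  a short arm \<open>a i\<close> and \<open>b i\<close> are adjacent.\<close>

lemma in_in:
  assumes "i < 3" "j < 3" "i \<noteq> j" and s: "inl i s" and t: "arms.inl F b j t"
  shows "s \<noteq> t \<and> \<not> F s t"
proof -
  interpret sw: arms V F E Y "\<lambda>i. rev (X i)" b a z y by (rule swapped)
  have bA: "b j \<notin> A" using Y_A[OF assms(2), of "b j"] mem[OF assms(2)] ne[OF assms(2)] by auto
  have aB: "a i \<notin> sw.A" using sw.Y_A[OF assms(1), of "a i"] mem[OF assms(1)] ne[OF assms(1)] by auto
  have sA: "s \<in> A" and tB: "t \<in> sw.A" using s t unfolding inl_def sw.inl_def by auto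
  have ab: "a i \<noteq> b j \<and> \<not> F (a i) (b j)" using arm[OF assms(1-3), of "a i" "b j"] mem ne assms(1,2) by metis
  consider "s = a i" "t = b j" | "s = a i" "\<And>w. F t w \<Longrightarrow> w \<in> sw.A" | "\<And>w. F s w \<Longrightarrow> w \<in> A"
    using s t unfolding inl_def sw.inl_def by blast
  then show ?thesis
  proof cases
    case 1
    then show ?thesis using ab by blast
  next
    case 2
    then show ?thesis using aB tB symF by blast
  next
    case 3
    have "s \<noteq> t" using A_meets_B[OF assms(1) sA _ 3] tB by blast
    moreover have "\<not> F s t"
    proof
      assume st: "F s t"
      then have tA: "t \<in> A" using 3 by blast
      have "t \<noteq> b j" using tA bA by blast
      then have inn: "\<And>w. F t w \<Longrightarrow> w \<in> sw.A" using t unfolding sw.inl_def by blast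
      have "t = a i \<or> F t (a i)" using A_adj[OF tA assms(1)] .
      then show False using aB inn tB by blast
    qed
    ultimately show ?thesis by blast
  qed
qed

text \<open>By \<open>two_out\<close> on both sides, the other candidates in \<open>s\<close> lie in
  the clique, and so does at least one of \<open>t j\<close> and \<open>t k\<close>. Say it is
  \<open>t j\<close>; then \<open>s i\<close>, \<open>s k\<close>, \<open>t j\<close> carry three
  distinct indices and are independent in \<open>F\<close>.\<close>

lemma one_out:
  assumes s: "side s" and t: "arms.side V F E b z t" and i: "i < 3" "outw i (s i)"
  shows False
proof -
  interpret sw: arms V F E Y "\<lambda>i. rev (X i)" b a z y by (rule swapped)
  obtain j k where jk: "j < 3" "k < 3" "i \<noteq> j" "i \<noteq> k" "j \<noteq> k" using other_two[OF i(1)] by metis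
  have *: False if jk: "j < 3" "k < 3" "i \<noteq> j" "i \<noteq> k" "j \<noteq> k" and tj: "sw.inl j (t j)" for j k
  proof -
    have h: "heavy (s i)" "heavy (s k)" "sw.heavy (t j)" "inl k (s k) \<or> outw k (s k)"
      using s t i(1) jk unfolding side_def sw.side_def by auto
    have ht: "heavy (t j)" using h(3) unfolding heavy_def sw.heavy_def .
    have sk: "inl k (s k)" using h(4) two_out[OF s i(1) jk(2,4) i(2)] by blast
    have 1: "s k \<noteq> s i \<and> \<not> F (s k) (s i)" using inl_out[OF jk(2) i(1) _ sk i(2)] jk(4) by auto
    have 2: "s k \<noteq> t j \<and> \<not> F (s k) (t j)" using in_in[OF jk(2,1) _ sk tj] jk(5) by auto
    have o: "s i \<notin> sw.A"
    proof
      assume "s i \<in> sw.A"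
      then have "s i = b j \<or> F (s i) (b j)" using sw.A_adj jk(1) by blast
      then show False using outY[OF i(1) jk(1,3) i(2), of "b j"] mem[OF jk(1)] by auto
    qed
    have 3: "s i \<noteq> t j \<and> \<not> F (s i) (t j)"
    proof (cases "t j = b j")
      case True
      then show ?thesis using outY[OF i(1) jk(1,3) i(2), of "b j"] mem[OF jk(1)] by auto
    next
      case False
      then have "t j \<in> sw.A" "\<And>w. F (t j) w \<Longrightarrow> w \<in> sw.A" using tj unfolding sw.inl_def by auto
      then show ?thesis using o symF[of "s i" "t j"] by auto
    qed
    show False using no_three_heavy[OF h(2,1) ht] 1 2 3 by blast
  qed
  have o: "sw.outw j (t j) \<or> sw.inl j (t j)" "sw.outw k (t k) \<or> sw.inl k (t k)" using t jk unfolding sw.side_def by auto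
  show False
  proof (cases "sw.inl j (t j)")
    case True
    then show False using *[OF jk] by blast
  next
    case False
    then have "sw.inl k (t k)" using o sw.two_out[OF t jk(1,2,5)] by blast
    then show False using *[OF jk(2,1,4,3)] jk(5) by auto
  qed
qed

section \<open>Counting when all heavy vertices lie in the two cliques\<close>

lemma card3_pairs:
  assumes "finite W" "P \<subseteq> W" "Q \<subseteq> W" "R \<subseteq> W" "P \<inter> Q \<inter> R = {}"
  shows "card P + card Q + card R \<le> 2 * card W"
proof -
  have f: "finite P" "finite Q" "finite R" using assms finite_subset by metis+
  have "card P + card Q = card (P \<union> Q) + card (P \<inter> Q)" using card_Un_Int f by blast
  moreover have "card (P \<union> Q) \<le> card W" using assms by (intro card_mono) auto
  moreover have "card (P \<inter> Q) + card R = card ((P \<inter> Q) \<union> R)" using f assms(5) by (subst card_Un_disjoint) auto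
  moreover have "card ((P \<inter> Q) \<union> R) \<le> card W" using assms by (intro card_mono) auto
  ultimately show ?thesis by linarith
qed

abbreviation M :: "nat \<Rightarrow> 'a set" where
  "M i \<equiv> region F (a i) (y i)"

lemma AV: "A \<subseteq> V" "i < 3 \<Longrightarrow> M i \<subseteq> V"
proof -
  have r: "region F u v \<subseteq> V" if "F u v" for u v using inV[OF that] inV unfolding region_def by auto
  show "A \<subseteq> V" unfolding A_def using r[OF a01] .
  show "i < 3 \<Longrightarrow> M i \<subseteq> V" using r adj by blast
qed

text \<open>The three degrees sum to at least \<open>card V + 3\<close>. Within \<open>A\<close>
  they contribute at most \<open>2 * (card A - 3)\<close>, since a common \<open>E\<close>-neighbour
  would centre a claw. Only \<open>a i\<close> can have neighbours outside \<open>A\<close>, and by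
  the claw at \<open>a i\<close> these lie in \<open>M i\<close> without \<open>a i\<close> itself.
  The corrections 3, 6 and 3 add up to 12.\<close>

lemma all_in_count:
  assumes s: "side s" and inn: "\<And>i. i < 3 \<Longrightarrow> inl i (s i)"
  shows "card V + 12 \<le> 2 * card A + (card (M 0) + card (M 1) + card (M 2))"
proof -
  let ?N = "\<lambda>i. {u. E (s i) u}"
  have fA: "finite A" "finite (M i)" if "i < 3" for i using AV that finV finite_subset by metis+
  have deg: "card (?N i) + 1 \<le> card (?N i \<inter> A) + card (M i)" if i: "i < 3" for i
  proof (cases "s i = a i")
    case False
    then have "?N i \<inter> A = ?N i" using inn[OF i] EF unfolding inl_def by auto
    moreover have "1 \<le> card (M i)" using card_mono[of "M i" "{a i}"] fA(2)[OF i] by auto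
    ultimately show ?thesis by simp
  next
    case True
    obtain j where j: "j < 3" "i \<noteq> j" using other_two[OF i] by metis
    have "?N i \<subseteq> (?N i \<inter> A) \<union> (M i - {a i})"
    proof
      fix w assume w: "w \<in> ?N i"
      then have aw: "F (a i) w" using True EF by auto
      have aj: "F (a i) (a j)" "F (a i) (y i)" "a j \<noteq> y i" "\<not> F (a j) (y i)" "w \<noteq> a i"
        using a_adj[OF i j] adj[OF i] yfar[OF i j, of "a j"] mem[OF j(1)] aw by auto
      show "w \<in> (?N i \<inter> A) \<union> (M i - {a i})"
      proof (cases "w = a j \<or> F w (a j)")
        case True
        then have "w \<in> A" using A_in[OF i j, of w] symF[OF aw] a_in_A j by blast
        then show ?thesis using w by blast
      next
        case False
        then have "w = y i \<or> F w (y i)" using clawD[OF aj(1,2) aw aj(3)] aj(4) symF by blast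
        then have "w \<in> M i" using symF[OF aw] unfolding region_def by blast
        then show ?thesis using aj(5) by blast
      qed
    qed
    then have "card (?N i) \<le> card (?N i \<inter> A) + card (M i - {a i})"
      using card_mono[of "(?N i \<inter> A) \<union> (M i - {a i})" "?N i"] card_Un_le[of "?N i \<inter> A" "M i - {a i}"] fA[OF i] by simp
    moreover have "card (M i - {a i}) + 1 = card (M i)" using fA(2)[OF i] card_Suc_Diff1[of "M i" "a i"] by simp
    ultimately show ?thesis by linarith
  qed
  have h: "card V + 3 \<le> 3 * card (?N i)" if "i < 3" for i using s that unfolding side_def heavy_def by blast
  have d: "s i \<noteq> s j" "\<not> E (s i) (s j)" if "i < 3" "j < 3" "i \<noteq> j" for i j using s that unfolding side_def by auto
  have dd: "s 0 \<noteq> s 1" "s 0 \<noteq> s 2" "s 1 \<noteq> s 2" "\<not> E (s 0) (s 1)" "\<not> E (s 0) (s 2)" "\<not> E (s 1) (s 2)"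
    using d[of 0 1] d[of 0 2] d[of 1 2] by auto
  let ?W = "A - {s 0, s 1, s 2}"
  have sA: "{s 0, s 1, s 2} \<subseteq> A" using inn unfolding inl_def by auto
  have "card {s 0, s 1, s 2} = 3" using dd by auto
  then have cW: "card ?W + 3 = card A" using sA fA(1)[of 0] card_Diff_subset[of "{s 0, s 1, s 2}" A] card_mono[OF _ sA] by auto
  have "card (?N 0 \<inter> A) + card (?N 1 \<inter> A) + card (?N 2 \<inter> A) \<le> 2 * card ?W"
  proof (rule card3_pairs)
    show "?N 0 \<inter> A \<subseteq> ?W" "?N 1 \<inter> A \<subseteq> ?W" "?N 2 \<inter> A \<subseteq> ?W" using dd symE by auto
    have False if "E (s 0) w" "E (s 1) w" "E (s 2) w" for w
      using clawE[OF symE[OF that(1)] symE[OF that(2)] symE[OF that(3)]] dd by blast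
    then show "?N 0 \<inter> A \<inter> (?N 1 \<inter> A) \<inter> (?N 2 \<inter> A) = {}" by blast
  qed (use fA(1)[of 0] in simp)
  moreover have "card V + 3 \<le> card (?N 0) + card (?N 1) + card (?N 2)" using h[of 0] h[of 1] h[of 2] by simp
  ultimately show ?thesis using deg[of 0] deg[of 1] deg[of 2] cW by linarith
qed

lemma regions_share_one:
  assumes uv: "F u v" and uv': "F u' v'" and w: "w \<in> region F u v" "w \<notin> region F u' v'"
  shows "card (region F u v \<inter> region F u' v') \<le> 1"
proof (rule ccontr)
  assume c: "\<not> ?thesis"
  have fin: "finite (region F u v \<inter> region F u' v')"
  proof (rule ccontr)
    assume "\<not> ?thesis"
    then show False using c by simp
  qed
  have "\<not> (\<forall>p \<in> region F u v \<inter> region F u' v'. \<forall>q \<in> region F u v \<inter> region F u' v'. p = q)"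
    using c card_le_Suc0_iff_eq[OF fin] by simp
  then obtain p q where pq: "p \<in> region F u v" "q \<in> region F u v" "p \<in> region F u' v'" "q \<in> region F u' v'" "p \<noteq> q"
    by blast
  have "w \<noteq> p" "w \<noteq> q" using pq w by auto
  then have "F w p" "F w q" using region_adj[OF uv w(1)] pq by auto
  then show False using region_in[OF uv' pq(3,4,5)] w(2) by blast
qed

text \<open>
  Applied to both triangles, this bound on the size of the cliques contradicts the previous one.
\<close>

lemma five_regions:
  "card A + card (arms.A F b) + (card (M 0) + card (M 1) + card (M 2)) \<le> card V + 10"
proof -
  interpret sw: arms V F E Y "\<lambda>i. rev (X i)" b a z y by (rule swapped)
  let ?B = "sw.A"
  have fin: "finite A" "finite ?B" "finite (M 0)" "finite (M 1)" "finite (M 2)"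
    using AV(1) sw.AV(1) AV(2)[of 0] AV(2)[of 1] AV(2)[of 2] finV finite_subset by fastforce+
  have AM: "card (A \<inter> M i) \<le> 1" if i: "i < 3" for i
  proof -
    obtain j where j: "j < 3" "i \<noteq> j" using other_two[OF i] by metis
    have "a j \<notin> M i"
      using yfar[OF i j, of "a j"] mem[OF j(1)] a_adj[OF i j] unfolding region_def by auto
    then show ?thesis
      using regions_share_one[OF a01, of "a i" "y i" "a j"] adj[OF i] a_in_A[OF j(1)] unfolding A_def by blast
  qed
  have BM: "card (?B \<inter> M i) \<le> 1" if i: "i < 3" for i
  proof -
    obtain j where j: "j < 3" "i \<noteq> j" using other_two[OF i] by metis
    have "b j \<notin> M i"
      using yfar[OF i j, of "b j"] mem[OF j(1)] mem[OF i] ne[OF i] ne[OF j(1)] arm[OF i j, of "a i" "b j"] unfolding region_def by auto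
    then show ?thesis
      using regions_share_one[OF sw.a01, of "a i" "y i" "b j"] adj[OF i] sw.a_in_A[OF j(1)] unfolding sw.A_def by blast
  qed
  have AB: "card (A \<inter> ?B) \<le> 1"
  proof -
    have "a 0 \<notin> ?B" using sw.Y_A[of 0 "a 0"] mem[of 0] ne[of 0] by auto
    then show ?thesis using regions_share_one[OF a01 sw.a01, of "a 0"] unfolding A_def sw.A_def by simp
  qed
  have MM: "card (M i \<inter> M j) \<le> 1" if ij: "i < 3" "j < 3" "i \<noteq> j" for i j
  proof -
    have "a i \<notin> M j" using yfar[OF ij(2,1), of "a i"] mem[OF ij(1)] a_adj[OF ij] ij(3) unfolding region_def by auto
    then show ?thesis using regions_share_one[of "a i" "y i" "a j" "y j" "a i"] adj ij by auto
  qed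
  have un: "card P + card Q \<le> card (P \<union> Q) + card (P \<inter> Q)" if "finite P" "finite Q" for P Q :: "'a set"
    using card_Un_Int[OF that] by simp
  \<comment> \<open>Five cliques have ten pairs, each with at most one common vertex: 1 + 2 + 3 + 4
    = 10.\<close>
  have i1: "card ((A \<union> ?B) \<inter> M 0) \<le> 2"
    using card_Un_le[of "A \<inter> M 0" "?B \<inter> M 0"] AM[of 0] BM[of 0] by (simp add: Int_Un_distrib2)
  have i2: "card ((A \<union> ?B \<union> M 0) \<inter> M 1) \<le> 3"
    using card_Un_le[of "A \<inter> M 1" "?B \<inter> M 1"] card_Un_le[of "A \<inter> M 1 \<union> ?B \<inter> M 1" "M 0 \<inter> M 1"] AM[of 1] BM[of 1] MM[of 0 1]
    by (simp add: Int_Un_distrib2)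
  have i3: "card ((A \<union> ?B \<union> M 0 \<union> M 1) \<inter> M 2) \<le> 4"
    using card_Un_le[of "A \<inter> M 2" "?B \<inter> M 2"] card_Un_le[of "A \<inter> M 2 \<union> ?B \<inter> M 2" "M 0 \<inter> M 2"]
      card_Un_le[of "A \<inter> M 2 \<union> ?B \<inter> M 2 \<union> M 0 \<inter> M 2" "M 1 \<inter> M 2"] AM[of 2] BM[of 2] MM[of 0 2] MM[of 1 2]
    by (simp add: Int_Un_distrib2)
  have "card (A \<union> ?B \<union> M 0 \<union> M 1 \<union> M 2) \<le> card V"
    using AV(1) sw.AV(1) AV(2)[of 0] AV(2)[of 1] AV(2)[of 2] by (intro card_mono[OF finV]) auto
  then show ?thesis
    using un[OF fin(1,2)] un[of "A \<union> ?B" "M 0"] un[of "A \<union> ?B \<union> M 0" "M 1"] un[of "A \<union> ?B \<union> M 0 \<union> M 1" "M 2"]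
      fin AB i1 i2 i3 by simp
qed

lemma two_sides_absurd:
  assumes s: "side s" and t: "arms.side V F E b z t"
  shows False
proof -
  interpret sw: arms V F E Y "\<lambda>i. rev (X i)" b a z y by (rule swapped)
  have sw_side: "arms.side V F E a y s" using s .
  have i1: "inl i (s i)" if "i < 3" for i
    using one_out[OF s t that] s that unfolding side_def by blast
  have i2: "sw.inl i (t i)" if "i < 3" for i
    using sw.one_out[OF t sw_side that] t that unfolding sw.side_def by blast
  \<comment> \<open>With n for \<open>card V\<close>, adding the two lower bounds and the two upper
    bounds gives 2n + 24 \<le> 2n + 20.\<close>
  show False
    using all_in_count[OF s i1] sw.all_in_count[OF t i2] five_regions sw.five_regions by linarith
qed

end

section \<open>Heavy vertices from nets and wounded graphs in the original graph\<close>

context arms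
begin

text \<open>The first step of the segment from \<open>a i\<close> to \<open>y i\<close> leads to
  \<open>y i\<close> itself or to a vertex whose neighbours all lie in their common region.\<close>

lemma get_d:
  assumes i: "i < 3"
  shows "\<exists>d. E (a i) d \<and> outw i d"
proof -
  have ay: "F (a i) (y i)" using adj[OF i] by blast
  obtain L where L: "ipath E L" "L \<noteq> []" "hd L = a i" "last L = y i" "set L \<subseteq> region F (a i) (y i)"
    "\<And>w u. w \<in> set L \<Longrightarrow> w \<noteq> a i \<Longrightarrow> w \<noteq> y i \<Longrightarrow> F w u \<Longrightarrow> u \<in> region F (a i) (y i)"
    using segment[OF ay] by metis
  obtain d L' where d: "L = a i # d # L'"
    using L(2,3,4) ne[OF i] by (cases L; cases "tl L") auto
  have ad: "E (a i) d" "d \<noteq> a i" "d \<in> set L" using L(1) unfolding d by auto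
  have "outw i d"
  proof (cases "d = y i")
    case False
    have "F d (y i)" using region_adj'[OF ay _ region_mem(2), of d] L(5) ad(3) False by blast
    moreover have "w = y i \<or> F w (y i)" if "F d w" for w
      using L(6)[OF ad(3,2) False that] region_adj'[OF ay _ region_mem(2), of w] by blast
    ultimately show ?thesis unfolding outw_def by blast
  qed (simp add: outw_def)
  then show ?thesis using ad by blast
qed

definition isnet :: "(nat \<Rightarrow> 'a list) \<Rightarrow> bool" where
  "isnet R \<longleftrightarrow> gen_net E R \<and> (\<forall>i<3. last (R i) = a i \<and> set (R i) \<subseteq> A \<and>
     (\<forall>w \<in> set (R i). w \<noteq> a i \<longrightarrow> (\<forall>u. F w u \<longrightarrow> u \<in> A)))"

lemma ex_net: "\<exists>R. isnet R"
proof -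
  have y: "\<exists>u. F (a i) u \<and> u \<notin> A" if "i < 3" for i
    using adj[OF that] Y_A[OF that, of "y i"] mem[OF that] ne[OF that] by blast
  show ?thesis
  proof (rule net_in_region[OF A_def a01, of a])
    show "a i \<in> A" if "i < 3" for i using a_in_A[OF that] .
    show "a i \<noteq> a j" if "i < 3" "j < 3" "i \<noteq> j" for i j using a_adj[OF that] by blast
    show "\<exists>u. F (a i) u \<and> u \<notin> A" if "i < 3" for i using y[OF that] .
    fix R :: "nat \<Rightarrow> 'a list"
    assume "gen_net E R" "\<And>i. i < 3 \<Longrightarrow> last (R i) = a i" "\<And>i. i < 3 \<Longrightarrow> set (R i) \<subseteq> A"
      "\<And>i w z. i < 3 \<Longrightarrow> w \<in> set (R i) \<Longrightarrow> w \<noteq> a i \<Longrightarrow> F w z \<Longrightarrow> z \<in> A"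
    then have "isnet R" unfolding isnet_def by blast
    then show ?thesis by blast
  qed
qed

lemma netD:
  assumes "isnet R" "i < 3"
  shows "ipath E (R i)" "R i \<noteq> []" "last (R i) = a i" "set (R i) \<subseteq> A"
    "\<And>w u. w \<in> set (R i) \<Longrightarrow> w \<noteq> a i \<Longrightarrow> F w u \<Longrightarrow> u \<in> A"
  using assms unfolding isnet_def gen_net_def by blast+

lemma gen_net_cross:
  assumes "gen_net E R" "i < 3" "j < 3" "i \<noteq> j" "u \<in> set (R i)" "v \<in> set (R j)"
  shows "u \<noteq> v \<and> (E u v \<longleftrightarrow> u = hd (R i) \<and> v = hd (R j))"
  using assms unfolding gen_net_def by blast

text \<open>Only the ends \<open>a i\<close> of the net have neighbours outside \<open>A\<close>, so
  prolonging the arms there creates no other edges.\<close>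

lemma ext_net:
  assumes R: "isnet R" and ip: "\<And>i. i < 3 \<Longrightarrow> ipath E (D i)"
    and DA: "\<And>i v. i < 3 \<Longrightarrow> v \<in> set (D i) \<Longrightarrow> v \<notin> A \<and> (E (a i) v \<longleftrightarrow> v = hd (D i))"
    and Da: "\<And>i j v. i < 3 \<Longrightarrow> j < 3 \<Longrightarrow> i \<noteq> j \<Longrightarrow> v \<in> set (D j) \<Longrightarrow> \<not> E v (a i)"
    and DD: "\<And>i j u v. i < 3 \<Longrightarrow> j < 3 \<Longrightarrow> i \<noteq> j \<Longrightarrow> u \<in> set (D i) \<Longrightarrow> v \<in> set (D j) \<Longrightarrow> u \<noteq> v \<and> \<not> E u v"
  shows "gen_net E (\<lambda>i. R i @ D i)"
proof -
  have RD: "u \<noteq> v" "E u v \<longleftrightarrow> i = j \<and> u = a i \<and> v = hd (D j)" "\<not> (E v u \<and> i \<noteq> j)"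
    if ij: "i < 3" "j < 3" "u \<in> set (R i)" "v \<in> set (D j)" for i j u v
  proof -
    have vA: "v \<notin> A" and uA: "u \<in> A" using DA[OF ij(2,4)] netD(4)[OF R ij(1)] ij(3) by auto
    show "u \<noteq> v" using vA uA by blast
    have inn: "\<not> E u v" "\<not> E v u" if "u \<noteq> a i"
      using netD(5)[OF R ij(1,3) that, of v] vA EF symE by blast+
    show "E u v \<longleftrightarrow> i = j \<and> u = a i \<and> v = hd (D j)"
    proof (cases "u = a i")
      case True
      show ?thesis
      proof (cases "i = j")
        case True
        then show ?thesis using DA[OF ij(2,4)] \<open>u = a i\<close> by blast
      next
        case False
        then show ?thesis using Da[OF ij(1,2) _ ij(4)] \<open>u = a i\<close> symE by blast
      qed
    qed (use inn in blast)
    show "\<not> (E v u \<and> i \<noteq> j)"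
      using inn Da[OF ij(1,2) _ ij(4)] by blast
  qed
  have "R i @ D i \<noteq> [] \<and> ipath E (R i @ D i)" if i: "i < 3" for i
  proof (intro conjI)
    show "R i @ D i \<noteq> []" using netD(2)[OF R i] by simp
    show "ipath E (R i @ D i)"
    proof (subst ipath_append, intro conjI ballI)
      show "ipath E (R i)" "ipath E (D i)" using netD(1)[OF R i] ip[OF i] .
      show "set (R i) \<inter> set (D i) = {}" using RD(1)[OF i i] by blast
      show "E u v \<longleftrightarrow> u = last (R i) \<and> v = hd (D i)" if "u \<in> set (R i)" "v \<in> set (D i)" for u v
        using RD(2)[OF i i that] netD(3)[OF R i] by simp
    qed
  qed
  moreover have "u \<noteq> v \<and> (E u v \<longleftrightarrow> u = hd (R i @ D i) \<and> v = hd (R j @ D j))"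
    if ij: "i < 3" "j < 3" "i \<noteq> j" and u: "u \<in> set (R i @ D i)" and v: "v \<in> set (R j @ D j)" for i j u v
  proof -
    have hd: "hd (R i @ D i) = hd (R i)" "hd (R j @ D j) = hd (R j)" "hd (R i) \<in> A" "hd (R j) \<in> A"
      using netD(2,4)[OF R ij(1)] netD(2,4)[OF R ij(2)] by auto
    consider "u \<in> set (R i)" "v \<in> set (R j)" | "u \<in> set (R i)" "v \<in> set (D j)"
      | "u \<in> set (D i)" "v \<in> set (R j)" | "u \<in> set (D i)" "v \<in> set (D j)" using u v by auto
    then show ?thesis
    proof cases
      case 1
      then show ?thesis using gen_net_cross[OF _ ij 1] R hd unfolding isnet_def by simp
    next
      case 2
      then show ?thesis using RD(1,2)[OF ij(1,2) 2] DA[OF ij(2) 2(2)] hd ij(3) by auto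
    next
      case 3
      then show ?thesis using RD(1,3)[OF ij(2,1) 3(2,1)] DA[OF ij(1) 3(1)] hd ij(3) by auto
    next
      case 4
      then show ?thesis using DD[OF ij 4] DA[OF ij(1) 4(1)] hd by auto
    qed
  qed
  ultimately show ?thesis unfolding gen_net_def by blast
qed

definition outs :: "(nat \<Rightarrow> 'a) \<Rightarrow> bool" where
  "outs d \<longleftrightarrow> (\<forall>i<3. E (a i) (d i) \<and> outw i (d i))"

lemma ex_outs: "\<exists>d. outs d"
  unfolding outs_def using get_d by metis

lemma outsD:
  assumes "outs d" "i < 3"
  shows "E (a i) (d i)" "outw i (d i)" "d i \<notin> A"
  using assms out_A unfolding outs_def by auto

lemma net_outs:
  assumes R: "isnet R" and d: "outs d"
  shows "gen_net E (\<lambda>i. R i @ [d i])"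
proof (rule ext_net[OF R])
  show "v \<notin> A \<and> (E (a i) v \<longleftrightarrow> v = hd [d i])" if "i < 3" "v \<in> set [d i]" for i v
    using outsD[OF d that(1)] that(2) by auto
  show "\<not> E v (a i)" if ij: "i < 3" "j < 3" "i \<noteq> j" "v \<in> set [d j]" for i j v
    using outY[of j i "d j" "a i"] outsD(2)[OF d ij(2)] ij mem[OF ij(1)] EF by auto
  show "u \<noteq> v \<and> \<not> E u v" if ij: "i < 3" "j < 3" "i \<noteq> j" "u \<in> set [d i]" "v \<in> set [d j]" for i j u v
    using out_out[OF ij(1-3) outsD(2)[OF d ij(1)] outsD(2)[OF d ij(2)]] ij(4,5) EF by auto
qed simp

text \<open>The second vertex of a prolonged arm is \<open>d i\<close> if the net arm is just
  \<open>a i\<close>, and lies in the clique otherwise. As it is not the head of its arm, it is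
  \<open>E\<close>-nonadjacent to the other arms.\<close>

lemma sideI:
  assumes R: "isnet R" and d: "outs d" and h: "\<And>i. i < 3 \<Longrightarrow> heavy ((R i @ [d i]) ! 1)"
  shows "side (\<lambda>i. (R i @ [d i]) ! 1)"
  unfolding side_def
proof (intro allI impI conjI)
  let ?s = "\<lambda>i. (R i @ [d i]) ! 1"
  note g = net_outs[OF R d]
  have len: "1 < length (R i @ [d i])" if "i < 3" for i using netD(2)[OF R that] by (cases "R i") auto
  have sin: "?s i \<in> set (R i @ [d i])" if "i < 3" for i using len[OF that] nth_mem by blast
  have shd: "?s i \<noteq> hd (R i @ [d i])" if i: "i < 3" for i
  proof -
    have "ipath E (R i @ [d i])" using g i unfolding gen_net_def by blast
    then have "distinct (R i @ [d i])" by (rule ipath_distinct)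
    moreover have "hd (R i @ [d i]) = (R i @ [d i]) ! 0" by (simp add: hd_conv_nth)
    ultimately show ?thesis using len[OF i] nth_eq_iff_index_eq[of "R i @ [d i]" 1 0] by auto
  qed
  fix i :: nat assume i: "i < 3"
  show "heavy (?s i)" using h[OF i] .
  show "outw i (?s i) \<or> inl i (?s i)"
  proof (cases "tl (R i) = []")
    case True
    then have "R i = [hd (R i)]" using netD(2)[OF R i] by (cases "R i") auto
    then have "?s i = d i" by (metis append_Cons append_Nil nth_Cons_0 nth_Cons_Suc One_nat_def)
    then show ?thesis using outsD(2)[OF d i] by simp
  next
    case False
    then have "?s i = R i ! 1" "1 < length (R i)" by (cases "R i"; cases "tl (R i)"; auto)+
    then have "?s i \<in> set (R i)" using nth_mem by metis
    then show ?thesis using netD(4,5)[OF R i] unfolding inl_def by blast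
  qed
  fix j :: nat assume j: "j < 3" "j \<noteq> i"
  have c: "?s i \<noteq> ?s j \<and> (E (?s i) (?s j) \<longleftrightarrow> ?s i = hd (R i @ [d i]) \<and> ?s j = hd (R j @ [d j]))"
    using gen_net_cross[OF g i j(1) _ sin[OF i] sin[OF j(1)]] j(2) by auto
  then show "?s i \<noteq> ?s j" "\<not> E (?s i) (?s j)" using shd[OF i] by auto
qed

definition net_heavy :: bool where
  "net_heavy \<longleftrightarrow> (\<forall>Yf i. gen_net E Yf \<longrightarrow> (\<forall>j<3. 2 \<le> length (Yf j)) \<longrightarrow> i < 3 \<longrightarrow> heavy (Yf i ! 1))"

lemma side_net:
  assumes N: net_heavy
  shows "\<exists>s. side s"
proof -
  obtain R d where R: "isnet R" and d: "outs d" using ex_net ex_outs by blast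
  have l: "2 \<le> length (R j @ [d j])" if "j < 3" for j using netD(2)[OF R that] by (cases "R j") auto
  have "heavy ((R i @ [d i]) ! 1)" if "i < 3" for i
    using N[unfolded net_heavy_def, rule_format, OF net_outs[OF R d] _ that] l by simp
  then show ?thesis using sideI[OF R d] by blast
qed

text \<open>Arm \<open>i\<close> carries the pendant vertex, arm \<open>j\<close> the path of two
  new vertices, and the third arm contributes only its head; both end-vertices are recorded.\<close>

definition wounded_heavy :: bool where
  "wounded_heavy \<longleftrightarrow> (\<forall>Yf i j. gen_net E Yf \<longrightarrow> i < 3 \<longrightarrow> j < 3 \<longrightarrow> i \<noteq> j \<longrightarrow> 2 \<le> length (Yf i) \<longrightarrow>
     3 \<le> length (Yf j) \<longrightarrow> heavy (Yf i ! 1) \<and> heavy (Yf j ! 2))"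

text \<open>
  \<open>ext d j\<close>: the arm at \<open>a j\<close> can be prolonged by an induced path with two vertices, which yields
  wounded graphs ending in the other two arms.
\<close>

definition good :: "(nat \<Rightarrow> 'a) \<Rightarrow> nat \<Rightarrow> 'a \<Rightarrow> bool" where
  "good d j u \<longleftrightarrow> u \<notin> A \<and> (\<forall>i<3. i \<noteq> j \<longrightarrow> \<not> E u (a i) \<and> u \<noteq> d i \<and> \<not> E u (d i))"

definition ext :: "(nat \<Rightarrow> 'a) \<Rightarrow> nat \<Rightarrow> bool" where
  "ext d j \<longleftrightarrow> (\<exists>p q. E (a j) p \<and> E p q \<and> \<not> E (a j) q \<and> good d j p \<and> good d j q)"

text \<open>A wounded graph with its pendant vertex on arm \<open>i\<close> needs three vertices on
  arm \<open>j\<close>. The net arm with \<open>d j\<close> has them unless it is just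
  \<open>a j\<close>; in that case \<open>p\<close> and \<open>q\<close> from \<open>ext\<close> are
  appended instead of \<open>d j\<close>.\<close>

lemma heavy_of_ext:
  assumes W: wounded_heavy and R: "isnet R" and d: "outs d" and ij: "i < 3" "j < 3" "i \<noteq> j"
    and e: "tl (R j) \<noteq> [] \<or> ext d j"
  shows "heavy ((R i @ [d i]) ! 1)"
proof (cases "tl (R j) = []")
  case False
  have "3 \<le> length (R j @ [d j])" using False by (cases "R j"; cases "tl (R j)") auto
  moreover have "2 \<le> length (R i @ [d i])" using netD(2)[OF R ij(1)] by (cases "R i") auto
  ultimately show ?thesis using W net_outs[OF R d] ij unfolding wounded_heavy_def by blast
next
  case True
  then obtain p q where pq: "E (a j) p" "E p q" "\<not> E (a j) q" "good d j p" "good d j q"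
    using e unfolding ext_def by blast
  define D where "D l = (if l = i then [d i] else if l = j then [p, q] else [])" for l
  have gd: "v \<notin> A" "l < 3 \<Longrightarrow> l \<noteq> j \<Longrightarrow> \<not> E v (a l) \<and> v \<noteq> d l \<and> \<not> E v (d l)" if "v = p \<or> v = q" for v l
    using that pq(4,5) unfolding good_def by auto
  have g: "gen_net E (\<lambda>l. R l @ D l)"
  proof (rule ext_net[OF R])
    show "ipath E (D l)" if "l < 3" for l using pq(2) ij unfolding D_def by (auto dest: sgraphD(4)[OF gE])
    show "v \<notin> A \<and> (E (a l) v \<longleftrightarrow> v = hd (D l))" if "l < 3" "v \<in> set (D l)" for l v
      using that gd(1)[of v] outsD[OF d ij(1)] pq(1-3) ij unfolding D_def by (auto split: if_splits)
    show "\<not> E v (a l)" if l: "l < 3" "l' < 3" "l \<noteq> l'" "v \<in> set (D l')" for l l' v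
    proof (cases "l' = i")
      case True
      then have "v = d i" using l(4) unfolding D_def by simp
      then show ?thesis
        using outY[of i l "d i" "a l"] outsD(2)[OF d ij(1)] l ij mem[OF l(1)] EF True by blast
    next
      case False
      then have "l' = j" "v = p \<or> v = q" using l(4) unfolding D_def by (auto split: if_splits)
      then show ?thesis using gd(2)[of v l] l by blast
    qed
    show "u \<noteq> v \<and> \<not> E u v" if l: "l < 3" "l' < 3" "l \<noteq> l'" "u \<in> set (D l)" "v \<in> set (D l')" for l l' u v
    proof -
      consider "u = d i" "v = p \<or> v = q" | "v = d i" "u = p \<or> u = q"
        using l(3-5) unfolding D_def by (auto split: if_splits)
      then show ?thesis
      proof cases
        case 1
        then show ?thesis using gd(2)[of v i] ij symE by blast
      next
        case 2
        then show ?thesis using gd(2)[of u i] ij by blast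
      qed
    qed
  qed
  have "2 \<le> length (R i @ D i)" "3 \<le> length (R j @ D j)"
    using netD(2)[OF R ij(1)] netD(2)[OF R ij(2)] ij(3) unfolding D_def by (cases "R i"; cases "R j"; simp)+
  then have "heavy ((R i @ D i) ! 1)"
    using W[unfolded wounded_heavy_def, rule_format, OF g ij] by blast
  then show ?thesis unfolding D_def by simp
qed

lemma good_outw:
  assumes "outs d" "j < 3" "outw j u"
  shows "good d j u"
  unfolding good_def
proof (intro conjI allI impI)
  show "u \<notin> A" using out_A[OF assms(2,3)] .
  fix i :: nat assume i: "i < 3" "i \<noteq> j"
  show "\<not> E u (a i)" using outY[OF assms(2) i(1) _ assms(3), of "a i"] i mem[OF i(1)] EF by auto
  show "u \<noteq> d i" "\<not> E u (d i)"
    using out_out[OF assms(2) i(1) _ assms(3) outsD(2)[OF assms(1) i(1)]] i EF by auto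
qed

lemma good_Y:
  assumes d: "outs d" and j: "j < 3" and u: "u \<in> Y j" "u \<noteq> a j"
  shows "good d j u"
  unfolding good_def
proof (intro conjI allI impI)
  show "u \<notin> A" using Y_A[OF j u] .
  fix i :: nat assume i: "i < 3" "i \<noteq> j"
  show "\<not> E u (a i)" using arm[OF j i(1) _ u(1), of "a i"] i mem[OF i(1)] ne[OF i(1)] u(2) EF by auto
  show "u \<noteq> d i" "\<not> E u (d i)"
    using outY[OF i(1) j i(2) outsD(2)[OF d i(1)] u(1)] EF by auto
qed

lemma good_B:
  assumes d: "outs d" and j: "j < 3" and u: "u \<in> arms.A F b" "\<And>w. F u w \<Longrightarrow> w \<in> arms.A F b"
  shows "good d j u"
  unfolding good_def
proof (intro conjI allI impI)
  interpret sw: arms V F E Y "\<lambda>i. rev (X i)" b a z y by (rule swapped)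
  show "u \<notin> A" using sw.A_meets_B[OF j u(1) _ u(2)] by blast
  fix i :: nat assume i: "i < 3" "i \<noteq> j"
  have "a i \<notin> sw.A" using sw.Y_A[OF i(1), of "a i"] mem[OF i(1)] ne[OF i(1)] by auto
  then show "\<not> E u (a i)" using u(2) EF by blast
  have "d i \<notin> sw.A"
  proof
    assume a: "d i \<in> sw.A"
    have "d i = b j \<or> F (d i) (b j)" using sw.A_adj[OF a j] .
    then show False using outY[OF i(1) j i(2) outsD(2)[OF d i(1)], of "b j"] mem[OF j] by auto
  qed
  then show "u \<noteq> d i" "\<not> E u (d i)" using u EF by blast+
qed

lemma region_out:
  assumes "F u v" "w \<in> region F u v" "\<And>t. F w t \<Longrightarrow> t \<in> region F u v" "y j \<in> region F u v"
  shows "outw j w"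
proof (cases "w = y j")
  case False
  then show ?thesis unfolding outw_def
    using region_adj'[OF assms(1) assms(2,4)] region_adj'[OF assms(1) assms(3,4)] by blast
qed (simp add: outw_def)

lemma three_path:
  assumes "ipath E L" "L \<noteq> []" "hd L = s" "last L = t" "s \<noteq> t" "\<not> E s t"
  obtains p q L' where "L = s # p # q # L'" "E s p" "E p q" "\<not> E s q" "q \<noteq> s" "p \<noteq> s" "p \<noteq> t"
proof -
  obtain p L1 where 1: "L = s # p # L1" using assms(2-5) by (cases L; cases "tl L") auto
  then obtain q L' where 2: "L1 = q # L'" using assms(1,4,6) by (cases L1) auto
  have "E s p" "E p q" "\<not> E s q" "q \<noteq> s" "p \<noteq> s" "p \<noteq> t" using assms(1,6) unfolding 1 2 by auto
  then show ?thesis using that 1 2 by blast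
qed

text \<open>If the arm were long, or if one of these edges were missing in \<open>E\<close>, lifting
  a suitable path or edge of \<open>F\<close> would give vertices \<open>p\<close> and
  \<open>q\<close> witnessing \<open>ext\<close>. For the last claim they are \<open>b j\<close> and
  an inner vertex of the opposite clique.\<close>

lemma not_ext_tight:
  assumes d: "outs d" and j: "j < 3" and ne': "\<not> ext d j"
  shows "y j = z j" "F (a j) (b j)" "E (a j) (y j)" "E (a j) (b j)" "\<And>k. k < 3 \<Longrightarrow> k \<noteq> j \<Longrightarrow> E (b j) (b k)"
proof -
  interpret sw: arms V F E Y "\<lambda>i. rev (X i)" b a z y by (rule swapped)
  have no: False if "E (a j) p" "E p q" "\<not> E (a j) q" "good d j p" "good d j q" for p q
    using ne' that unfolding ext_def by blast
  have ay: "F (a j) (y j)" using adj[OF j] by blast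
  have oy: "outw j (y j)" unfolding outw_def by blast
  have T: "y j = z j \<and> F (a j) (b j)"
  proof (rule ccontr)
    assume "\<not> ?thesis"
    then obtain g where g: "g \<in> Y j" "F (y j) g" "\<not> F (a j) g" "g \<noteq> a j" using kind[OF j] by blast
    have "ipath F [a j, y j, g]" using ay g ne[OF j] irr[of "y j"] by auto
    from lift_path[OF this] obtain L' where L': "ipath E L'" "L' \<noteq> []" "hd L' = a j" "last L' = g" "3 \<le> length L'"
      "\<And>w. w \<in> set L' \<Longrightarrow> tame [a j, y j, g] w" by auto
    have "\<not> E (a j) g" using g EF by blast
    then obtain p q L1 where pq: "L' = a j # p # q # L1" "E (a j) p" "E p q" "\<not> E (a j) q" "q \<noteq> a j" "p \<noteq> a j"
      using three_path[OF L'(1-4)] g(4) by metis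
    have "good d j w" if w: "w \<in> set L'" "w \<noteq> a j" for w
    proof (cases "w = y j \<or> w = g")
      case True
      then show ?thesis using good_outw[OF d j oy] good_Y[OF d j g(1,4)] by blast
    next
      case False
      then obtain u v where uv: "u \<in> {a j, y j, g}" "v \<in> {a j, y j, g}" "F u v" "w \<in> region F u v" "\<And>t. F w t \<Longrightarrow> t \<in> region F u v"
        using L'(6)[OF w(1)] w(2) unfolding tame_def by auto
      have "u = y j \<or> v = y j" using uv(1-3) g(3) symF by auto
      then have "outw j w" using region_out[OF uv(3-5)] by auto
      then show ?thesis using good_outw[OF d j] by blast
    qed
    then have "good d j p" "good d j q" using pq by auto
    then show False using no[OF pq(2-4)] by blast
  qed
  then show "y j = z j" "F (a j) (b j)" by auto
  then have yab: "F (y j) (b j)" "F (y j) (a j)" using adj[OF j] symF by auto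
  show "E (a j) (y j)"
  proof (rule ccontr)
    assume n: "\<not> E (a j) (y j)"
    obtain L where L: "ipath E L" "L \<noteq> []" "hd L = a j" "last L = y j" "set L \<subseteq> region F (a j) (y j)"
      "\<And>w u. w \<in> set L \<Longrightarrow> w \<noteq> a j \<Longrightarrow> w \<noteq> y j \<Longrightarrow> F w u \<Longrightarrow> u \<in> region F (a j) (y j)"
      using segment[OF ay] by metis
    obtain p q L1 where pq: "L = a j # p # q # L1" "E (a j) p" "E p q" "\<not> E (a j) q" "q \<noteq> a j" "p \<noteq> a j"
      using three_path[OF L(1-4) _ n] ne[OF j] by metis
    have "good d j w" if w: "w \<in> set L" "w \<noteq> a j" for w
    proof (cases "w = y j")
      case False
      then have "outw j w" using region_out[OF ay, of w j] L(5) L(6)[OF w(1,2) False] w(1) by auto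
      then show ?thesis using good_outw[OF d j] by blast
    qed (use good_outw[OF d j oy] in simp)
    then have "good d j p" "good d j q" using pq by auto
    then show False using no[OF pq(2-4)] by blast
  qed
  show Eab: "E (a j) (b j)"
  proof (rule ccontr)
    assume n: "\<not> E (a j) (b j)"
    have ab: "F (a j) (b j)" using T by blast
    obtain L where L: "ipath E L" "L \<noteq> []" "hd L = a j" "last L = b j" "set L \<subseteq> region F (a j) (b j)"
      "\<And>w u. w \<in> set L \<Longrightarrow> w \<noteq> a j \<Longrightarrow> w \<noteq> b j \<Longrightarrow> F w u \<Longrightarrow> u \<in> region F (a j) (b j)"
      using segment[OF ab] by metis
    obtain p q L1 where pq: "L = a j # p # q # L1" "E (a j) p" "E p q" "\<not> E (a j) q" "q \<noteq> a j" "p \<noteq> a j"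
      using three_path[OF L(1-4) _ n] ne[OF j] by metis
    have yr: "y j \<in> region F (a j) (b j)" using yab unfolding region_def by blast
    have "good d j w" if w: "w \<in> set L" "w \<noteq> a j" for w
    proof (cases "w = b j")
      case False
      have "w \<in> region F (a j) (b j)" using L(5) w(1) by blast
      then have "outw j w" using region_out[OF ab _ _ yr, of w] L(6)[OF w(1,2) False] by blast
      then show ?thesis using good_outw[OF d j] by blast
    next
      case True
      then show ?thesis using good_Y[OF d j, of "b j"] mem[OF j] ne[OF j] by auto
    qed
    then have "good d j p" "good d j q" using pq by auto
    then show False using no[OF pq(2-4)] by blast
  qed
  show "E (b j) (b k)" if k: "k < 3" "k \<noteq> j" for k
  proof (rule ccontr)
    assume n: "\<not> E (b j) (b k)"
    have bb: "F (b j) (b k)" "b j \<noteq> b k" using sw.a_adj[OF j k(1)] k(2) by auto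
    obtain L where L: "ipath E L" "L \<noteq> []" "hd L = b j" "last L = b k" "set L \<subseteq> region F (b j) (b k)"
      "\<And>w u. w \<in> set L \<Longrightarrow> w \<noteq> b j \<Longrightarrow> w \<noteq> b k \<Longrightarrow> F w u \<Longrightarrow> u \<in> region F (b j) (b k)"
      using segment[OF bb(1)] by metis
    obtain p q L1 where pq: "L = b j # p # q # L1" "E (b j) p" "p \<noteq> b j" "p \<noteq> b k"
      using three_path[OF L(1-4) bb(2) n] by metis
    have rB: "w \<in> sw.A" if "w \<in> region F (b j) (b k)" for w
      using that sw.A_in[OF j k(1), of w] k(2) sw.a_in_A j k(1) unfolding region_def by auto
    have pL: "p \<in> set L" using pq(1) by simp
    have pB: "p \<in> sw.A" "\<And>w. F p w \<Longrightarrow> w \<in> sw.A" using rB L(5) pL L(6)[OF pL pq(3,4)] by blast+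
    have "a j \<notin> sw.A" using sw.Y_A[OF j, of "a j"] mem[OF j] ne[OF j] by auto
    then have "\<not> E (a j) p" using pB(2) EF symF by blast
    moreover have "good d j (b j)" using good_Y[OF d j, of "b j"] mem[OF j] ne[OF j] by auto
    ultimately show False using no[OF Eab pq(2)] good_B[OF d j pB] by blast
  qed
qed

lemma wounded_at:
  assumes W: wounded_heavy and t: "E x0 x1" "E x1 x2" "E x0 x2" "E x1 p" "E x2 r" "E r q"
    and n: "x0 \<noteq> p" "\<not> E x0 p" "x0 \<noteq> r" "\<not> E x0 r" "x0 \<noteq> q" "\<not> E x0 q" "x1 \<noteq> r" "\<not> E x1 r" "x1 \<noteq> q" "\<not> E x1 q"
      "p \<noteq> x2" "\<not> E p x2" "p \<noteq> r" "\<not> E p r" "p \<noteq> q" "\<not> E p q" "x2 \<noteq> q" "\<not> E x2 q"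
  shows "heavy q"
proof -
  have ir: "x0 \<noteq> x1" "x1 \<noteq> x2" "x0 \<noteq> x2" "x1 \<noteq> p" "x2 \<noteq> r" "r \<noteq> q" using t irrE by blast+
  have s: "E x1 x0" "E x2 x1" "E x2 x0" "\<not> E p x0" "\<not> E r x0" "\<not> E q x0" "\<not> E r x1" "\<not> E q x1" "\<not> E x2 p" "\<not> E r p" "\<not> E q p"
    using t n symE by blast+
  have "gen_net E ((!) [[x0], [x1, p], [x2, r, q]])"
    unfolding gen_net_def all_less_3 using t n ir s by auto
  from W[unfolded wounded_heavy_def, rule_format, OF this, of 1 2] show ?thesis by simp
qed

text \<open>
  If two arms cannot be prolonged, then their triangles and the triangle at the other side are
  already present in the original graph, and wounded graphs centred at the arms produce three
  independent heavy vertices.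
\<close>

lemma tight_pair:
  assumes W: wounded_heavy and d: "outs d" and ijk: "i < 3" "j < 3" "k < 3" "i \<noteq> j" "i \<noteq> k" "j \<noteq> k"
    and nj: "\<not> ext d j" and nk: "\<not> ext d k" and ajk: "E (a j) (a k)"
  shows False
proof -
  interpret sw: arms V F E Y "\<lambda>i. rev (X i)" b a z y by (rule swapped)
  have nonadj: "u \<noteq> v \<and> \<not> E u v" if "l < 3" "m < 3" "l \<noteq> m" "u \<in> Y l" "v \<in> Y m" "u \<noteq> a l \<or> v \<noteq> a m" "u \<noteq> b l \<or> v \<noteq> b m" for l m u v
    using arm[OF that(1-5)] that(6,7) EF by blast
  \<comment> \<open>The outside neighbour \<open>a m\<close> makes the \<open>E\<close>-neighbours
    of \<open>a l\<close> within the region of \<open>a l\<close> and \<open>y l\<close> pairwise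
    adjacent.\<close>
  have tri: "E (y l) (b l)" if l: "l < 3" "m < 3" "l \<noteq> m" "\<not> ext d l" for l m
  proof (rule frontier_simplicial[of "a l" "y l" "a l" "a m"])
    note T = not_ext_tight[OF d l(1,4)]
    show "F (a l) (y l)" using adj[OF l(1)] by blast
    show "F (a l) (a m)" using a_adj[OF l(1-3)] by blast
    show "a m \<notin> region F (a l) (y l)"
      using yfar[OF l(1-3), of "a m"] mem[OF l(2)] a_adj[OF l(1-3)] unfolding region_def by auto
    show "b l \<in> region F (a l) (y l)" using T(1,2) adj[OF l(1)] symF unfolding region_def by auto
    show "E (a l) (y l)" "E (a l) (b l)" using T by auto
    show "y l \<noteq> b l" using ne[OF l(1)] by blast
  qed auto
  \<comment> \<open>The wounded graph consists of the triangle \<open>y m, a m, b m\<close>, a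
    pendant vertex \<open>p\<close> next to \<open>a m\<close> in the direction of
    \<open>a i\<close>, and the path \<open>b m, b l, y l\<close>.\<close>
  have hy: "heavy (y l)" if jk: "m < 3" "l < 3" "i \<noteq> m" "i \<noteq> l" "m \<noteq> l" "\<not> ext d m" "\<not> ext d l" for m l
  proof -
    note Tm = not_ext_tight[OF d jk(1,6)] and Tl = not_ext_tight[OF d jk(2,7)]
    have ai: "F (a m) (a i)" "a m \<noteq> a i" using a_adj[OF jk(1) ijk(1)] jk(3) by auto
    obtain L where L: "ipath E L" "L \<noteq> []" "hd L = a m" "last L = a i" "set L \<subseteq> region F (a m) (a i)"
      "\<And>w u. w \<in> set L \<Longrightarrow> w \<noteq> a m \<Longrightarrow> w \<noteq> a i \<Longrightarrow> F w u \<Longrightarrow> u \<in> region F (a m) (a i)"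
      using segment[OF ai(1)] by metis
    obtain p L' where p: "L = a m # p # L'" using L(2,3,4) ai(2) by (cases L; cases "tl L") auto
    have mp: "E (a m) p" "p \<noteq> a m" "p \<in> set L" using L(1) unfolding p by auto
    have rA: "w \<in> A" if "w \<in> region F (a m) (a i)" for w
      using that A_in[OF jk(1) ijk(1), of w] jk(3) a_in_A jk(1) ijk(1) unfolding region_def by auto
    have pA: "p \<in> A" "p = a i \<or> (\<forall>w. F p w \<longrightarrow> w \<in> A)" using rA L(5) L(6)[OF mp(3,2)] mp(3) by blast+
    have pn: "p \<noteq> u \<and> \<not> E p u \<and> \<not> E u p" if u: "u \<in> Y n" "n < 3" "n \<noteq> i" "u \<noteq> a n" for u n
    proof -
      have uA: "u \<notin> A" using Y_A[OF u(2,1,4)] .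
      have "\<not> E (a i) u" using nonadj[OF ijk(1) u(2) _ _ u(1), of "a i"] u(3,4) mem[OF ijk(1)] ne[OF ijk(1)] by auto
      then show ?thesis using pA uA EF symE by blast
    qed
    note memm = mem[OF jk(1)] ne[OF jk(1)] and meml = mem[OF jk(2)] ne[OF jk(2)]
    note nn = nonadj[OF jk(1,2,5)]
    show ?thesis
    proof (rule wounded_at[OF W, of "y m" "a m" "b m" p "b l" "y l"])
      show "E (y m) (a m)" using Tm(3) symE by blast
      show "E (a m) (b m)" using Tm(4) .
      show "E (y m) (b m)" using tri[OF jk(1,2,5,6)] .
      show "E (a m) p" using mp(1) .
      show "E (b m) (b l)" using Tm(5) jk(2,5) by auto
      show "E (b l) (y l)" using tri[OF jk(2,1) _ jk(7)] jk(5) symE by auto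
      show "y m \<noteq> p" "\<not> E (y m) p" using pn[of "y m" m] memm jk by auto
      show "y m \<noteq> b l" "\<not> E (y m) (b l)" using nn[of "y m" "b l"] memm meml by auto
      show "y m \<noteq> y l" "\<not> E (y m) (y l)" using nn[of "y m" "y l"] memm meml by auto
      show "a m \<noteq> b l" "\<not> E (a m) (b l)" using nn[of "a m" "b l"] memm meml by auto
      show "a m \<noteq> y l" "\<not> E (a m) (y l)" using nn[of "a m" "y l"] memm meml by auto
      show "p \<noteq> b m" "\<not> E p (b m)" using pn[of "b m" m] memm jk by auto
      show "p \<noteq> b l" "\<not> E p (b l)" using pn[of "b l" l] meml jk by auto
      show "p \<noteq> y l" "\<not> E p (y l)" using pn[of "y l" l] meml jk by auto
      show "b m \<noteq> y l" "\<not> E (b m) (y l)" using nn[of "b m" "y l"] memm meml by auto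
    qed
  qed
  have h1: "heavy (y k)" using hy[OF ijk(2,3,4,5,6) nj nk] .
  have h2: "heavy (y j)" using hy[OF ijk(3,2,5,4) _ nk nj] ijk(6) by auto
  \<comment> \<open>The third heavy vertex lies just outside the opposite clique at
    \<open>b i\<close>, away from the arms \<open>j\<close> and \<open>k\<close>. Its wounded graph
    has the triangle \<open>y j, a j, b j\<close>, the pendant vertex \<open>a k\<close> and the
    path \<open>b j, b i, e\<close>.\<close>
  obtain e where e: "E (b i) e" "sw.outw i e" using sw.get_d[OF ijk(1)] by blast
  have en: "u \<noteq> e \<and> \<not> F u e \<and> \<not> F e u" if "u \<in> Y l" "l < 3" "l \<noteq> i" for u l
    using sw.outY[OF ijk(1) that(2) _ e(2) that(1)] that(3) by auto
  note Tj = not_ext_tight[OF d ijk(2) nj]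
  note memi = mem[OF ijk(1)] ne[OF ijk(1)] and memj = mem[OF ijk(2)] ne[OF ijk(2)] and memk = mem[OF ijk(3)] ne[OF ijk(3)]
  have ne: "j \<noteq> i" "k \<noteq> i" "k \<noteq> j" using ijk by auto
  have h3: "heavy e"
  proof (rule wounded_at[OF W, of "y j" "a j" "b j" "a k" "b i" e])
    show "E (y j) (a j)" using Tj(3) symE by blast
    show "E (a j) (b j)" using Tj(4) .
    show "E (y j) (b j)" using tri[OF ijk(2,3,6) nj] .
    show "E (a j) (a k)" using ajk .
    show "E (b j) (b i)" using Tj(5) ijk by auto
    show "E (b i) e" using e(1) .
    show "y j \<noteq> a k" "\<not> E (y j) (a k)" using nonadj[OF ijk(2,3,6), of "y j" "a k"] memj memk by auto
    show "y j \<noteq> b i" "\<not> E (y j) (b i)" using nonadj[OF ijk(2,1) ne(1), of "y j" "b i"] memj memi by auto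
    show "a j \<noteq> b i" "\<not> E (a j) (b i)" using nonadj[OF ijk(2,1) ne(1), of "a j" "b i"] memj memi by auto
    show "a k \<noteq> b j" "\<not> E (a k) (b j)" using nonadj[OF ijk(3,2) ne(3), of "a k" "b j"] memj memk by auto
    show "a k \<noteq> b i" "\<not> E (a k) (b i)" using nonadj[OF ijk(3,1) ne(2), of "a k" "b i"] memi memk by auto
    show "y j \<noteq> e" "\<not> E (y j) e" "a j \<noteq> e" "\<not> E (a j) e" "b j \<noteq> e" "\<not> E (b j) e" "a k \<noteq> e" "\<not> E (a k) e"
      using en[of "y j" j] en[of "a j" j] en[of "b j" j] en[of "a k" k] memj memk ijk ne EF by auto
  qed
  show False
    using no_three_heavy[OF h2 h1 h3] y_indep[OF ijk(2,3,6)] en[of "y j" j] en[of "y k" k] memj memk ijk ne by auto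
qed

text \<open>If the candidate on arm \<open>i\<close> is not heavy, neither of the other arms can be
  made long. Their net arms are then just \<open>a j\<close> and \<open>a k\<close>, which as heads
  of the net are adjacent in \<open>E\<close>, and \<open>tight_pair\<close> applies.\<close>

lemma side_wounded:
  assumes W: wounded_heavy
  shows "\<exists>s. side s"
proof -
  obtain R d where R: "isnet R" and d: "outs d" using ex_net ex_outs by blast
  have "heavy ((R i @ [d i]) ! 1)" if i: "i < 3" for i
  proof (rule ccontr)
    assume n: "\<not> ?thesis"
    obtain j k where jk: "j < 3" "k < 3" "i \<noteq> j" "i \<noteq> k" "j \<noteq> k" using other_two[OF i] by metis
    have tj: "tl (R j) = []" "\<not> ext d j" "tl (R k) = []" "\<not> ext d k"
      using heavy_of_ext[OF W R d i jk(1,3)] heavy_of_ext[OF W R d i jk(2,4)] n by auto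
    have hd: "hd (R l) = a l" if "l < 3" "tl (R l) = []" for l
      using netD(2,3)[OF R that(1)] that(2) by (cases "R l") auto
    have h: "hd (R j) = a j" "hd (R k) = a k" "hd (R j) \<in> set (R j)" "hd (R k) \<in> set (R k)"
      using hd[OF jk(1) tj(1)] hd[OF jk(2) tj(3)] netD(2)[OF R jk(1)] netD(2)[OF R jk(2)] hd_in_set by metis+
    have "E (a j) (a k)"
      using gen_net_cross[OF _ jk(1,2,5) h(3,4)] R h(1,2) unfolding isnet_def by simp
    then show False using tight_pair[OF W d i jk tj(2,4)] by blast
  qed
  then show ?thesis using sideI[OF R d] by blast
qed

lemma net_absurd:
  assumes N: net_heavy
  shows False
proof -
  interpret sw: arms V F E Y "\<lambda>i. rev (X i)" b a z y by (rule swapped)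
  have "sw.net_heavy" using N unfolding net_heavy_def sw.net_heavy_def heavy_def sw.heavy_def .
  then show False using side_net[OF N] sw.side_net two_sides_absurd by blast
qed

lemma wounded_absurd:
  assumes W: wounded_heavy
  shows False
proof -
  interpret sw: arms V F E Y "\<lambda>i. rev (X i)" b a z y by (rule swapped)
  have "sw.wounded_heavy" using W unfolding wounded_heavy_def sw.wounded_heavy_def heavy_def sw.heavy_def .
  then show False using side_wounded[OF W] sw.side_wounded two_sides_absurd by blast
qed

end

section \<open>Reading off the arms from a theta\<close>

lemma long_arm:
  assumes "ipath F L" "3 \<le> length L"
  shows "L ! 1 \<in> set L" "L ! 1 \<noteq> hd L" "L ! 1 \<noteq> last L" "F (hd L) (L ! 1)" "hd L \<noteq> last L"
    "\<exists>g \<in> set L. F (L ! 1) g \<and> \<not> F (hd L) g \<and> g \<noteq> hd L"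
proof -
  obtain p q r L' where L: "L = p # q # r # L'" using assms(2)
    by (cases L; cases "tl L"; cases "tl (tl L)") auto
  have "last (r # L') \<in> set (r # L')" by simp
  then show "L ! 1 \<in> set L" "L ! 1 \<noteq> hd L" "L ! 1 \<noteq> last L" "F (hd L) (L ! 1)" "hd L \<noteq> last L"
    "\<exists>g \<in> set L. F (L ! 1) g \<and> \<not> F (hd L) g \<and> g \<noteq> hd L"
    using assms(1) unfolding L by (auto simp del: last_in_set split: if_splits)
qed

lemma (in closure_pair) arms_of_theta:
  assumes th: "theta F V X c" and nh: "\<not> ham V F"
  shows "\<exists>Y y z. arms V F E Y X (\<lambda>i. hd (X i)) (\<lambda>i. last (X i)) y z"
proof (intro exI)
  let ?T = "\<lambda>i. length (X i) = 2"
  let ?Y = "\<lambda>i. set (X i) \<union> (if ?T i then {c i} else {})"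
  let ?y = "\<lambda>i. if ?T i then c i else X i ! 1"
  let ?z = "\<lambda>i. if ?T i then c i else rev (X i) ! 1"
  have X: "ipath F (X i)" "2 \<le> length (X i)" "set (X i) \<subseteq> V" "X i \<noteq> []" if "i < 3" for i
    using th that unfolding theta_def by fastforce+
  have cr: "cross F (X i) (X j)" if "i < 3" "j < 3" "i \<noteq> j" for i j
    using th that unfolding theta_def by blast
  have c: "c i \<in> V" "F (c i) (hd (X i))" "F (c i) (last (X i))" if "i < 3" "?T i" for i
    using th that unfolding theta_def by blast+
  have cX: "c i \<noteq> u \<and> \<not> F (c i) u \<and> \<not> F u (c i)" if "i < 3" "?T i" "j < 3" "j \<noteq> i" "u \<in> set (X j)" for i j u
    using th that symF unfolding theta_def by blast
  have cc: "c i \<noteq> c j \<and> \<not> F (c i) (c j)" if "i < 3" "?T i" "j < 3" "j \<noteq> i" "?T j" for i j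
    using th that unfolding theta_def by blast
  have revX: "ipath F (rev (X i))" if "i < 3" for i using X(1)[OF that] ipath_rev[where F = F, OF symF] by blast
  have three: "3 \<le> length (X i)" if "i < 3" "\<not> ?T i" for i using X(2)[OF that(1)] that(2) by linarith
  have hl: "hd (X i) \<in> set (X i)" "last (X i) \<in> set (X i)" if "i < 3" for i using X(4)[OF that] by auto
  have two: "F (hd (X i)) (last (X i))" "hd (X i) \<noteq> last (X i)" if "i < 3" "?T i" for i
    using X(1)[OF that(1)] that(2) by (cases "X i"; cases "tl (X i)"; auto)+
  have la: "X i ! 1 \<in> set (X i)" "X i ! 1 \<noteq> hd (X i)" "X i ! 1 \<noteq> last (X i)" "F (hd (X i)) (X i ! 1)" "hd (X i) \<noteq> last (X i)"
    "\<exists>g \<in> set (X i). F (X i ! 1) g \<and> \<not> F (hd (X i)) g \<and> g \<noteq> hd (X i)" if "i < 3" "\<not> ?T i" for i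
    using long_arm[OF X(1)[OF that(1)] three[OF that]] by blast+
  have lb: "rev (X i) ! 1 \<in> set (X i)" "rev (X i) ! 1 \<noteq> last (X i)" "rev (X i) ! 1 \<noteq> hd (X i)" "F (last (X i)) (rev (X i) ! 1)"
    "\<exists>g \<in> set (X i). F (rev (X i) ! 1) g \<and> \<not> F (last (X i)) g \<and> g \<noteq> last (X i)" if "i < 3" "\<not> ?T i" for i
    using long_arm[OF revX[OF that(1)]] three[OF that] X(4)[OF that(1)] by (simp_all add: hd_rev last_rev)
  show "arms V F E ?Y X (\<lambda>i. hd (X i)) (\<lambda>i. last (X i)) ?y ?z"
  proof
    show "\<not> ham V F" using nh .
    show "?Y i \<subseteq> V" if "i < 3" for i using X(3)[OF that] c(1)[OF that] by auto
    show "u \<noteq> v \<and> (F u v \<longleftrightarrow> u = hd (X i) \<and> v = hd (X j) \<or> u = last (X i) \<and> v = last (X j))"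
      if ij: "i < 3" "j < 3" "i \<noteq> j" and u: "u \<in> ?Y i" and v: "v \<in> ?Y j" for i j u v
    proof (cases "u \<in> set (X i)")
      case ui: True
      show ?thesis
      proof (cases "v \<in> set (X j)")
        case True
        then show ?thesis using cr[OF ij] ui unfolding cross_def by blast
      next
        case False
        then have "v = c j" "?T j" using v by (auto split: if_splits)
        then show ?thesis using cX[OF ij(2) _ ij(1,3) ui] hl(1,2)[OF ij(2)] False by auto
      qed
    next
      case uc: False
      then have uc': "u = c i" "?T i" using u by (auto split: if_splits)
      show ?thesis
      proof (cases "v \<in> set (X j)")
        case True
        then show ?thesis using cX[OF ij(1) uc'(2) ij(2) _ True] ij(3) uc' hl[OF ij(1)] uc by auto
      next
        case False
        then have "v = c j" "?T j" using v by (auto split: if_splits)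
        then show ?thesis using cc[OF ij(1) uc'(2) ij(2)] ij(3) uc' hl[OF ij(1)] uc by auto
      qed
    qed
    show "hd (X i) \<in> ?Y i \<and> last (X i) \<in> ?Y i \<and> ?y i \<in> ?Y i \<and> ?z i \<in> ?Y i" if "i < 3" for i
      using hl[OF that] la(1)[OF that] lb(1)[OF that] by simp
    show "hd (X i) \<noteq> last (X i) \<and> ?y i \<noteq> hd (X i) \<and> ?y i \<noteq> last (X i) \<and> ?z i \<noteq> hd (X i) \<and> ?z i \<noteq> last (X i)" if "i < 3" for i
    proof (cases "?T i")
      case True
      have "c i \<noteq> hd (X i)" "c i \<noteq> last (X i)" using c[OF that True] irr by metis+
      then show ?thesis using True two[OF that True] by simp
    next
      case False
      then show ?thesis using la[OF that False] lb[OF that False] by simp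
    qed
    show "F (hd (X i)) (?y i) \<and> F (last (X i)) (?z i)" if "i < 3" for i
      using c[OF that] la(4)[OF that] lb(4)[OF that] symF by simp
    show "ipath F (X i) \<and> hd (X i) = hd (X i) \<and> last (X i) = last (X i) \<and> set (X i) \<subseteq> ?Y i \<and> 2 \<le> length (X i)" if "i < 3" for i
      using X[OF that] by auto
    show "?y i = ?z i \<and> F (hd (X i)) (last (X i)) \<or>
       (\<exists>g \<in> ?Y i. F (?y i) g \<and> \<not> F (hd (X i)) g \<and> g \<noteq> hd (X i)) \<and> (\<exists>g \<in> ?Y i. F (?z i) g \<and> \<not> F (last (X i)) g \<and> g \<noteq> last (X i))" if "i < 3" for i
      using two(1)[OF that] la(6)[OF that] lb(5)[OF that] by (cases "?T i") simp_all
  qed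
qed

section \<open>Translation to digraphs\<close>

abbreviation (input) adj_rel :: "('a, 'b) pre_digraph \<Rightarrow> 'a \<Rightarrow> 'a \<Rightarrow> bool" where
  "adj_rel G \<equiv> \<lambda>u v. (u, v) \<in> arcs_ends G"

context graph
begin

abbreviation (input) heavy_vertex :: "'a \<Rightarrow> bool" where
  "heavy_vertex v \<equiv> v \<in> verts G \<and> card (verts G) + 3 \<le> 3 * card {u. v \<rightarrow> u}"

lemma sgraph_adj: "sgraph (verts G) (adj_rel G)"
  unfolding sgraph_def
proof (intro conjI allI impI)
  show "finite (verts G)" by simp
  fix x y assume xy: "x \<rightarrow> y"
  show "x \<in> verts G" "y \<in> verts G" using adj_in_verts[OF xy] by auto
  show "y \<rightarrow> x" using arcs_ends_symmetric[OF sym_arcs xy] .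
  show "x \<noteq> y" using xy adj_not_same by blast
qed

lemma out_degree_adj: "out_degree G v = card {u. v \<rightarrow> u}"
proof -
  have "{u. v \<rightarrow> u} = head G ` out_arcs G v"
    unfolding arcs_ends_conv out_arcs_def by auto
  moreover have "inj_on (head G) (out_arcs G v)"
    by (rule inj_onI) (auto simp: out_arcs_def arc_to_ends_def intro!: no_multi_arcs)
  ultimately show ?thesis unfolding out_degree_def by (simp add: card_image)
qed

lemma arcs_ends_induce: "arcs_ends (G \<restriction> W) = {(u, v) \<in> arcs_ends G. u \<in> W \<and> v \<in> W}"
  unfolding arcs_ends_conv by auto

lemma graph_induce:
  assumes "W \<subseteq> verts G"
  shows "graph (G \<restriction> W)"
proof -
  interpret H: wf_digraph "G \<restriction> W" by (rule wellformed_induce_subgraph)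
  show ?thesis
  proof
    show "finite (verts (G \<restriction> W))" using finite_subset[OF assms finite_verts] by simp
    show "finite (arcs (G \<restriction> W))" by simp
    show "tail (G \<restriction> W) e \<noteq> head (G \<restriction> W) e" if "e \<in> arcs (G \<restriction> W)" for e
      using that no_loops by auto
    show "e1 = e2" if "e1 \<in> arcs (G \<restriction> W)" "e2 \<in> arcs (G \<restriction> W)"
      "arc_to_ends (G \<restriction> W) e1 = arc_to_ends (G \<restriction> W) e2" for e1 e2
      using that no_multi_arcs[of e1 e2] by (auto simp: arc_to_ends_def)
    show "symmetric (G \<restriction> W)"
      using sym_arcs unfolding symmetric_def arcs_ends_induce sym_def by blast
  qed
qed

lemma claw_free_clawfree:
  assumes cf: "claw_free G"
  shows "clawfree (adj_rel G)"
  unfolding clawfree_def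
proof (intro allI impI, rule ccontr)
  fix x a b c
  assume h: "x \<rightarrow> a \<and> x \<rightarrow> b \<and> x \<rightarrow> c \<and> a \<noteq> b \<and> a \<noteq> c \<and> b \<noteq> c"
    and n: "\<not> (a \<rightarrow> b \<or> a \<rightarrow> c \<or> b \<rightarrow> c)"
  note s = sgraphD[OF sgraph_adj]
  let ?C = "G \<restriction> {x, a, b, c}"
  have sub: "{x, a, b, c} \<subseteq> verts G" using h s(1,2) by blast
  have rev: "a \<rightarrow> x" "b \<rightarrow> x" "c \<rightarrow> x"
    "\<not> b \<rightarrow> a" "\<not> c \<rightarrow> a" "\<not> c \<rightarrow> b"
    using h n s(3) by blast+
  have irr: "\<not> v \<rightarrow> v" for v using s(4) by blast
  have "arcs_ends ?C = {x} \<times> {a, b, c} \<union> {a, b, c} \<times> {x}"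
    unfolding arcs_ends_induce using h n rev irr by auto
  moreover have "x \<noteq> a" "x \<noteq> b" "x \<noteq> c" using h irr by auto
  then have "verts ?C = {x} \<union> {a, b, c}" "{x} \<inter> {a, b, c} = {}" "card {x} = 1" "card {a, b, c} = 3"
    using h by auto
  ultimately have "K\<^bsub>1,3\<^esub> ?C"
    unfolding complete_bipartite_digraph_def using graph_induce[OF sub] by blast
  then show False using cf induced_induce[OF sub] unfolding claw_free_def by blast
qed

lemma k_connected_twoconn:
  assumes "k_connected 2 G"
  shows "twoconn (verts G) (adj_rel G)"
  unfolding twoconn_def
proof (intro conjI allI ballI)
  show "3 \<le> card (verts G)" using assms unfolding k_connected_def by simp
  fix x u v assume uv: "u \<in> verts G - {x}" "v \<in> verts G - {x}"
  let ?W = "verts G - {x}"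
  \<comment> \<open>Here \<open>x\<close> need not be a vertex of the graph, so the separating set
    is its intersection with the vertices.\<close>
  have "card ({x} \<inter> verts G) \<le> 1" using card_mono[of "{x}" "{x} \<inter> verts G"] by simp
  then have "connected (G \<restriction> (verts G - {x} \<inter> verts G))"
    using assms unfolding k_connected_def by auto
  moreover have "verts G - {x} \<inter> verts G = ?W" by blast
  ultimately have "connected (G \<restriction> ?W)" by simp
  then have r: "u \<rightarrow>\<^sup>*\<^bsub>mk_symmetric (G \<restriction> ?W)\<^esub> v"
    using uv unfolding connected_def strongly_connected_def by simp
  interpret H: graph "G \<restriction> ?W" by (rule graph_induce) auto
  have "u \<rightarrow>\<^sup>*\<^bsub>G \<restriction> ?W\<^esub> v" using r H.reachable_mk_symmetric_eq[OF H.sym_arcs] by blast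
  then show "linked (adj_rel G) ?W u v"
  proof (induction rule: H.reachable_induct)
    case base
    then show ?case by simp
  next
    case (step p q)
    then have "p \<rightarrow> q" "p \<in> ?W" "q \<in> ?W" unfolding arcs_ends_induce by auto
    then have "linked (adj_rel G) ?W p q" by (rule linked_edge)
    with step.IH show ?case by (rule linked_trans)
  qed
qed

lemma walk_of_successively:
  assumes "xs \<noteq> []" "successively (adj_rel G) xs" "set xs \<subseteq> verts G"
  shows "\<exists>p. awalk (hd xs) p (last xs) \<and> awalk_verts (hd xs) p = xs"
  using assms
proof (induction xs rule: list_nonempty_induct)
  case (single x)
  then show ?case by (intro exI[of _ "[]"]) (auto simp: awalk_def)
next
  case (cons x xs)
  then obtain p where p: "awalk (hd xs) p (last xs)" "awalk_verts (hd xs) p = xs"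
    by (auto simp: successively_Cons)
  have "x \<rightarrow> hd xs" using cons by (auto simp: successively_Cons)
  then obtain e where e: "e \<in> arcs G" "tail G e = x" "head G e = hd xs" by auto
  have "awalk x (e # p) (last xs)" using p(1) e by (auto simp: awalk_def)
  moreover have "awalk_verts x (e # p) = x # xs" using p(2) e by simp
  ultimately show ?case using cons.hyps by (intro exI[of _ "e # p"]) auto
qed

lemma map_tail_walk: "map (tail G) p = butlast (awalk_verts u p)"
proof (induction p arbitrary: u)
  case (Cons e p)
  have "awalk_verts (head G e) p \<noteq> []" by (cases p) auto
  then show ?case using Cons.IH[of "head G e"] by simp
qed simp

lemma ham_hamiltonian:
  assumes "ham (verts G) (adj_rel G)"
  shows "hamiltonian G"
proof -
  obtain xs where xs: "cyc (adj_rel G) xs" "set xs = verts G" using assms unfolding ham_def by blast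
  then have x: "3 \<le> length xs" "distinct xs" "successively (adj_rel G) xs" "last xs \<rightarrow> hd xs"
    unfolding cyc_def by auto
  have ne: "xs \<noteq> []" using x(1) by auto
  let ?ys = "xs @ [hd xs]"
  have "successively (adj_rel G) ?ys" using x(3,4) ne by (auto simp: successively_append_iff)
  moreover have "set ?ys \<subseteq> verts G" unfolding xs(2)[symmetric] using ne by simp
  ultimately obtain p where p: "awalk (hd ?ys) p (last ?ys)" "awalk_verts (hd ?ys) p = ?ys"
    using walk_of_successively[of ?ys] by blast
  then have p': "awalk (hd xs) p (hd xs)" "awalk_verts (hd xs) p = ?ys" using ne by auto
  have len: "length p = length xs" using length_awalk_verts[of "hd xs" p] p'(2) by simp
  have "distinct (tl ?ys)" using x(2) ne by (cases xs) auto
  then have "cycle p" unfolding cycle_def using p' len ne by (intro exI[of _ "hd xs"]) auto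
  moreover have "tail G ` set p = verts G"
  proof -
    have "set (map (tail G) p) = set xs" using map_tail_walk[of p "hd xs"] p'(2) by simp
    then show ?thesis using xs(2) by simp
  qed
  ultimately show ?thesis unfolding hamiltonian_def using len x(1) by (intro exI[of _ p]) auto
qed

text \<open>The isomorphism maps each vertex to its position in \<open>vs\<close>. Position
  \<open>k\<close> is the only neighbour of \<open>i\<close> in the pattern, so
  \<open>vs ! i\<close> is an end-vertex of the copy.\<close>

lemma induced_copy_degree:
  assumes Phi: "satisfies_Phi G (undirected {..<n} P) t"
    and vs: "length vs = n" "distinct vs" "set vs \<subseteq> verts G"
    and P: "\<And>i j. i < n \<Longrightarrow> j < n \<Longrightarrow> vs ! i \<rightarrow> vs ! j \<longleftrightarrow> (i, j) \<in> P \<or> (j, i) \<in> P"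
    and Pn: "P \<subseteq> {..<n} \<times> {..<n}"
    and k: "i < n" "k < n" "\<And>j. j < n \<Longrightarrow> (i, j) \<in> P \<or> (j, i) \<in> P \<longleftrightarrow> j = k"
  shows "(real (card (verts G)) + t) / 3 \<le> real (card {u. vs ! i \<rightarrow> u})"
proof -
  let ?S = "G \<restriction> set vs" and ?H = "undirected {..<n} P"
  interpret S: graph ?S by (rule graph_induce[OF vs(3)])
  define idx where "idx = the_inv_into {..<n} ((!) vs)"
  have inj: "inj_on ((!) vs) {..<n}" using vs(1,2) by (auto simp: inj_on_def nth_eq_iff_index_eq)
  have img: "(!) vs ` {..<n} = set vs" using vs(1) by (auto simp: set_conv_nth)
  have idx: "idx (vs ! j) = j" if "j < n" for j
    unfolding idx_def using the_inv_into_f_f[OF inj, of j] that by simp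
  have idx': "idx v < n" "vs ! idx v = v" if "v \<in> set vs" for v
  proof -
    obtain j where "j < n" "v = vs ! j" using \<open>v \<in> set vs\<close> vs(1) by (auto simp: in_set_conv_nth)
    then show "idx v < n" "vs ! idx v = v" using idx by auto
  qed
  define f where "f = \<lparr>iso_verts = idx, iso_arcs = (\<lambda>e. (idx (tail G e), idx (head G e))),
     iso_head = snd, iso_tail = fst\<rparr>"
  have "S.digraph_isomorphism f"
    unfolding S.digraph_isomorphism_def
  proof (intro conjI)
    show "wf_digraph ?S" by unfold_locales
    show "inj_on (iso_verts f) (verts ?S)" unfolding f_def by (auto intro!: inj_onI) (metis idx'(2))
    show "inj_on (iso_arcs f) (arcs ?S)"
    proof (rule inj_onI)
      fix e e' assume e: "e \<in> arcs ?S" "e' \<in> arcs ?S" and eq: "iso_arcs f e = iso_arcs f e'"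
      have "tail G e = tail G e'" "head G e = head G e'"
        using e eq idx'(2) unfolding f_def by (simp, metis)+
      then show "e = e'" using no_multi_arcs[of e e'] e unfolding arc_to_ends_def by simp
    qed
    show "\<forall>e \<in> arcs ?S. iso_verts f (tail ?S e) = iso_tail f (iso_arcs f e) \<and>
      iso_verts f (head ?S e) = iso_head f (iso_arcs f e)" unfolding f_def by simp
  qed
  moreover have "?H = app_iso f ?S"
  proof -
    have "idx ` set vs = {..<n}" unfolding img[symmetric] image_image using idx by auto
    moreover have "(\<lambda>e. (idx (tail G e), idx (head G e))) ` arcs ?S = P \<union> P\<inverse>"
    proof (intro equalityI subsetI)
      fix q assume "q \<in> (\<lambda>e. (idx (tail G e), idx (head G e))) ` arcs ?S"
      then obtain e where e: "e \<in> arcs G" "tail G e \<in> set vs" "head G e \<in> set vs"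
        "q = (idx (tail G e), idx (head G e))" by auto
      have "tail G e \<rightarrow> head G e" using e(1) unfolding arcs_ends_conv by blast
      then show "q \<in> P \<union> P\<inverse>"
        using P[of "idx (tail G e)" "idx (head G e)"] idx' e by auto
    next
      fix q assume "q \<in> P \<union> P\<inverse>"
      then obtain l m where lm: "q = (l, m)" "(l, m) \<in> P \<or> (m, l) \<in> P" by (cases q) auto
      then have lt: "l < n" "m < n" using Pn by auto
      then have "vs ! l \<rightarrow> vs ! m" using P lm by blast
      then obtain e where e: "e \<in> arcs G" "tail G e = vs ! l" "head G e = vs ! m" by auto
      then have "e \<in> arcs ?S" using lt vs(1) by auto
      moreover have "q = (idx (tail G e), idx (head G e))" using e lm(1) idx lt by simp
      ultimately show "q \<in> (\<lambda>e. (idx (tail G e), idx (head G e))) ` arcs ?S" by blast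
    qed
    ultimately show ?thesis unfolding undirected_def with_proj_def app_iso_def f_def by simp
  qed
  ultimately have iso: "digraph_iso ?S ?H" unfolding digraph_iso_def by blast
  have ivs: "vs ! i \<in> set vs" using k(1) vs(1) by auto
  have "{u. (vs ! i, u) \<in> arcs_ends ?S} = {vs ! k}"
  proof (intro equalityI subsetI)
    fix u assume "u \<in> {u. (vs ! i, u) \<in> arcs_ends ?S}"
    then have u: "vs ! i \<rightarrow> u" "u \<in> set vs" unfolding arcs_ends_induce by auto
    then have "idx u = k" using P[OF k(1), of "idx u"] k(3)[of "idx u"] idx'[OF u(2)] by auto
    then show "u \<in> {vs ! k}" using idx'(2)[OF u(2)] by simp
  next
    fix u assume u: "u \<in> {vs ! k}"
    have "vs ! i \<rightarrow> vs ! k" using P[OF k(1,2)] k(3)[OF k(2)] by blast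
    then show "u \<in> {u. (vs ! i, u) \<in> arcs_ends ?S}"
      using u ivs k(2) vs(1) unfolding arcs_ends_induce by auto
  qed
  then have "out_degree ?S (vs ! i) = 1" using S.out_degree_adj by simp
  then have "end_vertex ?S (vs ! i)" using ivs unfolding end_vertex_def by simp
  moreover have "induced_subgraph ?S G" using induced_induce[OF vs(3)] .
  ultimately have "(real (card (verts G)) + t) / 3 \<le> real (out_degree G (vs ! i))"
    using Phi iso ivs vs(3) unfolding satisfies_Phi_def by blast
  then show ?thesis using out_degree_adj by simp
qed

lemma heavy_copy:
  assumes Phi: "satisfies_Phi G (undirected {..<6} P) 3"
    and vs: "length vs = 6" "distinct vs" "set vs \<subseteq> verts G"
    and P: "\<forall>i<6. \<forall>j<6. vs ! i \<rightarrow> vs ! j \<longleftrightarrow> (i, j) \<in> P \<or> (j, i) \<in> P"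
    and Pn: "P \<subseteq> {..<6} \<times> {..<6}"
    and k: "i < 6" "k < 6" "\<forall>j<6. (i, j) \<in> P \<or> (j, i) \<in> P \<longleftrightarrow> j = k"
  shows "heavy_vertex (vs ! i)"
proof
  show "vs ! i \<in> verts G" using vs k(1) by auto
  have "(real (card (verts G)) + 3) / 3 \<le> real (card {u. vs ! i \<rightarrow> u})"
    by (rule induced_copy_degree[OF Phi vs _ Pn k(1,2)]) (use P k(3) in blast)+
  then have "real (card (verts G) + 3) \<le> real (3 * card {u. vs ! i \<rightarrow> u})" by simp
  then show "card (verts G) + 3 \<le> 3 * card {u. vs ! i \<rightarrow> u}" using of_nat_le_iff by blast
qed

end

section \<open>The three graphs as lists of six vertices\<close>

lemma all_less_6: "(\<forall>i<6. Q i) \<longleftrightarrow> Q 0 \<and> Q 1 \<and> Q 2 \<and> Q 3 \<and> Q 4 \<and> Q (5::nat)"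
proof
  show "\<forall>i<6. Q i" if Q: "Q 0 \<and> Q 1 \<and> Q 2 \<and> Q 3 \<and> Q 4 \<and> Q (5::nat)"
  proof (intro allI impI)
    fix i :: nat assume "i < 6"
    then have "i = 0 \<or> i = 1 \<or> i = 2 \<or> i = 3 \<or> i = 4 \<or> i = 5" by linarith
    then show "Q i" using Q by (elim disjE) simp_all
  qed
qed simp

lemma path_graph_6: "path_graph 6 = undirected {..<6} {(0, 1), (1, 2), (2, 3), (3, 4), (4, 5)}"
proof -
  have "{(i, Suc i) | i. Suc i < 6} = (\<lambda>i. (i, Suc i)) ` {..<5}" by auto
  also have "{..<5} = {0, 1, 2, 3, 4::nat}" by auto
  finally have "{(i, Suc i) | i. Suc i < 6} = {(0, 1), (1, 2), (2, 3), (3, 4), (4, 5)}"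
    by (simp add: eval_nat_numeral)
  then show ?thesis unfolding path_graph_def by (rule arg_cong)
qed

context graph
begin

lemma heavy_P6:
  assumes Phi: "satisfies_Phi G (path_graph 6) 3" and Q: "ipath (adj_rel G) Q" "length Q = 6"
  shows "heavy_vertex (hd Q)"
proof -
  note s = sgraphD[OF sgraph_adj]
  obtain v0 v1 v2 v3 v4 v5 where Qv: "Q = [v0, v1, v2, v3, v4, v5]"
    using Q(2) by (auto simp: eval_nat_numeral length_Suc_conv)
  have irr: "\<not> v \<rightarrow> v" for v using s(4) by blast
  have ns: "\<not> v \<rightarrow> u" if "\<not> u \<rightarrow> v" for u v using s(3) that by blast
  have "heavy_vertex (Q ! 0)"
  proof (rule heavy_copy[OF Phi[unfolded path_graph_6] Q(2), of 0 1])
    show "distinct Q" using Q(1) by (rule ipath_distinct)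
    have e: "v0 \<rightarrow> v1" "v1 \<rightarrow> v2" "v2 \<rightarrow> v3" "v3 \<rightarrow> v4" "v4 \<rightarrow> v5"
      using Q(1) unfolding Qv by auto
    show "set Q \<subseteq> verts G" using e s(1,2) unfolding Qv by auto
    have n: "\<not> v0 \<rightarrow> v2" "\<not> v0 \<rightarrow> v3" "\<not> v0 \<rightarrow> v4" "\<not> v0 \<rightarrow> v5"
      "\<not> v1 \<rightarrow> v3" "\<not> v1 \<rightarrow> v4" "\<not> v1 \<rightarrow> v5"
      "\<not> v2 \<rightarrow> v4" "\<not> v2 \<rightarrow> v5" "\<not> v3 \<rightarrow> v5"
      using Q(1) unfolding Qv by auto
    note e' = e[THEN s(3)] and n' = n[THEN ns]
    show "\<forall>i<6. \<forall>j<6. Q ! i \<rightarrow> Q ! j \<longleftrightarrow>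
      (i, j) \<in> {(0, 1), (1, 2), (2, 3), (3, 4), (4, 5)} \<or> (j, i) \<in> {(0, 1), (1, 2), (2, 3), (3, 4), (4, 5)}"
      unfolding all_less_6 Qv using e n e' n' irr by simp
  qed (auto simp: all_less_6)
  then show ?thesis unfolding Qv by simp
qed

text \<open>With all pairs of the pattern increasing, adjacency has to be checked only for
  \<open>i < j\<close>; symmetry and the absence of loops give the rest.\<close>

lemma pattern_6:
  assumes Phi: "satisfies_Phi G (undirected {..<6} P) 3"
    and sub: "P \<subseteq> {..<6} \<times> {..<6}"
    and d: "distinct [v0, v1, v2, v3, v4, v5]" and V: "set [v0, v1, v2, v3, v4, v5] \<subseteq> verts G"
    and P: "\<And>i j. i < j \<Longrightarrow> j < 6 \<Longrightarrow>
      (([v0, v1, v2, v3, v4, v5] ! i, [v0, v1, v2, v3, v4, v5] ! j) \<in> arcs_ends G \<longleftrightarrow> (i, j) \<in> P) \<and> (j, i) \<notin> P"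
    and irrP: "\<And>i. (i, i) \<notin> P"
    and k: "i < 6" "k < 6" "\<forall>j<6. (i, j) \<in> P \<or> (j, i) \<in> P \<longleftrightarrow> j = k"
  shows "heavy_vertex ([v0, v1, v2, v3, v4, v5] ! i)"
proof (rule heavy_copy[OF Phi _ d V _ sub k])
  note s = sgraphD[OF sgraph_adj]
  let ?vs = "[v0, v1, v2, v3, v4, v5]"
  show "\<forall>i<6. \<forall>j<6. ?vs ! i \<rightarrow> ?vs ! j \<longleftrightarrow> (i, j) \<in> P \<or> (j, i) \<in> P"
  proof (intro allI impI)
    fix i j :: nat assume ij: "i < 6" "j < 6"
    consider "i < j" | "j < i" | "i = j" by linarith
    then show "?vs ! i \<rightarrow> ?vs ! j \<longleftrightarrow> (i, j) \<in> P \<or> (j, i) \<in> P"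
    proof cases
      case 1
      then show ?thesis using P[OF 1 ij(2)] by blast
    next
      case 2
      then show ?thesis using P[OF 2 ij(1)] s(3)[of "?vs ! i" "?vs ! j"] s(3)[of "?vs ! j" "?vs ! i"] by blast
    next
      case 3
      then show ?thesis using irrP s(4)[of "?vs ! i" "?vs ! i"] by blast
    qed
  qed
qed simp

lemma heavy_net:
  assumes Phi: "satisfies_Phi G net 3" and g: "gen_net (adj_rel G) Y" and len: "\<And>j. j < 3 \<Longrightarrow> 2 \<le> length (Y j)"
    and i: "i < 3"
  shows "heavy_vertex (Y i ! 1)"
proof -
  note s = sgraphD[OF sgraph_adj]
  have "\<exists>t u R. Y j = t # u # R" if "j < 3" for j using len[OF that] by (cases "Y j"; cases "tl (Y j)") auto
  then obtain t u R where Y: "\<And>j. j < 3 \<Longrightarrow> Y j = t j # u j # R j" by metis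
  have tu: "t j \<rightarrow> u j" "t j \<noteq> u j" if "j < 3" for j
  proof -
    have "ipath (adj_rel G) (Y j)" using g that unfolding gen_net_def by blast
    then show "t j \<rightarrow> u j" "t j \<noteq> u j" unfolding Y[OF that] by auto
  qed
  have cr: "p \<noteq> q \<and> (p \<rightarrow> q \<longleftrightarrow> p = t j \<and> q = t k)"
    if "j < 3" "k < 3" "j \<noteq> k" "p = t j \<or> p = u j" "q = t k \<or> q = u k" for j k p q
  proof -
    have "p \<in> set (Y j)" "q \<in> set (Y k)" "hd (Y j) = t j" "hd (Y k) = t k" using that Y by auto
    then show ?thesis using g that unfolding gen_net_def by metis
  qed
  have c: "t 0 \<noteq> t 1 \<and> t 0 \<rightarrow> t 1" "t 0 \<noteq> t 2 \<and> t 0 \<rightarrow> t 2" "t 1 \<noteq> t 2 \<and> t 1 \<rightarrow> t 2"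
    "t 0 \<noteq> u 1 \<and> \<not> t 0 \<rightarrow> u 1" "t 0 \<noteq> u 2 \<and> \<not> t 0 \<rightarrow> u 2" "t 1 \<noteq> u 0 \<and> \<not> t 1 \<rightarrow> u 0"
    "t 1 \<noteq> u 2 \<and> \<not> t 1 \<rightarrow> u 2" "t 2 \<noteq> u 0 \<and> \<not> t 2 \<rightarrow> u 0" "t 2 \<noteq> u 1 \<and> \<not> t 2 \<rightarrow> u 1"
    "u 0 \<noteq> u 1 \<and> \<not> u 0 \<rightarrow> u 1" "u 0 \<noteq> u 2 \<and> \<not> u 0 \<rightarrow> u 2" "u 1 \<noteq> u 2 \<and> \<not> u 1 \<rightarrow> u 2"
    using cr[of 0 1 "t 0" "t 1"] cr[of 0 2 "t 0" "t 2"] cr[of 1 2 "t 1" "t 2"] cr[of 0 1 "t 0" "u 1"] cr[of 0 2 "t 0" "u 2"]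
      cr[of 1 0 "t 1" "u 0"] cr[of 1 2 "t 1" "u 2"] cr[of 2 0 "t 2" "u 0"] cr[of 2 1 "t 2" "u 1"]
      cr[of 0 1 "u 0" "u 1"] cr[of 0 2 "u 0" "u 2"] cr[of 1 2 "u 1" "u 2"] tu[of 0] tu[of 1] tu[of 2] by auto
  note tu3 = tu[of 0] tu[of 1] tu[of 2]
  let ?vs = "[t 0, t 1, t 2, u 0, u 1, u 2]"
  \<comment> \<open>The end-vertices of the net are at positions 3, 4, 5, attached to the triangle
    vertices 0, 1, 2 in this order.\<close>
  have "heavy_vertex (?vs ! (3 + i))"
  proof (rule pattern_6[OF Phi[unfolded net_def], where k = i])
    show "distinct ?vs" using c tu3 by auto
    show "set ?vs \<subseteq> verts G" using s(1,2) tu3 by auto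
    show "(?vs ! l \<rightarrow> ?vs ! m \<longleftrightarrow> (l, m) \<in> {(0, 1), (1, 2), (0, 2), (0, 3), (1, 4), (2, 5)}) \<and>
      (m, l) \<notin> {(0, 1), (1, 2), (0, 2), (0, 3), (1, 4), (2, 5)}" if "l < m" "m < 6" for l m :: nat
    proof -
      have "m = 0 \<or> m = 1 \<or> m = 2 \<or> m = 3 \<or> m = 4 \<or> m = 5" "l = 0 \<or> l = 1 \<or> l = 2 \<or> l = 3 \<or> l = 4" using that by auto
      then show ?thesis using that(1) c tu3 by (elim disjE) simp_all
    qed
    show "\<forall>j<6. (3 + i, j) \<in> {(0, 1), (1, 2), (0, 2), (0, 3), (1, 4), (2, 5)} \<or>
      (j, 3 + i) \<in> {(0, 1), (1, 2), (0, 2), (0, 3), (1, 4), (2, 5)} \<longleftrightarrow> j = i"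
      using less_3_cases[OF i] by (elim disjE) (simp_all add: all_less_6)
  qed (use i in auto)
  moreover have "?vs ! (3 + i) = Y i ! 1" using less_3_cases[OF i] Y[of 0] Y[of 1] Y[of 2] by auto
  ultimately show ?thesis by simp
qed

lemma heavy_wounded:
  assumes Phi: "satisfies_Phi G wounded 3" and g: "gen_net (adj_rel G) Y" and ij: "i < 3" "j < 3" "i \<noteq> j"
    and len: "2 \<le> length (Y i)" "3 \<le> length (Y j)"
  shows "heavy_vertex (Y i ! 1)"
    "heavy_vertex (Y j ! 2)"
proof -
  note s = sgraphD[OF sgraph_adj]
  obtain k where k: "k < 3" "i \<noteq> k" "j \<noteq> k" using third[OF ij] by metis
  obtain x Rk where Yk: "Y k = x # Rk" using g k(1) unfolding gen_net_def by (metis list.exhaust)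
  obtain y y' Ri where Yi: "Y i = y # y' # Ri" using len(1) by (cases "Y i"; cases "tl (Y i)") auto
  obtain z u w Rj where Yj: "Y j = z # u # w # Rj" using len(2) by (cases "Y j"; cases "tl (Y j)"; cases "tl (tl (Y j))") auto
  have ip: "ipath (adj_rel G) (Y i)" "ipath (adj_rel G) (Y j)" using g ij unfolding gen_net_def by blast+
  have e: "y \<rightarrow> y'" "y \<noteq> y'" "z \<rightarrow> u" "z \<noteq> u" "u \<rightarrow> w" "u \<noteq> w" "z \<noteq> w" "\<not> z \<rightarrow> w"
    using ip unfolding Yi Yj by auto
  have cr: "p \<noteq> q \<and> (p \<rightarrow> q \<longleftrightarrow> p = hd (Y l) \<and> q = hd (Y m))"
    if "l < 3" "m < 3" "l \<noteq> m" "p \<in> set (Y l)" "q \<in> set (Y m)" for l m p q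
    using g that unfolding gen_net_def by blast
  note ki = cr[OF k(1) ij(1) k(2)[symmetric], unfolded Yk Yi] and kj = cr[OF k(1) ij(2) k(3)[symmetric], unfolded Yk Yj]
    and ij' = cr[OF ij, unfolded Yi Yj]
  have c: "x \<noteq> y \<and> x \<rightarrow> y" "x \<noteq> z \<and> x \<rightarrow> z" "x \<noteq> y' \<and> \<not> x \<rightarrow> y'"
    "x \<noteq> u \<and> \<not> x \<rightarrow> u" "x \<noteq> w \<and> \<not> x \<rightarrow> w"
    "y \<noteq> z \<and> y \<rightarrow> z" "y \<noteq> u \<and> \<not> y \<rightarrow> u" "y \<noteq> w \<and> \<not> y \<rightarrow> w"
    "y' \<noteq> z \<and> \<not> y' \<rightarrow> z" "y' \<noteq> u \<and> \<not> y' \<rightarrow> u" "y' \<noteq> w \<and> \<not> y' \<rightarrow> w"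
    using ki[of x y] kj[of x z] ki[of x y'] kj[of x u] kj[of x w] ij'[of y z] ij'[of y u] ij'[of y w] ij'[of y' z] ij'[of y' u] ij'[of y' w] e
    by auto
  have zy: "\<not> z \<rightarrow> y'" using c(9) s(3) by blast
  let ?vs = "[x, y, z, y', u, w]" and ?P = "{(0, 1), (1, 2), (0, 2), (1, 3), (2, 4), (4, 5)} :: (nat \<times> nat) set"
  \<comment> \<open>Positions 3 and 5 are the two end-vertices of the wounded graph, with neighbours
    at 1 and 4.\<close>
  have main: "heavy_vertex (?vs ! n)"
    if n: "n = 3 \<and> m = 1 \<or> n = 5 \<and> m = 4" for n m :: nat
  proof (rule pattern_6[OF Phi[unfolded wounded_def], where k = m])
    show "distinct ?vs" using c e by auto
    show "set ?vs \<subseteq> verts G" using s(1,2) e c(1) by auto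
    show "(?vs ! l \<rightarrow> ?vs ! m \<longleftrightarrow> (l, m) \<in> ?P) \<and> (m, l) \<notin> ?P" if "l < m" "m < 6" for l m :: nat
    proof -
      have "m = 0 \<or> m = 1 \<or> m = 2 \<or> m = 3 \<or> m = 4 \<or> m = 5" "l = 0 \<or> l = 1 \<or> l = 2 \<or> l = 3 \<or> l = 4" using that by auto
      then show ?thesis using that(1) c e zy by (elim disjE) simp_all
    qed
    show "\<forall>j<6. (n, j) \<in> ?P \<or> (j, n) \<in> ?P \<longleftrightarrow> j = m"
      using n by (elim disjE) (simp_all add: all_less_6)
  qed (use n in auto)
  show "heavy_vertex (Y i ! 1)"
    using main[of 3 1] unfolding Yi by simp
  show "heavy_vertex (Y j ! 2)"
    using main[of 5 4] unfolding Yj by simp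
qed

end

theorem theorem5:
  fixes G :: "('a, 'b) pre_digraph" and H :: "(nat, nat \<times> nat) pre_digraph"
  assumes "graph G"
    and "H \<in> {path_graph 6, net, wounded}"
    and "k_connected 2 G"
    and "claw_free G"
    and "satisfies_Phi G H 3"
  shows "hamiltonian G"
proof (rule ccontr)
  assume nonham: "\<not> hamiltonian G"
  interpret G: graph G by (rule assms(1))
  let ?E = "adj_rel G"
  have cfE: "clawfree ?E" using G.claw_free_clawfree[OF assms(4)] .
  obtain F where F: "sgraph (verts G) F" "clawfree F" "diamondfree F" "\<And>u v. ?E u v \<Longrightarrow> F u v"
    "ham (verts G) F \<Longrightarrow> ham (verts G) ?E" "\<And>u v. F u v \<Longrightarrow> linked ?E (region F u v) u v"
    using closure_exists[OF G.sgraph_adj cfE] by blast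
  have nh: "\<not> ham (verts G) F" using F(5) G.ham_hamiltonian nonham by blast
  interpret closure_pair "verts G" F ?E
    by unfold_locales (use F G.sgraph_adj cfE in simp_all)
  have "linked F X u v" if "linked ?E X u v" for X u v
    using that
  proof (induction rule: linked_induct)
    case (step p q)
    then have "linked F X p q" using F(4) by (blast intro: linked_edge)
    with step.IH show ?case by (rule linked_trans)
  qed simp
  then have "twoconn (verts G) F" using G.k_connected_twoconn[OF assms(3)] unfolding twoconn_def by blast
  then obtain X c where "theta F (verts G) X c" using nonham_theta nh by blast
  then obtain Y y z where "arms (verts G) F ?E Y X (\<lambda>i. hd (X i)) (\<lambda>i. last (X i)) y z"
    using arms_of_theta nh by blast
  then interpret arms "verts G" F ?E Y X "\<lambda>i. hd (X i)" "\<lambda>i. last (X i)" y z .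
  consider "H = path_graph 6" | "H = net" | "H = wounded" using assms(2) by blast
  then show False
  proof cases
    case 1
    have "heavy (hd Q)" if "ipath ?E Q" "length Q = 6" for Q
      using G.heavy_P6[OF _ that] assms(5) 1 unfolding heavy_def by blast
    then show False by (rule P6_absurd)
  next
    case 2
    have net_heavy
      unfolding net_heavy_def heavy_def using G.heavy_net assms(5) 2 by blast
    then show False by (rule net_absurd)
  next
    case 3
    have wounded_heavy
      unfolding wounded_heavy_def heavy_def using G.heavy_wounded assms(5) 3 by blast
    then show False by (rule wounded_absurd)
  qed
qed

end
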